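(* Let $V(x)=V(-x)$, $x\in\mathbb{R}$, be an even Hermitian $N\times N$ matrix function with Hölder continuous entries, let $\rho=\exp(-V)$, and assume that the measure $\rho(x)\,dx$ has finite moments, with its family of monic matrix orthogonal polynomials $P_n$. For each $n\ge1$, consider the Riemann--Hilbert problem of finding a $2N\times2N$ matrix function $Y_n(z)$ such that: 1. $Y_n$ is analytic in $\mathbb{C}\setminus\mathbb{R}$; 2. $Y_n(z)=(\mathbb{I}_{2N}+O(z^{-1}))\begin{pmatrix}\mathbb{I}_Nz^n&0\\0&\mathbb{I}_Nz^{-n}\end{pmatrix}$ as $z\to\infty$; 3. on $\mathbb{R}$ the (continuous) boundary values $Y_n(x)_\pm=Y_n(x\pm i0)$ satisfy the jump condition $Y_n(x)_+=Y_n(x)_-\begin{pmatrix}\mathbb{I}_N&\rho(x)\\0&\mathbb{I}_N\end{pmatrix}$. The unique solution of this problem is $$Y_n(z)=\begin{pmatrix}P_n(z)&Q_n(z)\\c_{n-1}P_{n-1}(z)&c_{n-1}Q_{n-1}(z)\end{pmatrix},\qquad n\ge1.$$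
   Context: $\mathbb{I}_N$ is the $N\times N$ identity matrix. The monic matrix orthogonal polynomials with respect to $\rho(x)\,dx$ are the unique polynomials $P_n(z)=\mathbb{I}_Nz^n+\cdots$ of degree $n$ with coefficients in $\mathbb{C}^{N\times N}$ such that $\int_{\mathbb{R}}P_n(x)x^j\rho(x)\,dx=0$ for $j=0,\dots,n-1$. Their Cauchy transforms are $Q_n(z)=\frac{1}{2\pi i}\int_{\mathbb{R}}\frac{P_n(x)}{x-z}\rho(x)\,dx$, $z\in\mathbb{C}\setminus\mathbb{R}$, and $c_n=\Big(-\frac{1}{2\pi i}\int_{\mathbb{R}}P_n(x)\rho(x)x^n\,dx\Big)^{-1}$. *)

theory Defs
  imports "HOL-Complex_Analysis.Complex_Analysis" "HOL-Library.Landau_Symbols"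
begin

definition msmult :: "complex \<Rightarrow> complex^'n^'m \<Rightarrow> complex^'n^'m"  (infixr "*\<^sub>m" 75)
  where "c *\<^sub>m A = (\<chi> i j. c * A $ i $ j)"

definition hermitian_matrix :: "complex^'n^'n \<Rightarrow> bool"
  where "hermitian_matrix A \<longleftrightarrow> (\<forall>i j. A $ j $ i = cnj (A $ i $ j))"

definition matrix_exp :: "complex^'n^'n \<Rightarrow> complex^'n^'n"
  where "matrix_exp A = (\<Sum>k. ((**) A ^^ k) (mat 1) /\<^sub>R fact k)"

definition block_matrix ::
    "'a^'n^'n \<Rightarrow> 'a^'n^'n \<Rightarrow> 'a^'n^'n \<Rightarrow> 'a^'n^'n \<Rightarrow> 'a^('n + 'n)^('n + 'n)"
  where "block_matrix A B C D =
    (\<chi> i j. case i of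
        Inl a \<Rightarrow> (case j of Inl b \<Rightarrow> A $ a $ b | Inr b \<Rightarrow> B $ a $ b)
      | Inr a \<Rightarrow> (case j of Inl b \<Rightarrow> C $ a $ b | Inr b \<Rightarrow> D $ a $ b))"

definition holder_on :: "real \<Rightarrow> real \<Rightarrow> real set \<Rightarrow> (real \<Rightarrow> complex) \<Rightarrow> bool"
  where "holder_on \<gamma> C S f \<longleftrightarrow> 0 < \<gamma> \<and> \<gamma> \<le> 1 \<and> 0 \<le> C \<and>
    (\<forall>x\<in>S. \<forall>y\<in>S. dist (f x) (f y) \<le> C * dist x y powr \<gamma>)"

text \<open>
  Hoelder continuity on the line: a fixed exponent, with a constant on the interval from \<open>-R\<close> to
  \<open>R\<close> that may grow polynomially in \<open>R\<close>. The case \<open>m = 0\<close> is a single constant on the whole line,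
  which forces at most linear growth and so excludes the Hermite potential \<open>x\<^sup>2\<close>. With no control at
  all of the local constants, \<open>exp (-V)\<close> could have finite moments and yet high narrow spikes
  arbitrarily far out; the jump of the upper right block then contradicts the normalization at
  infinity, and the Riemann-Hilbert problem has no solution.
\<close>
definition holder_continuous :: "(real \<Rightarrow> complex) \<Rightarrow> bool"
  where "holder_continuous f \<longleftrightarrow>
    (\<exists>\<gamma> C. \<exists>m::nat. \<forall>R\<ge>1. holder_on \<gamma> (C * R ^ m) {-R..R} f)"

lemma holder_continuousI:
  assumes "holder_on \<gamma> C UNIV f"
  shows "holder_continuous f"
proof -
  have "\<forall>R\<ge>1. holder_on \<gamma> (C * R ^ 0) {-R..R} f"
    using assms by (auto simp: holder_on_def)
  then show ?thesis
    unfolding holder_continuous_def by blast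
qed

lemma holder_continuous_square: "holder_continuous (\<lambda>x. of_real (x\<^sup>2))"
proof -
  have "dist (complex_of_real (x\<^sup>2)) (of_real (y\<^sup>2)) \<le> 2 * R * dist x y powr 1"
    if "x \<in> {-R..R}" "y \<in> {-R..R}" for x y R :: real
  proof -
    have "dist (complex_of_real (x\<^sup>2)) (of_real (y\<^sup>2)) = \<bar>x + y\<bar> * \<bar>x - y\<bar>"
      by (simp only: dist_of_real dist_real_def flip: abs_mult)
         (simp add: power2_eq_square algebra_simps)
    also have "\<dots> \<le> (2 * R) * \<bar>x - y\<bar>"
      using that by (intro mult_right_mono) auto
    finally show ?thesis
      by (simp add: dist_real_def)
  qed
  then have "\<forall>R\<ge>1. holder_on 1 (2 * R ^ 1) {-R..R} (\<lambda>x. of_real (x\<^sup>2))"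
    unfolding holder_on_def by simp
  then show ?thesis
    unfolding holder_continuous_def by blast
qed

definition finite_moments :: "(real \<Rightarrow> complex^'n^'n) \<Rightarrow> bool"
  where "finite_moments \<rho> \<longleftrightarrow> (\<forall>k::nat. integrable lborel (\<lambda>x. x ^ k *\<^sub>R \<rho> x))"

definition monic_matrix_poly :: "nat \<Rightarrow> (complex \<Rightarrow> complex^'n^'n) \<Rightarrow> bool"
  where "monic_matrix_poly n P \<longleftrightarrow>
    (\<exists>A :: nat \<Rightarrow> complex^'n^'n. A n = mat 1 \<and> P = (\<lambda>z. \<Sum>k\<le>n. z ^ k *\<^sub>m A k))"

definition monic_op ::
    "(real \<Rightarrow> complex^'n^'n) \<Rightarrow> nat \<Rightarrow> complex \<Rightarrow> complex^'n^'n"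
  where "monic_op \<rho> n = (THE P. monic_matrix_poly n P \<and>
    (\<forall>j<n. (LINT x|lborel. x ^ j *\<^sub>R (P (of_real x) ** \<rho> x)) = 0))"

definition cauchy_op ::
    "(real \<Rightarrow> complex^'n^'n) \<Rightarrow> nat \<Rightarrow> complex \<Rightarrow> complex^'n^'n"
  where "cauchy_op \<rho> n z = (1 / (2 * of_real pi * \<i>)) *\<^sub>m
    (LINT x|lborel. (1 / (of_real x - z)) *\<^sub>m (monic_op \<rho> n (of_real x) ** \<rho> x))"

definition norming_const :: "(real \<Rightarrow> complex^'n^'n) \<Rightarrow> nat \<Rightarrow> complex^'n^'n"
  where "norming_const \<rho> n = matrix_inv ((- (1 / (2 * of_real pi * \<i>))) *\<^sub>m
    (LINT x|lborel. x ^ n *\<^sub>R (monic_op \<rho> n (of_real x) ** \<rho> x)))"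

text \<open>
  The limits are unrestricted: \<open>z\<close> tends to infinity, or to a point of the real line, in any manner
  within the complement of the line, respectively within a half-plane. The solution
  would not be unique if the behaviour at infinity were required only in sectors that avoid the
  line, or the boundary values only as vertical limits. Values of \<open>Y\<close> on the real line are
  irrelevant.
\<close>
definition solves_rhp ::
    "(real \<Rightarrow> complex^'n^'n) \<Rightarrow> nat \<Rightarrow> (complex \<Rightarrow> complex^('n + 'n)^('n + 'n)) \<Rightarrow> bool"
  where "solves_rhp \<rho> n Y \<longleftrightarrow>
    (\<forall>i j. (\<lambda>z. Y z $ i $ j) analytic_on - \<real>) \<and>
    (\<exists>E. (\<forall>\<^sub>F z in inf at_infinity (principal (- \<real>)).
            Y z = (mat 1 + E z) ** block_matrix (mat (z ^ n)) 0 0 (mat (z powi (- int n)))) \<and>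
         (\<forall>i j. (\<lambda>z. E z $ i $ j) \<in> O[inf at_infinity (principal (- \<real>))](\<lambda>z. 1 / z))) \<and>
    (\<exists>Yp Ym. continuous_on UNIV Yp \<and> continuous_on UNIV Ym \<and>
      (\<forall>x::real. (Y \<longlongrightarrow> Yp x) (at (of_real x) within {z. Im z > 0}) \<and>
                 (Y \<longlongrightarrow> Ym x) (at (of_real x) within {z. Im z < 0}) \<and>
                 Yp x = Ym x ** block_matrix (mat 1) (\<rho> x) 0 (mat 1)))"

definition rhp_solution ::
    "(real \<Rightarrow> complex^'n^'n) \<Rightarrow> nat \<Rightarrow> complex \<Rightarrow> complex^('n + 'n)^('n + 'n)"
  where "rhp_solution \<rho> n z = block_matrix
    (monic_op \<rho> n z) (cauchy_op \<rho> n z)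
    (norming_const \<rho> (n - 1) ** monic_op \<rho> (n - 1) z)
    (norming_const \<rho> (n - 1) ** cauchy_op \<rho> (n - 1) z)"

end

(*
  For Hermitian a, b the operator norm satisfies norm (exp (2a)) = norm (exp a)^2, and therefore
  norm (exp a - exp b) <= norm (a - b) * max (norm (exp a)) (norm (exp b)). With V Hoelder
  continuous (constants growing polynomially) and with finite moments, this makes the entries of
  rho rapidly decreasing, with rapidly decreasing local Hoelder constants.

  For such a function g the Cauchy transform of g is bounded off the line, has continuous boundary
  values Phi +- i pi g, and has the asymptotic series at infinity given by the moments of g. This
  gives the jump of the second block column. Orthogonality makes P_n rho lose its first n moments,
  which gives the decay Q_n = O(z^(-n-1)); the constant c_(n-1) normalizes the first moment of
  P_(n-1) rho that does not vanish.

  For uniqueness let (p, q) be a row of the difference of two solutions. By Liouville p is a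
  polynomial of degree less than n and q is the Cauchy transform of p rho / (2 pi i). As
  q = O(z^(-n-1)), the moments of p rho of order less than n vanish, so the integral of p rho p^*
  is 0, and p = 0 because rho is positive definite.
*)
theory Submission
  imports Defs
begin

(* fps_nth shares its infix symbol with vec_nth, which makes the parsing of nested uses exponential. *)
no_notation fps_nth (infixl "$" 75)

subsection \<open>Bounded operators as a Banach algebra\<close>

text \<open>Bounding norm (exp a - exp b) by norm (a - b) times the exponential of the larger norm
  would be useless, since exp (-V) is tiny when V is large and positive. The bound has to be in
  terms of the exponentials themselves. It rests on an identity for the operator norm, which is why
  matrices are moved into an algebra of operators. The asymptotic condition at infinity holds
  uniformly up to the line, so the Cauchy transforms have to be bounded there as well. This is where
  the Hoelder continuity of \<rho> enters, through the subtraction of the value of the density at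
  the real part of z. Uniqueness works with differences of rows rather than with a quotient of two
  solutions, because a difference satisfies a linear problem that the positivity of \<rho> settles.
  The same positivity statement, \<open>row_poly_eq_0\<close>, gives the uniqueness of P_n, the
  invertibility of the moment behind c_n and, through it, the existence of P_n.\<close>

text \<open>A copy of the type of bounded operators: the exponential of the library needs a type of
  class \<^class>\<open>real_normed_algebra_1\<close>, which neither the matrices nor the operators are.\<close>
typedef 'n cop = "UNIV :: ((complex^'n) \<Rightarrow>\<^sub>L (complex^'n)) set"
  morphisms fun_of_cop Cop ..

setup_lifting type_definition_cop

instantiation cop :: (finite) real_normed_algebra_1
begin

lift_definition zero_cop :: "'a cop" is 0 .
lift_definition one_cop :: "'a cop" is id_blinfun .
lift_definition plus_cop :: "'a cop \<Rightarrow> 'a cop \<Rightarrow> 'a cop" is "(+)" .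
lift_definition minus_cop :: "'a cop \<Rightarrow> 'a cop \<Rightarrow> 'a cop" is "(-)" .
lift_definition uminus_cop :: "'a cop \<Rightarrow> 'a cop" is "uminus" .
lift_definition times_cop :: "'a cop \<Rightarrow> 'a cop \<Rightarrow> 'a cop" is "(o\<^sub>L)" .
lift_definition scaleR_cop :: "real \<Rightarrow> 'a cop \<Rightarrow> 'a cop" is "(*\<^sub>R)" .
lift_definition norm_cop :: "'a cop \<Rightarrow> real" is norm .
lift_definition dist_cop :: "'a cop \<Rightarrow> 'a cop \<Rightarrow> real" is dist .
lift_definition sgn_cop :: "'a cop \<Rightarrow> 'a cop" is sgn .

definition uniformity_cop :: "('a cop \<times> 'a cop) filter"
  where "uniformity_cop = (INF e\<in>{0 <..}. principal {(x, y). dist x y < e})"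

definition open_cop :: "'a cop set \<Rightarrow> bool"
  where "open_cop U = (\<forall>x\<in>U. eventually (\<lambda>(x', y). x' = x \<longrightarrow> y \<in> U) uniformity)"

instance
proof
  fix a b c :: "'a cop" and r s :: real
  show "a + b + c = a + (b + c)" "a + b = b + a" "0 + a = a" "- a + a = 0" "a - b = a + - b"
    by (transfer, simp add: algebra_simps)+
  show "r *\<^sub>R (a + b) = r *\<^sub>R a + r *\<^sub>R b" "(r + s) *\<^sub>R a = r *\<^sub>R a + s *\<^sub>R a"
    "r *\<^sub>R s *\<^sub>R a = (r * s) *\<^sub>R a" "1 *\<^sub>R a = a"
    by (transfer, simp add: algebra_simps)+
  show "a * b * c = a * (b * c)" "1 * a = a" "a * 1 = a"
    by (transfer, rule blinfun_eqI, simp)+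
  show "(a + b) * c = a * c + b * c" "a * (b + c) = a * b + a * c"
    "r *\<^sub>R a * b = r *\<^sub>R (a * b)" "a * r *\<^sub>R b = r *\<^sub>R (a * b)"
    by (transfer, rule blinfun_eqI, simp add: blinfun.bilinear_simps)+
  show "dist a b = norm (a - b)" "sgn a = inverse (norm a) *\<^sub>R a"
    by (transfer, simp add: dist_norm sgn_div_norm)+
  show "(norm a = 0) = (a = 0)" "norm (a + b) \<le> norm a + norm b" "norm (r *\<^sub>R a) = \<bar>r\<bar> * norm a"
    by (transfer, simp add: norm_triangle_ineq)+
  show "norm (a * b) \<le> norm a * norm b"
    by transfer (rule norm_blinfun_compose)
  have "(0::complex^'a) \<noteq> 1"
    by (simp add: vec_eq_iff)
  then have "blinfun_apply 0 (1::complex^'a) \<noteq> blinfun_apply id_blinfun (1::complex^'a)"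
    by simp
  then have "(0 :: (complex^'a) \<Rightarrow>\<^sub>L (complex^'a)) \<noteq> id_blinfun"
    by fastforce
  then show "(0::'a cop) \<noteq> 1"
    by transfer
  show "norm (1::'a cop) = 1"
    by transfer simp
qed (simp_all add: uniformity_cop_def open_cop_def)

end

instance cop :: (finite) banach
proof
  fix X :: "nat \<Rightarrow> 'a cop"
  assume "Cauchy X"
  then have "Cauchy (\<lambda>n. fun_of_cop (X n))"
    by (simp add: Cauchy_def dist_cop.rep_eq)
  then obtain l where l: "(\<lambda>n. fun_of_cop (X n)) \<longlonglongrightarrow> l"
    by (auto simp: Cauchy_convergent_iff convergent_def)
  have "dist (X n) (Cop l) = dist (fun_of_cop (X n)) l" for n
    by (simp add: dist_cop.rep_eq Cop_inverse)
  then have "X \<longlonglongrightarrow> Cop l"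
    using l by (simp add: tendsto_dist_iff[of _ "Cop l"] tendsto_dist_iff[of _ l])
  then show "convergent X"
    by (auto simp: convergent_def)
qed

subsection \<open>Matrix exponentials\<close>

definition app :: "'n::finite cop \<Rightarrow> complex^'n \<Rightarrow> complex^'n"
  where "app T v = blinfun_apply (fun_of_cop T) v"

lemma bounded_bilinear_app: "bounded_bilinear (app :: 'n::finite cop \<Rightarrow> _)"
proof
  fix a b :: "'n cop" and v w :: "complex^'n" and r :: real
  show "app (a + b) v = app a v + app b v" "app (r *\<^sub>R a) v = r *\<^sub>R app a v"
    by (simp_all add: app_def plus_cop.rep_eq scaleR_cop.rep_eq blinfun.bilinear_simps)
  show "app a (v + w) = app a v + app a w" "app a (r *\<^sub>R v) = r *\<^sub>R app a v"
    by (simp_all add: app_def blinfun.bilinear_simps)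
  show "\<exists>K. \<forall>(a::'n cop) b. norm (app a b) \<le> norm a * norm b * K"
    by (rule exI[of _ 1]) (simp add: app_def norm_cop.rep_eq norm_blinfun)
qed

interpretation app: bounded_bilinear app
  by (rule bounded_bilinear_app)

lemma app_mult [simp]: "app (S * T) v = app S (app T v)"
  by (simp add: app_def times_cop.rep_eq)

lemma app_one [simp]: "app 1 v = v"
  by (simp add: app_def one_cop.rep_eq)

lemma norm_app: "norm (app T v) \<le> norm T * norm v"
  by (simp add: app_def norm_cop.rep_eq norm_blinfun)

lemma norm_cop_bound: "0 \<le> b \<Longrightarrow> (\<And>v. norm (app T v) \<le> b * norm v) \<Longrightarrow> norm T \<le> b"
  by (simp add: app_def norm_cop.rep_eq norm_blinfun_bound)

lemma cop_eqI: "(\<And>v. app S v = app T v) \<Longrightarrow> S = T"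
  by (simp add: app_def blinfun_eqI flip: fun_of_cop_inject)

definition cop_of_matrix :: "complex^'n^'n \<Rightarrow> 'n::finite cop"
  where "cop_of_matrix A = Cop (Blinfun ((*v) A))"

text \<open>The operators are only real linear, so \<open>cop_of_matrix\<close> is not onto and this
  is a left inverse of it only.\<close>

definition matrix_of_cop :: "'n::finite cop \<Rightarrow> complex^'n^'n"
  where "matrix_of_cop T = (\<chi> i j. app T (axis j 1) $ i)"

lemma matrix_vector_mult_scaleR_left: "(r *\<^sub>R A) *v v = r *\<^sub>R (A *v (v::complex^'n))"
  by (simp add: vec_eq_iff matrix_vector_mult_def scaleR_sum_right)

lemma bounded_linear_matrix_vector_mult: "bounded_linear ((*v) (A :: complex^'n^'m))"
  unfolding linear_conv_bounded_linear[symmetric]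
  by (intro linearI)
    (simp_all add: matrix_vector_mult_def vec_eq_iff scaleR_sum_right distrib_left sum.distrib)

lemma app_cop_of_matrix [simp]: "app (cop_of_matrix A) v = A *v v"
  by (simp add: app_def cop_of_matrix_def Cop_inverse bounded_linear_Blinfun_apply
      bounded_linear_matrix_vector_mult)

lemma matrix_of_cop_of_matrix [simp]: "matrix_of_cop (cop_of_matrix A) = A"
  by (simp add: matrix_of_cop_def vec_eq_iff matrix_vector_mult_def axis_def if_distrib[of "(*) _"] cong: if_cong)

lemma linear_cop_of_matrix: "linear (cop_of_matrix :: complex^'n^'n \<Rightarrow> _)"
  by (rule linearI; rule cop_eqI)
    (simp_all add: app.bilinear_simps matrix_vector_mult_add_rdistrib matrix_vector_mult_scaleR_left)

lemma bounded_linear_cop_of_matrix: "bounded_linear cop_of_matrix"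
  using linear_cop_of_matrix by (simp add: linear_conv_bounded_linear)

lemma bounded_linear_vec:
  assumes "\<And>i. bounded_linear (\<lambda>x. f x $ i)"
  shows "bounded_linear (f :: 'a::real_normed_vector \<Rightarrow> 'b::real_normed_vector ^ 'n)"
proof -
  interpret linear f
    using linear_add[OF bounded_linear.linear[OF assms]] linear_scale[OF bounded_linear.linear[OF assms]]
    by (intro linearI) (simp_all add: vec_eq_iff)
  obtain K where K: "\<And>i x. norm (f x $ i) \<le> norm x * K i"
    using bounded_linear.bounded[OF assms] by metis
  show ?thesis
  proof
    show "\<exists>K. \<forall>x. norm (f x) \<le> norm x * K"
    proof (rule exI[of _ "\<Sum>i\<in>UNIV. K i"], rule allI)
      fix x
      have "norm (f x) \<le> (\<Sum>i\<in>UNIV. norm (f x $ i))"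
        unfolding norm_vec_def by (rule L2_set_le_sum) simp
      also have "\<dots> \<le> (\<Sum>i\<in>UNIV. norm x * K i)"
        by (rule sum_mono) (rule K)
      finally show "norm (f x) \<le> norm x * (\<Sum>i\<in>UNIV. K i)"
        by (simp add: sum_distrib_left)
    qed
  qed
qed

lemma bounded_linear_matrix_of_cop: "bounded_linear matrix_of_cop"
  unfolding matrix_of_cop_def
  by (intro bounded_linear_vec)
    (simp, intro bounded_linear_intros app.bounded_linear_left
      bounded_linear_compose[OF bounded_linear_vec_nth])

lemma cop_of_matrix_mult: "cop_of_matrix (A ** B) = cop_of_matrix A * cop_of_matrix B"
  by (rule cop_eqI) (simp add: matrix_vector_mul_assoc)

lemma cop_of_matrix_power: "cop_of_matrix (((**) A ^^ k) (mat 1)) = cop_of_matrix A ^ k"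
  by (induction k) (simp_all add: cop_of_matrix_mult cop_eqI)

text \<open>The operator series, carried back by the left inverse \<open>matrix_of_cop\<close>,
  gives convergence of the matrix series and the first equation. The second does not follow from the
  first alone, as \<open>cop_of_matrix\<close> is not onto; it comes from applying
  \<open>cop_of_matrix\<close> to the matrix series.\<close>

lemma matrix_exp_eq_exp:
  "matrix_exp A = matrix_of_cop (exp (cop_of_matrix A))"
  "cop_of_matrix (matrix_exp A) = exp (cop_of_matrix A)"
proof -
  let ?T = "\<lambda>k. ((**) A ^^ k) (mat 1) /\<^sub>R fact k"
  have T: "cop_of_matrix (?T k) = cop_of_matrix A ^ k /\<^sub>R fact k" for k
    by (simp add: linear_scale[OF linear_cop_of_matrix] cop_of_matrix_power)
  have "(\<lambda>k. matrix_of_cop (cop_of_matrix (?T k))) sums matrix_of_cop (exp (cop_of_matrix A))"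
    unfolding T by (rule bounded_linear.sums[OF bounded_linear_matrix_of_cop exp_converges])
  then have s: "?T sums matrix_of_cop (exp (cop_of_matrix A))"
    by simp
  then show 1: "matrix_exp A = matrix_of_cop (exp (cop_of_matrix A))"
    unfolding matrix_exp_def by (rule sums_unique[symmetric])
  have "(\<lambda>k. cop_of_matrix (?T k)) sums cop_of_matrix (matrix_exp A)"
    using bounded_linear.sums[OF bounded_linear_cop_of_matrix s] 1 by simp
  then show "cop_of_matrix (matrix_exp A) = exp (cop_of_matrix A)"
    unfolding T using exp_converges sums_unique2 by blast
qed

subsection \<open>Self-adjoint operators\<close>

text \<open>Here \<open>inner\<close> is the real part of the Hermitian product. Self-adjointness in
  this sense is meaningful for operators that are only real linear, and it is enough for the
  identity of norms below.\<close>

definition self_adjoint :: "'n::finite cop \<Rightarrow> bool"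
  where "self_adjoint T \<longleftrightarrow> (\<forall>v w. inner (app T v) w = inner v (app T w))"

lemma inner_complex_vec: "inner v w = Re (\<Sum>i\<in>UNIV. v $ i * cnj (w $ i))" for v w :: "complex^'n"
  by (simp add: inner_vec_def inner_complex_def)

lemma self_adjoint_cop_of_matrix:
  assumes "hermitian_matrix A"
  shows "self_adjoint (cop_of_matrix A)"
  unfolding self_adjoint_def
proof (intro allI)
  fix v w
  have A: "cnj (A $ i $ j) = A $ j $ i" for i j
    using assms unfolding hermitian_matrix_def by metis
  have "inner (A *v v) w = Re (\<Sum>i\<in>UNIV. \<Sum>j\<in>UNIV. A $ i $ j * v $ j * cnj (w $ i))"
    by (simp only: inner_complex_vec matrix_vector_mult_def vec_lambda_beta sum_distrib_right)
  also have "\<dots> = Re (\<Sum>j\<in>UNIV. \<Sum>i\<in>UNIV. A $ i $ j * v $ j * cnj (w $ i))"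
    by (subst sum.swap) simp
  also have "\<dots> = inner v (A *v w)"
    by (simp only: inner_complex_vec matrix_vector_mult_def vec_lambda_beta sum_distrib_left
        cnj_sum complex_cnj_mult A mult_ac)
  finally show "inner (app (cop_of_matrix A) v) w = inner v (app (cop_of_matrix A) w)"
    by simp
qed

lemma self_adjoint_scaleR: "self_adjoint T \<Longrightarrow> self_adjoint (r *\<^sub>R T)"
  by (simp add: self_adjoint_def app.bilinear_simps)

lemma self_adjoint_power:
  assumes T: "self_adjoint T"
  shows "self_adjoint (T ^ k)"
proof (induction k)
  case 0
  show ?case by (simp add: self_adjoint_def)
next
  case (Suc k)
  have "app (T ^ k) (app T w) = app (T ^ Suc k) w" for w
    by (simp add: power_commutes del: app_mult flip: app_mult)
  then show ?case
    using T Suc by (simp add: self_adjoint_def)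
qed

lemma self_adjoint_exp:
  assumes "self_adjoint T"
  shows "self_adjoint (exp T)"
  unfolding self_adjoint_def
proof (intro allI)
  fix v w
  have "(\<lambda>k. inner (app (T ^ k /\<^sub>R fact k) v) w) sums inner (app (exp T) v) w"
    by (intro bounded_linear.sums[OF bounded_linear_inner_left]
        bounded_linear.sums[OF app.bounded_linear_left] exp_converges)
  moreover have "(\<lambda>k. inner v (app (T ^ k /\<^sub>R fact k) w)) sums inner v (app (exp T) w)"
    by (intro bounded_linear.sums[OF bounded_linear_inner_right]
        bounded_linear.sums[OF app.bounded_linear_left] exp_converges)
  moreover have "inner (app (T ^ k /\<^sub>R fact k) v) w = inner v (app (T ^ k /\<^sub>R fact k) w)" for k
    using self_adjoint_scaleR[OF self_adjoint_power[OF assms]] unfolding self_adjoint_def by blast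
  ultimately show "inner (app (exp T) v) w = inner v (app (exp T) w)"
    using sums_unique2 by fastforce
qed

section \<open>Norms and positivity of exponentials of self-adjoint operators\<close>

lemma exp_scaleR_double: "exp ((2 * t) *\<^sub>R a) = exp (t *\<^sub>R a) * exp (t *\<^sub>R (a :: 'a::{real_normed_algebra_1,banach}))"
  by (subst exp_add_commuting[symmetric]) (simp_all flip: scaleR_left_distrib)

text \<open>The C*-identity: the square of norm (S v) is the inner product of v with S (S v), so the
  Cauchy-Schwarz inequality bounds norm S by the root of norm (S * S).\<close>

lemma norm_square_self_adjoint:
  assumes "self_adjoint S"
  shows "norm (S * S) = (norm S)\<^sup>2"
proof (rule antisym)
  show "norm (S * S) \<le> (norm S)\<^sup>2"
    by (simp add: power2_eq_square norm_mult_ineq)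
  have "norm S \<le> sqrt (norm (S * S))"
  proof (rule norm_cop_bound)
    fix v
    have "(norm (app S v))\<^sup>2 = inner v (app (S * S) v)"
      using assms by (simp add: self_adjoint_def power2_norm_eq_inner)
    also have "\<dots> \<le> norm v * (norm (S * S) * norm v)"
      by (rule order_trans[OF norm_cauchy_schwarz]) (intro mult_left_mono norm_app norm_ge_zero)
    also have "\<dots> = (sqrt (norm (S * S)) * norm v)\<^sup>2"
      by (simp add: power2_eq_square)
    finally show "norm (app S v) \<le> sqrt (norm (S * S)) * norm v"
      by (rule power2_le_imp_le) simp
  qed simp
  then show "(norm S)\<^sup>2 \<le> norm (S * S)"
    by (metis norm_ge_zero power_mono real_sqrt_pow2)
qed

text \<open>The only trace of self-adjointness that the estimate of differences uses.
  Submultiplicativity alone would bound the norm at half the argument from below, whereas a bound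
  from above is wanted.\<close>

lemma norm_exp_double:
  assumes "self_adjoint T"
  shows "norm (exp ((2 * t) *\<^sub>R T)) = (norm (exp (t *\<^sub>R T)))\<^sup>2"
  by (simp add: exp_scaleR_double norm_square_self_adjoint self_adjoint_exp self_adjoint_scaleR assms)

text \<open>exp A is the square of the self-adjoint invertible operator S = exp (A / 2), so its
  quadratic form is the square of norm (S u). The vector u is the conjugate of v because the
  statement is made for rows v, with the conjugate on the right.\<close>

lemma matrix_exp_positive:
  assumes "hermitian_matrix A" "v \<noteq> 0"
  shows "0 < Re (\<Sum>i\<in>UNIV. \<Sum>j\<in>UNIV. v $ i * matrix_exp A $ i $ j * cnj (v $ j))"
proof -
  define T where "T = cop_of_matrix A"
  define S where "S = exp ((1/2) *\<^sub>R T)"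
  define u where "u = (\<chi> i. cnj (v $ i))"
  have T: "self_adjoint T" and S: "self_adjoint S"
    by (simp_all add: T_def S_def self_adjoint_cop_of_matrix assms self_adjoint_exp self_adjoint_scaleR)
  have "exp (- ((1/2) *\<^sub>R T)) * S = 1"
    unfolding S_def using exp_minus_inverse[of "- ((1/2) *\<^sub>R T)"] by simp
  then have "app (exp (- ((1/2) *\<^sub>R T))) (app S u) = u"
    by (metis app_mult app_one)
  moreover have "u \<noteq> 0"
    using assms(2) by (auto simp: u_def vec_eq_iff)
  ultimately have "app S u \<noteq> 0"
    by (metis app.zero_right)
  then have "0 < inner (app S u) (app S u)"
    by simp
  also have "\<dots> = inner (app (S * S) u) u"
    using S by (simp add: self_adjoint_def inner_commute)
  also have "S * S = exp T"
    using exp_scaleR_double[of "1/2" T] by (simp add: S_def)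
  also have "exp T = cop_of_matrix (matrix_exp A)"
    by (simp add: T_def matrix_exp_eq_exp(2))
  also have "inner (app (cop_of_matrix (matrix_exp A)) u) u
      = Re (\<Sum>i\<in>UNIV. \<Sum>j\<in>UNIV. v $ i * matrix_exp A $ i $ j * cnj (v $ j))"
    unfolding app_cop_of_matrix
    by (simp only: u_def inner_complex_vec matrix_vector_mult_def vec_lambda_beta sum_distrib_right
        sum_distrib_left complex_cnj_cnj mult_ac)
  finally show ?thesis .
qed

text \<open>Halving the exponents \<open>k\<close> times replaces the difference of the exponentials by one whose
  arguments tend to \<open>0\<close>, where it is \<open>norm (a - b) / 2 ^ k\<close> to first order.\<close>
lemma norm_exp_diff_le:
  fixes a b :: "'a::{real_normed_algebra_1,banach}"
  assumes a: "\<And>t. norm (exp ((2 * t) *\<^sub>R a)) = (norm (exp (t *\<^sub>R a)))\<^sup>2"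
    and b: "\<And>t. norm (exp ((2 * t) *\<^sub>R b)) = (norm (exp (t *\<^sub>R b)))\<^sup>2"
  shows "norm (exp a - exp b) \<le> norm (a - b) * max (norm (exp a)) (norm (exp b))"
proof -
  define m where "m = max (norm (exp a)) (norm (exp b))"
  define h where "h k = (1 / 2 ^ k :: real)" for k
  have h: "h 0 = 1" "h k = 2 * h (Suc k)" "0 < h k" for k
    by (simp_all add: h_def)
  have "exp a \<noteq> 0"
    using exp_minus_inverse[of a] by auto
  then have m: "0 < m"
    by (simp add: m_def less_max_iff_disj)
  \<comment> \<open>The doubling identity read backwards: each halving of the argument takes the
    square root of the norm.\<close>
  have root: "norm (exp (h k *\<^sub>R c)) \<le> m powr h k"
    if c: "\<And>t. norm (exp ((2 * t) *\<^sub>R c)) = (norm (exp (t *\<^sub>R c)))\<^sup>2" and "norm (exp c) \<le> m"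
    for k and c :: 'a
  proof (induction k)
    case 0
    show ?case using that m by (simp add: h(1))
  next
    case (Suc k)
    have "(norm (exp (h (Suc k) *\<^sub>R c)))\<^sup>2 \<le> (m powr h (Suc k))\<^sup>2"
      using Suc unfolding h(2)[of k] c by (simp add: power2_eq_square flip: powr_add)
    then show ?case
      by (rule power2_le_imp_le) simp
  qed
  \<comment> \<open>As x^2 - y^2 = x (x - y) + (x - y) y also without commutativity, step k + 1
    costs a factor 2 and a factor \<open>m powr h (Suc k)\<close>. The exponents 1/2, 1/4, ... up to
    \<open>h k\<close> add up to \<open>1 - h k\<close>.\<close>
  have ind: "norm (exp a - exp b) \<le> 2 ^ k * m powr (1 - h k) * norm (exp (h k *\<^sub>R a) - exp (h k *\<^sub>R b))" for k
  proof (induction k)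
    case 0
    show ?case using m by (simp add: h(1))
  next
    case (Suc k)
    define x y where "x = exp (h (Suc k) *\<^sub>R a)" and "y = exp (h (Suc k) *\<^sub>R b)"
    define M where "M = m powr h (Suc k)"
    have xy: "norm x \<le> M" "norm y \<le> M"
      unfolding x_def y_def M_def by (rule root; simp add: a b m_def)+
    have "exp (h k *\<^sub>R a) - exp (h k *\<^sub>R b) = x * (x - y) + (x - y) * y"
      by (simp add: h(2)[of k] exp_scaleR_double x_def y_def algebra_simps)
    then have "norm (exp (h k *\<^sub>R a) - exp (h k *\<^sub>R b)) \<le> norm x * norm (x - y) + norm (x - y) * norm y"
      by (metis add_mono norm_mult_ineq norm_triangle_le)
    also have "\<dots> \<le> M * norm (x - y) + norm (x - y) * M"
      by (intro add_mono mult_right_mono mult_left_mono xy norm_ge_zero)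
    finally have le: "norm (exp (h k *\<^sub>R a) - exp (h k *\<^sub>R b)) \<le> 2 * M * norm (x - y)"
      by simp
    have "norm (exp a - exp b) \<le> 2 ^ k * m powr (1 - h k) * (2 * M * norm (x - y))"
      by (rule order_trans[OF Suc.IH]) (intro mult_left_mono le; simp)
    also have "\<dots> = 2 ^ Suc k * (m powr (1 - h k) * M) * norm (x - y)"
      by simp
    also have "m powr (1 - h k) * M = m powr (1 - h (Suc k))"
      unfolding M_def powr_add[symmetric] by (simp add: h(2)[of k])
    finally show ?case
      by (simp add: x_def y_def)
  qed
  have d: "((\<lambda>t. (exp (t *\<^sub>R c) - 1) /\<^sub>R t) \<longlongrightarrow> c) (at 0)" for c :: 'a
  proof -
    have "((\<lambda>t. norm (exp (t *\<^sub>R c) - 1 - t *\<^sub>R c) / norm t) \<longlongrightarrow> 0) (at 0)"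
      using exp_scaleR_has_vector_derivative_right[of c 0 UNIV]
      by (simp add: has_vector_derivative_def has_derivative_at)
    also have "?this \<longleftrightarrow> ((\<lambda>t. norm ((exp (t *\<^sub>R c) - 1) /\<^sub>R t - c)) \<longlongrightarrow> 0) (at 0)"
    proof (rule filterlim_cong[OF refl refl], rule eventually_at_filter[THEN iffD2], rule always_eventually, safe)
      fix t :: real assume "t \<noteq> 0"
      then have "(exp (t *\<^sub>R c) - 1) /\<^sub>R t - c = (exp (t *\<^sub>R c) - 1 - t *\<^sub>R c) /\<^sub>R t"
        by (simp add: scaleR_diff_right)
      then show "norm (exp (t *\<^sub>R c) - 1 - t *\<^sub>R c) / norm t = norm ((exp (t *\<^sub>R c) - 1) /\<^sub>R t - c)"
        by (simp add: divide_inverse mult.commute)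
    qed
    finally show ?thesis
      by (simp add: LIM_zero_iff tendsto_norm_zero_iff)
  qed
  have h0: "filterlim h (at 0) sequentially"
    unfolding filterlim_at using h(3) LIMSEQ_realpow_zero[of "1/2"]
    by (auto simp: h_def[abs_def] power_divide less_imp_neq[OF h(3), symmetric])
  then have "h \<longlonglongrightarrow> 0"
    by (simp add: filterlim_at)
  \<comment> \<open>The factor 2 ^ k is 1 / \<open>h k\<close>; it turns the difference of
    exponentials into a difference of two difference quotients at 0, with limits a and b.\<close>
  then have "(\<lambda>k. m powr (1 - h k) * norm ((exp (h k *\<^sub>R a) - 1) /\<^sub>R h k - (exp (h k *\<^sub>R b) - 1) /\<^sub>R h k))
      \<longlonglongrightarrow> m powr (1 - 0) * norm (a - b)"
    using m by (intro tendsto_intros filterlim_compose[OF d h0]) auto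
  moreover have "m powr (1 - h k) * norm ((exp (h k *\<^sub>R a) - 1) /\<^sub>R h k - (exp (h k *\<^sub>R b) - 1) /\<^sub>R h k)
      = 2 ^ k * m powr (1 - h k) * norm (exp (h k *\<^sub>R a) - exp (h k *\<^sub>R b))" for k
    by (simp add: h_def flip: scaleR_diff_right)
  ultimately have "(\<lambda>k. 2 ^ k * m powr (1 - h k) * norm (exp (h k *\<^sub>R a) - exp (h k *\<^sub>R b)))
      \<longlonglongrightarrow> m * norm (a - b)"
    using m by simp
  then have "norm (exp a - exp b) \<le> m * norm (a - b)"
    by (rule LIMSEQ_le_const) (use ind in blast)
  then show ?thesis
    by (simp add: m_def mult.commute)
qed

subsection \<open>Rapidly decaying Hoelder continuous functions\<close>

definition poly_holder :: "(real \<Rightarrow> 'a::real_normed_vector) \<Rightarrow> bool"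
  where "poly_holder f \<longleftrightarrow> (\<exists>\<gamma> C m. 0 < \<gamma> \<and> \<gamma> \<le> 1 \<and> 0 \<le> C \<and>
    (\<forall>x y. \<bar>x - y\<bar> \<le> 1 \<longrightarrow> norm (f x - f y) \<le> C * (1 + \<bar>x\<bar>) ^ m * \<bar>x - y\<bar> powr \<gamma>))"

text \<open>Rapid decay of the values and of the local Hoelder constants. The restriction to
  distances up to 1 makes the weights at x and at y comparable up to 2 ^ k. The exponent is a
  parameter so that finite sums stay in the class with the same one.\<close>

definition rapid_holder :: "real \<Rightarrow> (real \<Rightarrow> 'a::real_normed_vector) \<Rightarrow> bool"
  where "rapid_holder \<gamma> f \<longleftrightarrow> 0 < \<gamma> \<and> \<gamma> \<le> 1 \<and>
    (\<forall>k. \<exists>C. \<forall>x. (1 + \<bar>x\<bar>) ^ k * norm (f x) \<le> C) \<and>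
    (\<forall>k. \<exists>C. \<forall>x y. \<bar>x - y\<bar> \<le> 1 \<longrightarrow> (1 + \<bar>x\<bar>) ^ k * norm (f x - f y) \<le> C * \<bar>x - y\<bar> powr \<gamma>)"

lemma poly_holder_holder_continuous:
  assumes "holder_continuous f"
  shows "poly_holder f"
proof -
  obtain \<gamma> C and m :: nat where h: "\<And>R. 1 \<le> R \<Longrightarrow> holder_on \<gamma> (C * R ^ m) {-R..R} f"
    using assms unfolding holder_continuous_def by blast
  have 1: "0 < \<gamma>" "\<gamma> \<le> 1" "0 \<le> C"
    using h[of 1] by (simp_all add: holder_on_def)
  have "norm (f x - f y) \<le> C * (1 + \<bar>x\<bar>) ^ m * \<bar>x - y\<bar> powr \<gamma>" if "\<bar>x - y\<bar> \<le> 1" for x y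
  proof -
    have "x \<in> {- (1 + \<bar>x\<bar>)..1 + \<bar>x\<bar>}" "y \<in> {- (1 + \<bar>x\<bar>)..1 + \<bar>x\<bar>}"
      using that by auto
    then have "dist (f x) (f y) \<le> C * (1 + \<bar>x\<bar>) ^ m * dist x y powr \<gamma>"
      using h[of "1 + \<bar>x\<bar>"] unfolding holder_on_def by simp
    then show ?thesis
      by (simp add: dist_norm)
  qed
  then show ?thesis
    unfolding poly_holder_def using 1 by blast
qed

text \<open>The smallest exponent and the sum of the degrees serve all components at once, because
  the distances are at most 1 and 1 + \<bar>x\<bar> is at least 1.\<close>

lemma poly_holder_vec:
  fixes f :: "real \<Rightarrow> 'a::real_normed_vector ^ 'n"
  assumes "\<And>i. poly_holder (\<lambda>x. f x $ i)"
  shows "poly_holder f"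
proof -
  obtain \<gamma> C and m :: "'n \<Rightarrow> nat" where h: "\<And>i. 0 < \<gamma> i" "\<And>i. \<gamma> i \<le> 1" "\<And>i. (0::real) \<le> C i"
    and *: "\<And>i x y. \<bar>x - y\<bar> \<le> 1 \<Longrightarrow> norm (f x $ i - f y $ i) \<le> C i * (1 + \<bar>x\<bar>) ^ m i * \<bar>x - y\<bar> powr \<gamma> i"
    using assms unfolding poly_holder_def by metis
  define g where "g = Min (range \<gamma>)"
  define M where "M = sum m UNIV"
  have g: "0 < g" "g \<le> \<gamma> i" for i
    using h(1) by (simp_all add: g_def)
  have "norm (f x - f y) \<le> sum C UNIV * (1 + \<bar>x\<bar>) ^ M * \<bar>x - y\<bar> powr g" if xy: "\<bar>x - y\<bar> \<le> 1" for x y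
  proof -
    have "norm (f x - f y) \<le> (\<Sum>i\<in>UNIV. norm ((f x - f y) $ i))"
      unfolding norm_vec_def by (rule L2_set_le_sum) simp
    also have "\<dots> \<le> (\<Sum>i\<in>UNIV. C i * (1 + \<bar>x\<bar>) ^ M * \<bar>x - y\<bar> powr g)"
    proof (rule sum_mono)
      fix i
      have "norm ((f x - f y) $ i) \<le> C i * (1 + \<bar>x\<bar>) ^ m i * \<bar>x - y\<bar> powr \<gamma> i"
        using *[OF xy] by simp
      also have "\<dots> \<le> C i * (1 + \<bar>x\<bar>) ^ M * \<bar>x - y\<bar> powr g"
        using h(3) g xy unfolding M_def
        by (intro mult_mono mult_left_mono power_increasing powr_mono' member_le_sum) auto
      finally show "norm ((f x - f y) $ i) \<le> C i * (1 + \<bar>x\<bar>) ^ M * \<bar>x - y\<bar> powr g" .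
    qed
    finally show ?thesis
      by (simp add: sum_distrib_right)
  qed
  moreover have "g \<le> 1" "0 \<le> sum C UNIV"
    using h g(2) order_trans by (blast, simp add: sum_nonneg)
  ultimately show ?thesis
    unfolding poly_holder_def using g(1) by blast
qed

lemma poly_holder_bounded_linear:
  assumes "bounded_linear L" "poly_holder f"
  shows "poly_holder (\<lambda>x. L (f x))"
proof -
  interpret bounded_linear L by fact
  obtain \<gamma> C m where h: "0 < \<gamma>" "\<gamma> \<le> 1" "0 \<le> C"
    and *: "\<And>x y. \<bar>x - y\<bar> \<le> 1 \<Longrightarrow> norm (f x - f y) \<le> C * (1 + \<bar>x\<bar>) ^ m * \<bar>x - y\<bar> powr \<gamma>"
    using assms(2) unfolding poly_holder_def by blast
  obtain K where K: "0 \<le> K" "\<And>v. norm (L v) \<le> norm v * K"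
    using nonneg_bounded by blast
  have "norm (L (f x) - L (f y)) \<le> (K * C) * (1 + \<bar>x\<bar>) ^ m * \<bar>x - y\<bar> powr \<gamma>" if "\<bar>x - y\<bar> \<le> 1" for x y
    unfolding diff[symmetric]
    using order_trans[OF K(2) mult_right_mono[OF *[OF that] K(1)]] by (simp add: mult_ac)
  then show ?thesis
    unfolding poly_holder_def using h K(1) by (metis mult_nonneg_nonneg)
qed

lemma one_plus_abs_le:
  fixes x y :: real
  assumes "\<bar>x - y\<bar> \<le> 1"
  shows "(1 + \<bar>x\<bar>) ^ k \<le> 2 ^ k * (1 + \<bar>y\<bar>) ^ k"
  unfolding power_mult_distrib[symmetric] using assms by (intro power_mono) auto

lemma one_le_one_plus_abs: "1 \<le> (1 + \<bar>x\<bar>) ^ k" for x :: real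
  by (rule one_le_power) simp

lemma rapid_holder_decay:
  assumes "rapid_holder \<gamma> f"
  obtains C where "0 \<le> C" "\<And>x. (1 + \<bar>x\<bar>) ^ k * norm (f x) \<le> C"
proof -
  obtain C where C: "\<And>x. (1 + \<bar>x\<bar>) ^ k * norm (f x) \<le> C"
    using assms unfolding rapid_holder_def by metis
  moreover have "0 \<le> C"
    by (rule order_trans[OF _ C[of 0]]) simp
  ultimately show ?thesis using that by blast
qed

lemma rapid_holder_diff:
  assumes "rapid_holder \<gamma> f"
  obtains C where "0 \<le> C"
    "\<And>x y. \<bar>x - y\<bar> \<le> 1 \<Longrightarrow> (1 + \<bar>x\<bar>) ^ k * norm (f x - f y) \<le> C * \<bar>x - y\<bar> powr \<gamma>"
proof -
  obtain C where C: "\<And>x y. \<bar>x - y\<bar> \<le> 1 \<Longrightarrow> (1 + \<bar>x\<bar>) ^ k * norm (f x - f y) \<le> C * \<bar>x - y\<bar> powr \<gamma>"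
    using assms unfolding rapid_holder_def by metis
  moreover have "0 \<le> C"
    by (rule order_trans[OF _ C[of 0 1, simplified]]) simp
  ultimately show ?thesis using that by blast
qed

lemma rapid_holderI:
  assumes "0 < \<gamma>" "\<gamma> \<le> 1"
    and "\<And>k. \<exists>C. \<forall>x. (1 + \<bar>x\<bar>) ^ k * norm (f x) \<le> C"
    and "\<And>k. \<exists>C. \<forall>x y. \<bar>x - y\<bar> \<le> 1 \<longrightarrow> (1 + \<bar>x\<bar>) ^ k * norm (f x - f y) \<le> C * \<bar>x - y\<bar> powr \<gamma>"
  shows "rapid_holder \<gamma> f"
  using assms unfolding rapid_holder_def by blast

lemma rapid_holder_exponent: "rapid_holder \<gamma> f \<Longrightarrow> 0 < \<gamma> \<and> \<gamma> \<le> 1"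
  by (simp add: rapid_holder_def)

lemma rapid_holder_bounded_linear:
  assumes "bounded_linear L" "rapid_holder \<gamma> f"
  shows "rapid_holder \<gamma> (\<lambda>x. L (f x))"
proof (rule rapid_holderI)
  interpret bounded_linear L by fact
  obtain K where K: "0 \<le> K" "\<And>v. norm (L v) \<le> norm v * K"
    using nonneg_bounded by blast
  have L: "a * norm (L v) \<le> c * K" if "a * norm v \<le> c" "0 \<le> a" for a c v
    using order_trans[OF mult_left_mono[OF K(2) that(2)] mult_right_mono[OF that(1) K(1), simplified mult.assoc]] .
  fix k
  obtain C where C: "\<And>x. (1 + \<bar>x\<bar>) ^ k * norm (f x) \<le> C"
    using rapid_holder_decay[OF assms(2)] by metis
  show "\<exists>C. \<forall>x. (1 + \<bar>x\<bar>) ^ k * norm (L (f x)) \<le> C"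
    using L[OF C] by fastforce
  obtain D where D: "\<And>x y. \<bar>x - y\<bar> \<le> 1 \<Longrightarrow> (1 + \<bar>x\<bar>) ^ k * norm (f x - f y) \<le> D * \<bar>x - y\<bar> powr \<gamma>"
    using rapid_holder_diff[OF assms(2)] by metis
  have "(1 + \<bar>x\<bar>) ^ k * norm (L (f x) - L (f y)) \<le> (D * K) * \<bar>x - y\<bar> powr \<gamma>" if "\<bar>x - y\<bar> \<le> 1" for x y
    unfolding diff[symmetric] using L[OF D[OF that]] by (simp add: mult_ac)
  then show "\<exists>C. \<forall>x y. \<bar>x - y\<bar> \<le> 1 \<longrightarrow> (1 + \<bar>x\<bar>) ^ k * norm (L (f x) - L (f y)) \<le> C * \<bar>x - y\<bar> powr \<gamma>"
    by blast
qed (use rapid_holder_exponent[OF assms(2)] in auto)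

lemma rapid_holder_zero: "0 < \<gamma> \<Longrightarrow> \<gamma> \<le> 1 \<Longrightarrow> rapid_holder \<gamma> (\<lambda>x. 0)"
  by (auto intro!: rapid_holderI exI[of _ 0])

lemma rapid_holder_add:
  assumes f: "rapid_holder \<gamma> f" and g: "rapid_holder \<gamma> g"
  shows "rapid_holder \<gamma> (\<lambda>x. f x + g x)"
proof (rule rapid_holderI)
  have L: "a * norm (v + w) \<le> c + d" if "a * norm v \<le> c" "a * norm w \<le> d" "0 \<le> a" for a c d and v w :: 'a
    using mult_left_mono[OF norm_triangle_ineq[of v w] that(3)] that by (simp add: distrib_left)
  fix k
  obtain C D where C: "\<And>x. (1 + \<bar>x\<bar>) ^ k * norm (f x) \<le> C" and D: "\<And>x. (1 + \<bar>x\<bar>) ^ k * norm (g x) \<le> D"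
    using rapid_holder_decay[OF f] rapid_holder_decay[OF g] by metis
  show "\<exists>C. \<forall>x. (1 + \<bar>x\<bar>) ^ k * norm (f x + g x) \<le> C"
    using L[OF C D] by fastforce
  obtain C where C: "\<And>x y. \<bar>x - y\<bar> \<le> 1 \<Longrightarrow> (1 + \<bar>x\<bar>) ^ k * norm (f x - f y) \<le> C * \<bar>x - y\<bar> powr \<gamma>"
    using rapid_holder_diff[OF f] by metis
  obtain D where D: "\<And>x y. \<bar>x - y\<bar> \<le> 1 \<Longrightarrow> (1 + \<bar>x\<bar>) ^ k * norm (g x - g y) \<le> D * \<bar>x - y\<bar> powr \<gamma>"
    using rapid_holder_diff[OF g] by metis
  have "(1 + \<bar>x\<bar>) ^ k * norm ((f x + g x) - (f y + g y)) \<le> (C + D) * \<bar>x - y\<bar> powr \<gamma>" if "\<bar>x - y\<bar> \<le> 1" for x y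
    using L[OF C[OF that] D[OF that]] by (simp add: algebra_simps)
  then show "\<exists>C. \<forall>x y. \<bar>x - y\<bar> \<le> 1 \<longrightarrow>
      (1 + \<bar>x\<bar>) ^ k * norm ((f x + g x) - (f y + g y)) \<le> C * \<bar>x - y\<bar> powr \<gamma>"
    by blast
qed (use rapid_holder_exponent[OF f] in auto)

lemma rapid_holder_sum:
  assumes "\<And>i. i \<in> I \<Longrightarrow> rapid_holder \<gamma> (f i)" "0 < \<gamma>" "\<gamma> \<le> 1"
  shows "rapid_holder \<gamma> (\<lambda>x. \<Sum>i\<in>I. f i x)"
  using assms by (induction I rule: infinite_finite_induct)
    (auto intro: rapid_holder_zero rapid_holder_add)

text \<open>The splitting x f(x) - y f(y) = x (f(x) - f(y)) + (x - y) f(y) costs one power of 1 +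
  \<bar>x\<bar>, which the bounds for all powers absorb. In the second term \<bar>x - y\<bar> is at
  most \<open>\<bar>x - y\<bar> powr \<gamma>\<close>, since distances are at most 1.\<close>

lemma rapid_holder_times_ident:
  assumes f: "rapid_holder \<gamma> f"
  shows "rapid_holder \<gamma> (\<lambda>x. x *\<^sub>R f x)"
proof (rule rapid_holderI)
  fix k
  obtain C where C: "0 \<le> C" "\<And>x. (1 + \<bar>x\<bar>) ^ Suc k * norm (f x) \<le> C"
    using rapid_holder_decay[OF f] by metis
  have "(1 + \<bar>x\<bar>) ^ k * norm (x *\<^sub>R f x) \<le> (1 + \<bar>x\<bar>) ^ Suc k * norm (f x)" for x
    by (simp add: algebra_simps)
  then show "\<exists>C. \<forall>x. (1 + \<bar>x\<bar>) ^ k * norm (x *\<^sub>R f x) \<le> C"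
    using C order_trans by blast
  obtain D where D: "0 \<le> D"
      "\<And>x y. \<bar>x - y\<bar> \<le> 1 \<Longrightarrow> (1 + \<bar>x\<bar>) ^ Suc k * norm (f x - f y) \<le> D * \<bar>x - y\<bar> powr \<gamma>"
    using rapid_holder_diff[OF f] by metis
  have "(1 + \<bar>x\<bar>) ^ k * norm (x *\<^sub>R f x - y *\<^sub>R f y) \<le> (D + 2 ^ k * C) * \<bar>x - y\<bar> powr \<gamma>"
    if xy: "\<bar>x - y\<bar> \<le> 1" for x y
  proof -
    have "x *\<^sub>R f x - y *\<^sub>R f y = x *\<^sub>R (f x - f y) + (x - y) *\<^sub>R f y"
      by (simp add: algebra_simps)
    then have "norm (x *\<^sub>R f x - y *\<^sub>R f y) \<le> \<bar>x\<bar> * norm (f x - f y) + \<bar>x - y\<bar> * norm (f y)"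
      by (metis norm_scaleR norm_triangle_ineq)
    then have "(1 + \<bar>x\<bar>) ^ k * norm (x *\<^sub>R f x - y *\<^sub>R f y)
        \<le> (1 + \<bar>x\<bar>) ^ k * (\<bar>x\<bar> * norm (f x - f y) + \<bar>x - y\<bar> * norm (f y))"
      by (rule mult_left_mono) simp
    also have "\<dots> \<le> (1 + \<bar>x\<bar>) ^ Suc k * norm (f x - f y) + \<bar>x - y\<bar> * ((1 + \<bar>x\<bar>) ^ k * norm (f y))"
      by (simp add: algebra_simps)
    also have "\<dots> \<le> D * \<bar>x - y\<bar> powr \<gamma> + \<bar>x - y\<bar> powr \<gamma> * (2 ^ k * C)"
    proof (rule add_mono[OF D(2)[OF xy]], rule mult_mono)
      have "\<bar>x - y\<bar> powr 1 \<le> \<bar>x - y\<bar> powr \<gamma>"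
        using xy rapid_holder_exponent[OF f] by (intro powr_mono') auto
      then show "\<bar>x - y\<bar> \<le> \<bar>x - y\<bar> powr \<gamma>" by simp
      have "(1 + \<bar>x\<bar>) ^ k * norm (f y) \<le> 2 ^ k * (1 + \<bar>y\<bar>) ^ k * norm (f y)"
        by (intro mult_right_mono one_plus_abs_le xy) simp
      also have "\<dots> \<le> 2 ^ k * ((1 + \<bar>y\<bar>) ^ Suc k * norm (f y))"
        by (simp add: algebra_simps)
      also have "\<dots> \<le> 2 ^ k * C"
        by (intro mult_left_mono C) simp
      finally show "(1 + \<bar>x\<bar>) ^ k * norm (f y) \<le> 2 ^ k * C" .
    qed simp_all
    finally show ?thesis by (simp add: algebra_simps)
  qed
  then show "\<exists>C. \<forall>x y. \<bar>x - y\<bar> \<le> 1 \<longrightarrow>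
      (1 + \<bar>x\<bar>) ^ k * norm (x *\<^sub>R f x - y *\<^sub>R f y) \<le> C * \<bar>x - y\<bar> powr \<gamma>"
    by blast
qed (use rapid_holder_exponent[OF f] in auto)

lemma rapid_holder_times_power:
  "rapid_holder \<gamma> f \<Longrightarrow> rapid_holder \<gamma> (\<lambda>x. x ^ k *\<^sub>R f x)"
  by (induction k) (simp_all add: rapid_holder_times_ident flip: scaleR_scaleR)

text \<open>Near \<open>x\<close>, on an interval whose length is a negative power of \<open>1 + \<bar>x\<bar>\<close>, the exponential is at
  least half its value at \<open>x\<close>. The moments therefore bound the values.\<close>
lemma rapid_holder_exp:
  fixes W :: "real \<Rightarrow> 'a::{real_normed_algebra_1,banach}"
  assumes W: "poly_holder W"
    and sq: "\<And>x t. norm (exp ((2 * t) *\<^sub>R W x)) = (norm (exp (t *\<^sub>R W x)))\<^sup>2"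
    and moments: "\<And>k. integrable lborel (\<lambda>x. \<bar>x\<bar> ^ k * norm (exp (W x)))"
  shows "\<exists>\<gamma>. rapid_holder \<gamma> (\<lambda>x. exp (W x))"
proof -
  define r where "r x = norm (exp (W x))" for x
  obtain \<gamma> C m where \<gamma>: "0 < \<gamma>" "\<gamma> \<le> 1" and C: "0 \<le> C"
    and hol: "\<And>x y. \<bar>x - y\<bar> \<le> 1 \<Longrightarrow> norm (W x - W y) \<le> C * (1 + \<bar>x\<bar>) ^ m * \<bar>x - y\<bar> powr \<gamma>"
    using W unfolding poly_holder_def by blast
  have r: "0 \<le> r x" for x
    by (simp add: r_def)
  have diff: "norm (exp (W x) - exp (W y)) \<le> norm (W x - W y) * max (r x) (r y)" for x y
    unfolding r_def by (rule norm_exp_diff_le[OF sq sq])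
  obtain q :: nat where q: "1 / \<gamma> \<le> q"
    using real_arch_simple by blast
  \<comment> \<open>On distances up to \<open>\<delta> x\<close> the Hoelder bound is at most 1/2:
    as q * \<gamma> \<ge> 1, the power \<open>\<delta> x powr \<gamma>\<close> is at most 1 /
    \<open>B x\<close>. The 1 added to C keeps \<open>B x\<close> at least 1 even if C = 0.\<close>
  define B where "B x = 2 * (C + 1) * (1 + \<bar>x\<bar>) ^ m" for x :: real
  define \<delta> where "\<delta> x = 1 / B x ^ q" for x
  have B: "2 * (C + 1) \<le> B x" "1 \<le> B x" for x
  proof -
    show "2 * (C + 1) \<le> B x"
      unfolding B_def using mult_left_mono[OF one_le_one_plus_abs[of x m], of "2 * (C + 1)"] C by simp
    then show "1 \<le> B x" using C by simp
  qed
  then have \<delta>: "0 < \<delta> x" "\<delta> x \<le> 1" for x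
    using less_le_trans[OF zero_less_one B(2)[of x]] by (simp_all add: \<delta>_def one_le_power)
  have close: "r x \<le> 2 * r y" if xy: "\<bar>x - y\<bar> \<le> \<delta> x" for x y
  proof -
    have "\<bar>x - y\<bar> powr \<gamma> \<le> \<delta> x powr \<gamma>"
      using xy \<gamma> by (intro powr_mono2) auto
    also have "\<dots> = B x powr (- (q * \<gamma>))"
      using B(2)[of x]
      by (simp add: \<delta>_def powr_minus powr_divide powr_powr inverse_eq_divide flip: powr_realpow)
    also have "\<dots> \<le> B x powr (- 1)"
      using q \<gamma> B(2)[of x] by (intro powr_mono) (auto simp: field_simps)
    also have "\<dots> = 1 / B x"
      using B(2)[of x] by (simp add: powr_minus divide_inverse)
    finally have "C * (1 + \<bar>x\<bar>) ^ m * \<bar>x - y\<bar> powr \<gamma> \<le> C * (1 + \<bar>x\<bar>) ^ m * (1 / B x)"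
      by (rule mult_left_mono) (simp add: C)
    also have "\<dots> = C / (2 * (C + 1))"
      using less_le_trans[OF zero_less_one one_le_one_plus_abs[of x m]] by (simp add: B_def)
    also have "\<dots> \<le> 1 / 2"
      using C by (simp add: field_simps)
    finally have "norm (W x - W y) \<le> 1 / 2"
      using hol[of x y] xy \<delta>(2)[of x] by linarith
    then have "norm (exp (W x) - exp (W y)) \<le> (1 / 2) * max (r x) (r y)"
      using diff[of x y] r[of x] by (meson max.coboundedI1 mult_right_mono order_trans)
    moreover have "r x - r y \<le> norm (exp (W x) - exp (W y))"
      by (simp add: r_def norm_triangle_ineq2)
    ultimately show ?thesis
      using r[of y] by (simp add: max_def split: if_splits)
  qed
  have int: "integrable lborel (\<lambda>x. (1 + \<bar>x\<bar>) ^ k * r x)" for k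
  proof -
    have "(1 + \<bar>x\<bar>) ^ k * r x = (\<Sum>i\<le>k. of_nat (k choose i) * (\<bar>x\<bar> ^ i * r x))" for x
      by (subst add.commute, subst binomial_ring) (simp add: sum_distrib_left sum_distrib_right mult_ac)
    then show ?thesis
      using moments by (simp add: r_def)
  qed
  have decay: "\<exists>K\<ge>0. \<forall>x. (1 + \<bar>x\<bar>) ^ k * r x \<le> K" for k
  proof -
    \<comment> \<open>The interval at x has length of order 1 / (1 + \<bar>x\<bar>) ^ (m * q); the
      additional weight compensates for it.\<close>
    define j where "j = k + m * q"
    define I where "I = (LINT y|lborel. (1 + \<bar>y\<bar>) ^ j * r y)"
    have I: "0 \<le> I"
      unfolding I_def by (intro integral_nonneg_AE) (simp add: r)
    have "(1 + \<bar>x\<bar>) ^ k * r x \<le> (2 * (C + 1)) ^ q * (2 ^ Suc j * I)" for x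
    proof -
      \<comment> \<open>On the interval the value at x is at most twice the value at y, and the
        weights differ by at most 2 ^ j; hence \<open>2 ^ Suc j\<close>.\<close>
      have "(LINT y|lborel. indicator {x..x + \<delta> x} y * ((1 + \<bar>x\<bar>) ^ j * r x))
          \<le> (LINT y|lborel. 2 ^ Suc j * ((1 + \<bar>y\<bar>) ^ j * r y))"
      proof (rule integral_mono)
        show "integrable lborel (\<lambda>y. indicator {x..x + \<delta> x} y * ((1 + \<bar>x\<bar>) ^ j * r x))"
          using less_imp_le[OF \<delta>(1)[of x]]
          by (intro integrable_mult_left integrable_real_indicator) simp_all
        show "integrable lborel (\<lambda>y. 2 ^ Suc j * ((1 + \<bar>y\<bar>) ^ j * r y))"
          using int by simp
        fix y
        show "indicator {x..x + \<delta> x} y * ((1 + \<bar>x\<bar>) ^ j * r x) \<le> 2 ^ Suc j * ((1 + \<bar>y\<bar>) ^ j * r y)"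
        proof (cases "y \<in> {x..x + \<delta> x}")
          case True
          then have xy: "\<bar>x - y\<bar> \<le> \<delta> x" "\<bar>x - y\<bar> \<le> 1"
            using \<delta>(2)[of x] by auto
          have "(1 + \<bar>x\<bar>) ^ j * r x \<le> 2 ^ j * (1 + \<bar>y\<bar>) ^ j * (2 * r y)"
            by (intro mult_mono one_plus_abs_le close xy r) simp
          then show ?thesis
            using True by (simp add: mult_ac)
        qed (simp add: r)
      qed
      then have "\<delta> x * ((1 + \<bar>x\<bar>) ^ j * r x) \<le> 2 ^ Suc j * I"
        using \<delta>(1)[of x] by (simp add: I_def)
      also have "\<delta> x * ((1 + \<bar>x\<bar>) ^ j * r x) = (1 + \<bar>x\<bar>) ^ k * r x / (2 * (C + 1)) ^ q"
        using abs_ge_zero[of x]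
        by (simp add: \<delta>_def j_def B_def power_mult_distrib power_add power_mult add_nonneg_eq_0_iff)
      finally show ?thesis
        using C by (simp add: field_simps)
    qed
    moreover have "0 \<le> (2 * (C + 1)) ^ q * (2 ^ Suc j * I)"
      using I C by simp
    ultimately show ?thesis by blast
  qed
  have "rapid_holder \<gamma> (\<lambda>x. exp (W x))"
  proof (rule rapid_holderI)
    fix k
    show "\<exists>C. \<forall>x. (1 + \<bar>x\<bar>) ^ k * norm (exp (W x)) \<le> C"
      using decay[of k] unfolding r_def by blast
    \<comment> \<open>The extra m powers pay for the growth of the Hoelder constants of W.\<close>
    obtain K where K: "0 \<le> K" "\<And>x. (1 + \<bar>x\<bar>) ^ (k + m) * r x \<le> K"
      using decay by blast
    have "(1 + \<bar>x\<bar>) ^ k * norm (exp (W x) - exp (W y)) \<le> (C * (2 ^ (k + m) * K)) * \<bar>x - y\<bar> powr \<gamma>"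
      if xy: "\<bar>x - y\<bar> \<le> 1" for x y
    proof -
      have "(1 + \<bar>x\<bar>) ^ (k + m) * r y \<le> 2 ^ (k + m) * (1 + \<bar>y\<bar>) ^ (k + m) * r y"
        by (intro mult_right_mono one_plus_abs_le xy r)
      also have "\<dots> \<le> 2 ^ (k + m) * K"
        using K(2) by (simp add: mult.assoc)
      finally have "(1 + \<bar>x\<bar>) ^ (k + m) * r y \<le> 2 ^ (k + m) * K" .
      moreover have "(1 + \<bar>x\<bar>) ^ (k + m) * r x \<le> 2 ^ (k + m) * K"
        using K(2)[of x] mult_right_mono[OF one_le_power[of 2 "k + m"] K(1)] by simp
      ultimately have max: "(1 + \<bar>x\<bar>) ^ (k + m) * max (r x) (r y) \<le> 2 ^ (k + m) * K"
        by (simp add: max_def)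
      have "(1 + \<bar>x\<bar>) ^ k * norm (exp (W x) - exp (W y)) \<le>
          (1 + \<bar>x\<bar>) ^ k * ((C * (1 + \<bar>x\<bar>) ^ m * \<bar>x - y\<bar> powr \<gamma>) * max (r x) (r y))"
        by (intro mult_left_mono order_trans[OF diff] mult_right_mono hol xy)
          (simp_all add: le_max_iff_disj r)
      also have "\<dots> = C * \<bar>x - y\<bar> powr \<gamma> * ((1 + \<bar>x\<bar>) ^ (k + m) * max (r x) (r y))"
        by (simp add: power_add)
      also have "\<dots> \<le> C * \<bar>x - y\<bar> powr \<gamma> * (2 ^ (k + m) * K)"
        by (intro mult_left_mono max) (simp add: C)
      finally show ?thesis by (simp add: mult_ac)
    qed
    then show "\<exists>C. \<forall>x y. \<bar>x - y\<bar> \<le> 1 \<longrightarrow>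
        (1 + \<bar>x\<bar>) ^ k * norm (exp (W x) - exp (W y)) \<le> C * \<bar>x - y\<bar> powr \<gamma>"
      by blast
  qed (use \<gamma> in auto)
  then show ?thesis by blast
qed

text \<open>The estimates are made for the operator-valued function; the entries are bounded linear
  images of it and so inherit one common exponent.\<close>

lemma rapid_holder_matrix_exp:
  fixes V :: "real \<Rightarrow> complex^'n^'n"
  assumes herm: "\<And>x. hermitian_matrix (V x)"
    and holder: "\<And>i j. holder_continuous (\<lambda>x. V x $ i $ j)"
    and moments: "finite_moments (\<lambda>x. matrix_exp (- V x))"
  shows "\<exists>\<gamma>. \<forall>i j. rapid_holder \<gamma> (\<lambda>x. matrix_exp (- V x) $ i $ j)"
proof -
  define W where "W x = cop_of_matrix (- V x)" for x
  have exp_W: "exp (W x) = cop_of_matrix (matrix_exp (- V x))" for x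
    by (simp add: W_def matrix_exp_eq_exp(2))
  have "poly_holder V"
    by (intro poly_holder_vec poly_holder_holder_continuous holder)
  then have W: "poly_holder W"
    unfolding W_def
    by (intro poly_holder_bounded_linear[OF bounded_linear_compose[OF bounded_linear_cop_of_matrix
          bounded_linear_minus[OF bounded_linear_ident]]])
  have "hermitian_matrix (- V x)" for x
    using herm[of x] unfolding hermitian_matrix_def
    by (metis complex_cnj_minus vector_uminus_component)
  then have sq: "norm (exp ((2 * t) *\<^sub>R W x)) = (norm (exp (t *\<^sub>R W x)))\<^sup>2" for x t
    unfolding W_def by (intro norm_exp_double self_adjoint_cop_of_matrix)
  have "integrable lborel (\<lambda>x. \<bar>x\<bar> ^ k * norm (exp (W x)))" for k
  proof -
    let ?f = "\<lambda>x. x ^ k *\<^sub>R matrix_exp (- V x)"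
    obtain K where K: "\<And>A :: complex^'n^'n. norm (cop_of_matrix A) \<le> norm A * K"
      using bounded_linear.bounded[OF bounded_linear_cop_of_matrix] by blast
    have f: "integrable lborel ?f"
      using moments by (simp add: finite_moments_def)
    have "integrable lborel (\<lambda>x. norm (cop_of_matrix (?f x)))"
    proof (rule Bochner_Integration.integrable_bound)
      show "integrable lborel (\<lambda>x. norm (?f x) * K)"
        by (intro integrable_mult_left integrable_norm f)
      show "(\<lambda>x. norm (cop_of_matrix (?f x))) \<in> borel_measurable lborel"
        by (rule borel_measurable_continuous_on[OF _ borel_measurable_integrable[OF f]])
          (intro continuous_intros bounded_linear.continuous_on[OF bounded_linear_cop_of_matrix])
      show "AE x in lborel. norm (norm (cop_of_matrix (?f x))) \<le> norm (norm (?f x) * K)"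
        by (intro AE_I2) (use order_trans[OF K abs_ge_self] in \<open>simp only: real_norm_def abs_norm_cancel\<close>)
    qed
    then show ?thesis
      by (simp add: linear_scale[OF linear_cop_of_matrix] exp_W power_abs)
  qed
  from rapid_holder_exp[OF W sq this] obtain \<gamma> where "rapid_holder \<gamma> (\<lambda>x. exp (W x))"
    by blast
  then have "rapid_holder \<gamma> (\<lambda>x. matrix_of_cop (exp (W x)))"
    by (rule rapid_holder_bounded_linear[OF bounded_linear_matrix_of_cop])
  then have "rapid_holder \<gamma> (\<lambda>x. matrix_exp (- V x))"
    by (simp add: exp_W)
  then have "rapid_holder \<gamma> (\<lambda>x. matrix_exp (- V x) $ i $ j)" for i j
    by (rule rapid_holder_bounded_linear[OF bounded_linear_compose[OF bounded_linear_vec_nth bounded_linear_vec_nth]])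
  then show ?thesis by blast
qed

subsection \<open>Cauchy transforms\<close>

lemma integrable_inverse_1_plus_square: "integrable lborel (\<lambda>x::real. inverse (1 + x\<^sup>2))"
proof -
  have "(\<integral>\<^sup>+x. ennreal (inverse (1 + x\<^sup>2)) * indicator {0..} x \<partial>lborel) = pi/2 - arctan 0"
    by (rule nn_integral_FTC_atLeast) (auto intro!: derivative_eq_intros tendsto_arctan_at_top)
  then have p: "(\<integral>\<^sup>+x. ennreal (inverse (1 + x\<^sup>2)) * indicator {0..} x \<partial>lborel) < \<infinity>"
    by simp
  have "(\<lambda>x::real. ennreal (norm (indicator {0..} x *\<^sub>R inverse (1 + x\<^sup>2))))
      = (\<lambda>x. ennreal (inverse (1 + x\<^sup>2)) * indicator {0..} x)"
    by (auto simp: indicator_def fun_eq_iff)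
  then have "integrable lborel (\<lambda>x::real. indicator {0..} x *\<^sub>R inverse (1 + x\<^sup>2))"
    by (intro integrableI_bounded) (use p in simp_all)
  then have 1: "set_integrable lborel {0..} (\<lambda>x::real. inverse (1 + x\<^sup>2))"
    unfolding set_integrable_def .
  have "integrable lborel (\<lambda>x::real. indicator {0..} (0 + (-1) * x) *\<^sub>R inverse (1 + (0 + (-1) * x)\<^sup>2))"
    by (rule lborel_integrable_real_affine) (use 1 in \<open>simp_all add: set_integrable_def\<close>)
  moreover have "indicator {0..} (0 + (-1) * x) = (indicator {..0} x :: real)" for x :: real
    by (simp add: indicator_def)
  ultimately have "set_integrable lborel {..0} (\<lambda>x::real. inverse (1 + x\<^sup>2))"
    by (simp add: set_integrable_def)
  from set_integrable_Un[OF 1 this] have "set_integrable lborel ({0..} \<union> {..0}) (\<lambda>x::real. inverse (1 + x\<^sup>2))"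
    by simp
  moreover have "{0..} \<union> {..0} = (UNIV :: real set)"
    by auto
  ultimately show ?thesis
    by (simp add: set_integrable_def)
qed


text \<open>Used with a = \<gamma> - 1, the singularity that is left of the Cauchy kernel after a
  Hoelder estimate of the numerator.\<close>

lemma integrable_abs_powr:
  assumes "-1 < a"
  shows "integrable lborel (\<lambda>x::real. indicator {-1..1} x * \<bar>x\<bar> powr a)"
proof -
  let ?f = "\<lambda>x::real. indicator {0..1} x * \<bar>x\<bar> powr a"
  have "(\<lambda>x. x powr a) absolutely_integrable_on {0..1}"
    by (intro nonnegative_absolutely_integrable_1 integrable_on_powr_from_0 assms) auto
  then have "integrable lebesgue (\<lambda>x::real. indicator {0..1} x * x powr a)"
    by (simp add: set_integrable_def)
  also have "(\<lambda>x::real. indicator {0..1} x * x powr a) = ?f"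
    by (auto simp: indicator_def)
  finally have 1: "integrable lborel ?f"
    by (subst (asm) integrable_completion) auto
  have 2: "integrable lborel (\<lambda>x. ?f (0 + (-1) * x))"
    by (rule lborel_integrable_real_affine[OF 1]) simp
  show ?thesis
  proof (rule Bochner_Integration.integrable_bound[OF Bochner_Integration.integrable_add[OF 1 2]])
    show "AE x in lborel. norm (indicator {-1..1} x * \<bar>x\<bar> powr a) \<le> norm (?f x + ?f (0 + (-1) * x))"
      by (auto simp: indicator_def)
  qed simp
qed

text \<open>Dominated convergence along \<open>at a within S\<close>, reduced to sequences. It
  serves for differentiating the Cauchy transform off the line and for the continuity of the
  regularized transform across it.\<close>

lemma tendsto_integral_within:
  fixes f :: "'b::metric_space \<Rightarrow> 'a \<Rightarrow> 'c::{banach, second_countable_topology}"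
  assumes f: "\<forall>\<^sub>F y in at a within S. f y \<in> borel_measurable M \<and> (\<forall>x. norm (f y x) \<le> w x)"
    and g: "g \<in> borel_measurable M" and w: "integrable M w"
    and lim: "AE x in M. ((\<lambda>y. f y x) \<longlongrightarrow> g x) (at a within S)"
  shows "((\<lambda>y. LINT x|M. f y x) \<longlongrightarrow> (LINT x|M. g x)) (at a within S)"
  unfolding tendsto_at_iff_sequentially
proof (intro allI impI)
  fix X assume X: "\<forall>i. X i \<in> S - {a}" "X \<longlonglongrightarrow> a"
  then have Xa: "filterlim X (at a within S) sequentially"
    by (auto simp: filterlim_at)
  from filterlim_iff[THEN iffD1, OF Xa, rule_format, OF f]
  obtain N where N: "\<And>i. N \<le> i \<Longrightarrow> f (X i) \<in> borel_measurable M \<and> (\<forall>x. norm (f (X i) x) \<le> w x)"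
    by (auto simp: eventually_sequentially)
  have "(\<lambda>i. LINT x|M. f (X (i + N)) x) \<longlonglongrightarrow> (LINT x|M. g x)"
  proof (rule integral_dominated_convergence[OF g _ w])
    show "AE x in M. (\<lambda>i. f (X (i + N)) x) \<longlonglongrightarrow> g x"
      using lim
    proof eventually_elim
      case (elim x)
      show ?case
        using LIMSEQ_ignore_initial_segment[OF filterlim_compose[OF elim Xa]] .
    qed
  qed (use N in auto)
  then show "((\<lambda>y. LINT x|M. f y x) \<circ> X) \<longlonglongrightarrow> (LINT x|M. g x)"
    unfolding comp_def by (rule LIMSEQ_offset)
qed

lemma continuous_on_rapid_holder:
  assumes f: "rapid_holder \<gamma> f"
  shows "continuous_on UNIV f"
  unfolding continuous_on_eq_continuous_within
proof
  fix x :: real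
  obtain C where C: "\<And>x y. \<bar>x - y\<bar> \<le> 1 \<Longrightarrow> (1 + \<bar>x\<bar>) ^ 0 * norm (f x - f y) \<le> C * \<bar>x - y\<bar> powr \<gamma>"
    using rapid_holder_diff[OF f] by metis
  have "\<forall>\<^sub>F y in at x. dist y x < 1"
    using eventually_at_ball[OF zero_less_one, of x UNIV] by eventually_elim (auto simp: dist_commute)
  then have "\<forall>\<^sub>F y in at x. norm (f y - f x) \<le> C * \<bar>y - x\<bar> powr \<gamma>"
    by eventually_elim (use C[of _ x] in \<open>simp add: dist_real_def\<close>)
  moreover have "((\<lambda>y. C * \<bar>y - x\<bar> powr \<gamma>) \<longlongrightarrow> C * \<bar>x - x\<bar> powr \<gamma>) (at x)"
    using rapid_holder_exponent[OF f] by (intro tendsto_intros tendsto_powr') auto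
  ultimately have "((\<lambda>y. f y - f x) \<longlongrightarrow> 0) (at x)"
    using Lim_null_comparison by fastforce
  then show "continuous (at x within UNIV) f"
    by (simp add: continuous_within LIM_zero_iff)
qed

lemma borel_measurable_rapid_holder [measurable_dest]:
  "rapid_holder \<gamma> f \<Longrightarrow> f \<in> borel_measurable borel"
  by (rule borel_measurable_continuous_onI[OF continuous_on_rapid_holder])

lemma integrable_rapid_holder:
  fixes f :: "real \<Rightarrow> 'a::{banach, second_countable_topology}"
  assumes f: "rapid_holder \<gamma> f"
  shows "integrable lborel f"
proof -
  obtain C where C: "0 \<le> C" "\<And>x. (1 + \<bar>x\<bar>) ^ 2 * norm (f x) \<le> C"
    using rapid_holder_decay[OF f] by metis
  show ?thesis
  proof (rule Bochner_Integration.integrable_bound)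
    show "integrable lborel (\<lambda>x::real. C * inverse (1 + x\<^sup>2))"
      by (intro integrable_mult_right integrable_inverse_1_plus_square)
    show "AE x in lborel. norm (f x) \<le> norm (C * inverse (1 + x\<^sup>2))"
    proof (rule AE_I2)
      fix x :: real
      have "(1 + x\<^sup>2) * norm (f x) \<le> (1 + \<bar>x\<bar>) ^ 2 * norm (f x)"
        by (intro mult_right_mono) (auto simp: power2_eq_square algebra_simps)
      also have "\<dots> \<le> C"
        by (rule C(2))
      finally have "norm (f x) \<le> C / (1 + x\<^sup>2)"
        by (simp add: pos_le_divide_eq add_pos_nonneg mult.commute)
      then show "norm (f x) \<le> norm (C * inverse (1 + x\<^sup>2))"
        using C(1) by (simp add: divide_inverse)
    qed
  qed (use borel_measurable_rapid_holder[OF f] in simp)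
qed

section \<open>Cauchy transforms off the line and their regularization\<close>

definition cauchy_transform :: "(real \<Rightarrow> complex) \<Rightarrow> complex \<Rightarrow> complex"
  where "cauchy_transform g z = (LINT x|lborel. g x / (of_real x - z))"

lemma not_Reals_iff_Im: "z \<notin> \<real> \<longleftrightarrow> Im z \<noteq> 0"
  by (simp add: complex_is_Real_iff)

lemma abs_Im_le_norm_of_real_diff: "\<bar>Im z\<bar> \<le> norm (of_real x - z)"
  using abs_Im_le_cmod[of "of_real x - z"] by simp

lemma integrable_divide_of_real_diff:
  fixes g :: "real \<Rightarrow> complex"
  assumes g: "integrable lborel g" and z: "z \<notin> \<real>"
  shows "integrable lborel (\<lambda>x. g x / (of_real x - z))"
proof (rule Bochner_Integration.integrable_bound)
  show "integrable lborel (\<lambda>x. g x / of_real \<bar>Im z\<bar>)"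
    using g by simp
  show "(\<lambda>x. g x / (of_real x - z)) \<in> borel_measurable lborel"
    using borel_measurable_integrable[OF g] by simp
  show "AE x in lborel. norm (g x / (of_real x - z)) \<le> norm (g x / of_real \<bar>Im z\<bar>)"
    using z abs_Im_le_norm_of_real_diff[of z]
    by (auto intro!: AE_I2 divide_left_mono simp: norm_divide not_Reals_iff_Im zero_less_mult_iff)
qed

text \<open>Differentiation under the integral: the difference quotient is an integral with kernel 1
  / ((x - y) (x - z)), which is dominated as long as y keeps half the distance of z from the
  line.\<close>

lemma cauchy_transform_holomorphic:
  assumes g: "integrable lborel g"
  shows "cauchy_transform g holomorphic_on - \<real>"
proof -
  have "(cauchy_transform g has_field_derivative (LINT x|lborel. g x / (of_real x - z)\<^sup>2)) (at z)"
    if z: "z \<notin> \<real>" for z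
    unfolding has_field_derivative_iff
  proof (rule Lim_transform_eventually)
    let ?f = "\<lambda>y x. g x / ((of_real x - y) * (of_real x - z))"
    have g': "g \<in> borel_measurable borel"
      using borel_measurable_integrable[OF g] by simp
    define e where "e = \<bar>Im z\<bar> / 2"
    have e: "0 < e"
      using z by (simp add: e_def not_Reals_iff_Im)
    have ev: "\<forall>\<^sub>F y in at z. dist y z < e \<and> y \<noteq> z"
      using eventually_at_ball'[OF e, of z UNIV] by eventually_elim (auto simp: dist_commute)
    have Im: "e \<le> \<bar>Im y\<bar>" if "dist y z < e" for y
      using that abs_Im_le_cmod[of "y - z"] by (simp add: dist_norm e_def)
    show "((\<lambda>y. LINT x|lborel. ?f y x) \<longlongrightarrow> (LINT x|lborel. g x / (of_real x - z)\<^sup>2)) (at z)"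
    proof (rule tendsto_integral_within)
      show "integrable lborel (\<lambda>x. norm (g x) / (e * e))"
        using g by simp
      show "(\<lambda>x. g x / (of_real x - z)\<^sup>2) \<in> borel_measurable lborel"
        using g' by simp
      show "\<forall>\<^sub>F y in at z. ?f y \<in> borel_measurable lborel \<and> (\<forall>x. norm (?f y x) \<le> norm (g x) / (e * e))"
        using ev
      proof eventually_elim
        case (elim y)
        have "norm (?f y x) \<le> norm (g x) / (e * e)" for x
        proof -
          have le: "e * e \<le> norm ((of_real x - y) * (of_real x - z))"
            unfolding norm_mult
            using order_trans[OF Im abs_Im_le_norm_of_real_diff, of y x] elim e
              order_trans[OF Im abs_Im_le_norm_of_real_diff, of z x]
            by (intro mult_mono) auto
          moreover have "0 < e * e"
            using e by simp
          ultimately have pos: "0 < norm ((of_real x - y) * (of_real x - z))"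
            by linarith
          show ?thesis
            unfolding norm_divide by (intro divide_left_mono mult_pos_pos e pos le norm_ge_zero)
        qed
        then show ?case
          using g' by simp
      qed
      show "AE x in lborel. ((\<lambda>y. ?f y x) \<longlongrightarrow> g x / (of_real x - z)\<^sup>2) (at z)"
      proof (rule AE_I2)
        fix x
        have "of_real x - z \<noteq> 0"
          using z by auto
        then show "((\<lambda>y. ?f y x) \<longlongrightarrow> g x / (of_real x - z)\<^sup>2) (at z)"
          unfolding power2_eq_square by (intro tendsto_intros) auto
      qed
    qed
    show "\<forall>\<^sub>F y in at z. (LINT x|lborel. ?f y x) = (cauchy_transform g y - cauchy_transform g z) / (y - z)"
      using ev
    proof eventually_elim
      case (elim y)
      then have y: "y \<notin> \<real>"
        using Im[of y] e by (auto simp: not_Reals_iff_Im)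
      have "?f y x = (g x / (of_real x - y) - g x / (of_real x - z)) / (y - z)" for x
      proof -
        have "of_real x - y \<noteq> 0" "of_real x - z \<noteq> 0" "y - z \<noteq> 0"
          using y z elim by auto
        then show ?thesis
          by (simp add: divide_simps) (simp add: algebra_simps)
      qed
      then show ?case
        unfolding cauchy_transform_def
        using integrable_divide_of_real_diff[OF g y] integrable_divide_of_real_diff[OF g z] by simp
    qed
  qed
  then show ?thesis
    by (auto simp: holomorphic_on_def field_differentiable_def intro: DERIV_subset)
qed

text \<open>From z / (x - z) = x / (x - z) - 1. Each factor z trades g for x g at the price of a
  moment; iterated, this produces the asymptotic series at infinity.\<close>

lemma cauchy_transform_mult_ident:
  assumes g: "rapid_holder \<gamma> g" and z: "z \<notin> \<real>"
  shows "z * cauchy_transform g z = cauchy_transform (\<lambda>x. x *\<^sub>R g x) z - (LINT x|lborel. g x)"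
proof -
  have "z * (g x / (of_real x - z)) = (x *\<^sub>R g x) / (of_real x - z) - g x" for x
  proof -
    have "of_real x - z \<noteq> 0"
      using z by auto
    then show ?thesis
      by (simp add: divide_simps scaleR_conv_of_real) (simp add: algebra_simps)
  qed
  then have "(LINT x|lborel. z * (g x / (of_real x - z)))
      = (LINT x|lborel. (x *\<^sub>R g x) / (of_real x - z) - g x)"
    by simp
  also have "\<dots> = cauchy_transform (\<lambda>x. x *\<^sub>R g x) z - (LINT x|lborel. g x)"
    unfolding cauchy_transform_def
    by (intro Bochner_Integration.integral_diff integrable_divide_of_real_diff z
        integrable_rapid_holder[OF g] integrable_rapid_holder[OF rapid_holder_times_ident[OF g]])
  finally show ?thesis
    by (simp only: cauchy_transform_def integral_mult_right_zero)
qed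

text \<open>The Cauchy transform at \<open>u + iv\<close> with the value of \<open>g\<close> at \<open>u\<close> subtracted near \<open>u\<close>: unlike the
  transform itself this is continuous across the line.\<close>
definition cauchy_regular :: "(real \<Rightarrow> complex) \<Rightarrow> complex \<Rightarrow> complex"
  where "cauchy_regular g z =
    (LINT t|lborel. (g (Re z + t) - indicator {-1..1} t * g (Re z)) / (of_real t - \<i> * of_real (Im z)))"

text \<open>A majorant for the integrand of \<open>cauchy_regular\<close>: the first term comes from
  the Hoelder bound for \<bar>t\<bar> \<le> 1, the second from the decay of g. The factor
  \<open>1 *\<close> fits the affine substitution rule for integrals.\<close>

definition cauchy_kernel_bound :: "real \<Rightarrow> real \<Rightarrow> real \<Rightarrow> real \<Rightarrow> real \<Rightarrow> real"
  where "cauchy_kernel_bound \<gamma> C D u t =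
    D * (indicator {-1..1} t * \<bar>t\<bar> powr (\<gamma> - 1)) + 4 * C * inverse (1 + (u + 1 * t)\<^sup>2)"

lemma integrable_cauchy_kernel_bound:
  assumes "0 < \<gamma>"
  shows "integrable lborel (cauchy_kernel_bound \<gamma> C D u)"
  unfolding cauchy_kernel_bound_def using assms
  by (intro Bochner_Integration.integrable_add integrable_mult_right integrable_abs_powr
      lborel_integrable_real_affine[OF integrable_inverse_1_plus_square]) auto

text \<open>Translation invariance makes the bound on the integral uniform along the whole
  line.\<close>

lemma integral_cauchy_kernel_bound:
  assumes "0 < \<gamma>"
  shows "integral\<^sup>L lborel (cauchy_kernel_bound \<gamma> C D u) = integral\<^sup>L lborel (cauchy_kernel_bound \<gamma> C D 0)"
proof -
  have i: "integrable lborel (\<lambda>t::real. inverse (1 + (u + 1 * t)\<^sup>2))" for u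
    by (intro lborel_integrable_real_affine[OF integrable_inverse_1_plus_square]) auto
  have "(LINT t|lborel. inverse (1 + (u + 1 * t)\<^sup>2)) = (LINT t|lborel. inverse (1 + t\<^sup>2))" for u :: real
    by (subst lborel_integral_real_affine[of 1 "\<lambda>t. inverse (1 + t\<^sup>2)" u]) simp_all
  then have "integral\<^sup>L lborel (cauchy_kernel_bound \<gamma> C D u)
      = D * (LINT t|lborel. indicator {-1..1} t * \<bar>t\<bar> powr (\<gamma> - 1)) + 4 * C * (LINT t|lborel. inverse (1 + t\<^sup>2))" for u
    unfolding cauchy_kernel_bound_def using assms
    by (subst Bochner_Integration.integral_add)
      (auto intro!: integrable_mult_right integrable_abs_powr i i[simplified])
  then show ?thesis by simp
qed

text \<open>The majorant does not involve v, because \<bar>t\<bar> is at most the modulus of t - i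
  v, and it is the same for all u within 1 of u0. The case u = u0 gives boundedness, a moving u
  gives continuity.\<close>

lemma norm_cauchy_regular_integrand:
  assumes g: "rapid_holder \<gamma> g"
  obtains C D where "\<And>u u0 t v. \<bar>u - u0\<bar> \<le> 1 \<Longrightarrow>
    norm ((g (u + t) - indicator {-1..1} t * g u) / (of_real t - \<i> * of_real v)) \<le> cauchy_kernel_bound \<gamma> C D u0 t"
proof -
  obtain C where C: "0 \<le> C" "\<And>x. (1 + \<bar>x\<bar>) ^ 2 * norm (g x) \<le> C"
    using rapid_holder_decay[OF g] by metis
  obtain D where D: "0 \<le> D" "\<And>x y. \<bar>x - y\<bar> \<le> 1 \<Longrightarrow> (1 + \<bar>x\<bar>) ^ 0 * norm (g x - g y) \<le> D * \<bar>x - y\<bar> powr \<gamma>"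
    using rapid_holder_diff[OF g] by metis
  have "norm ((g (u + t) - indicator {-1..1} t * g u) / (of_real t - \<i> * of_real v)) \<le> cauchy_kernel_bound \<gamma> C D u0 t"
    if u: "\<bar>u - u0\<bar> \<le> 1" for u u0 t v
  proof (cases "t = 0")
    case True
    then show ?thesis
      using C(1) D(1) by (simp add: cauchy_kernel_bound_def)
  next
    case False
    let ?n = "norm (g (u + t) - indicator {-1..1} t * g u)"
    have "\<bar>t\<bar> \<le> norm (of_real t - \<i> * of_real v)"
      using abs_Re_le_cmod[of "of_real t - \<i> * of_real v"] by simp
    then have "norm ((g (u + t) - indicator {-1..1} t * g u) / (of_real t - \<i> * of_real v)) \<le> ?n / \<bar>t\<bar>"
      using False unfolding norm_divide by (intro divide_left_mono) (auto intro: mult_pos_pos)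
    also have "\<dots> \<le> cauchy_kernel_bound \<gamma> C D u0 t"
    proof (cases "t \<in> {-1..1}")
      case True
      then have "?n \<le> D * \<bar>t\<bar> powr \<gamma>"
        using D(2)[of "u + t" u] by (simp add: abs_le_iff)
      then have "?n / \<bar>t\<bar> \<le> D * \<bar>t\<bar> powr \<gamma> / \<bar>t\<bar>"
        by (rule divide_right_mono) simp
      also have "\<dots> = D * \<bar>t\<bar> powr (\<gamma> - 1)"
        using False by (simp add: powr_diff)
      finally show ?thesis
        using True C(1) by (simp add: cauchy_kernel_bound_def add_increasing2)
    next
      case t: False
      have "(1 + (u0 + t)\<^sup>2) \<le> (1 + \<bar>u0 + t\<bar>) ^ 2"
        by (auto simp: power2_eq_square algebra_simps)
      also have "\<dots> \<le> 2 ^ 2 * (1 + \<bar>u + t\<bar>) ^ 2"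
        using u by (intro one_plus_abs_le) simp
      finally have "(1 + (u0 + t)\<^sup>2) * norm (g (u + t)) \<le> 2 ^ 2 * (1 + \<bar>u + t\<bar>) ^ 2 * norm (g (u + t))"
        by (rule mult_right_mono) simp
      also have "\<dots> \<le> 4 * C"
        using C(2)[of "u + t"] by simp
      finally have "norm (g (u + t)) \<le> 4 * C / (1 + (u0 + t)\<^sup>2)"
        by (simp add: pos_le_divide_eq add_pos_nonneg mult.commute)
      moreover have "?n / \<bar>t\<bar> \<le> norm (g (u + t)) / 1"
        using t by (intro frac_le) auto
      ultimately show ?thesis
        using t by (simp add: cauchy_kernel_bound_def divide_inverse)
    qed
    finally show ?thesis .
  qed
  then show ?thesis
    using that by blast
qed

lemma cauchy_regular_bounded:
  assumes g: "rapid_holder \<gamma> g"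
  shows "\<exists>K. \<forall>z. norm (cauchy_regular g z) \<le> K"
proof -
  obtain C D where *: "\<And>u u0 t v. \<bar>u - u0\<bar> \<le> 1 \<Longrightarrow>
    norm ((g (u + t) - indicator {-1..1} t * g u) / (of_real t - \<i> * of_real v)) \<le> cauchy_kernel_bound \<gamma> C D u0 t"
    using norm_cauchy_regular_integrand[OF g] by blast
  have \<gamma>: "0 < \<gamma>"
    using rapid_holder_exponent[OF g] by simp
  have "norm (cauchy_regular g z) \<le> integral\<^sup>L lborel (cauchy_kernel_bound \<gamma> C D (Re z))" for z
    unfolding cauchy_regular_def
  proof (rule Bochner_Integration.integral_norm_bound_integral)
    let ?f = "\<lambda>t. (g (Re z + t) - indicator {-1..1} t * g (Re z)) / (of_real t - \<i> * of_real (Im z))"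
    show le: "norm (?f t) \<le> cauchy_kernel_bound \<gamma> C D (Re z) t" for t
      by (rule *) simp
    show "integrable lborel ?f"
      by (rule Bochner_Integration.integrable_bound[OF integrable_cauchy_kernel_bound[OF \<gamma>]])
        (use borel_measurable_rapid_holder[OF g] order_trans[OF le abs_ge_self] in auto)
  qed (rule integrable_cauchy_kernel_bound[OF \<gamma>])
  then show ?thesis
    by (metis integral_cauchy_kernel_bound[OF \<gamma>])
qed

lemma continuous_on_cauchy_regular:
  assumes g: "rapid_holder \<gamma> g"
  shows "continuous_on UNIV (cauchy_regular g)"
  unfolding continuous_on_def
proof
  fix z0 :: complex
  obtain C D where *: "\<And>u u0 t v. \<bar>u - u0\<bar> \<le> 1 \<Longrightarrow>
    norm ((g (u + t) - indicator {-1..1} t * g u) / (of_real t - \<i> * of_real v)) \<le> cauchy_kernel_bound \<gamma> C D u0 t"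
    using norm_cauchy_regular_integrand[OF g] by blast
  have \<gamma>: "0 < \<gamma>"
    using rapid_holder_exponent[OF g] by simp
  have m: "g \<in> borel_measurable borel"
    by (rule borel_measurable_rapid_holder[OF g])
  have c: "isCont g x" for x
    using continuous_on_rapid_holder[OF g] by (simp add: continuous_on_eq_continuous_at)
  show "(cauchy_regular g \<longlongrightarrow> cauchy_regular g z0) (at z0 within UNIV)"
    unfolding cauchy_regular_def
  proof (rule tendsto_integral_within)
    let ?f = "\<lambda>z t. (g (Re z + t) - indicator {-1..1} t * g (Re z)) / (of_real t - \<i> * of_real (Im z))"
    show "integrable lborel (cauchy_kernel_bound \<gamma> C D (Re z0))"
      by (rule integrable_cauchy_kernel_bound[OF \<gamma>])
    show "?f z0 \<in> borel_measurable lborel"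
      using m by measurable
    have "\<forall>\<^sub>F z in at z0. dist z z0 < 1"
      using eventually_at_ball[OF zero_less_one, of z0 UNIV] by eventually_elim (auto simp: dist_commute)
    then show "\<forall>\<^sub>F z in at z0. ?f z \<in> borel_measurable lborel \<and>
        (\<forall>t. norm (?f z t) \<le> cauchy_kernel_bound \<gamma> C D (Re z0) t)"
    proof eventually_elim
      case (elim z)
      have "\<bar>Re z - Re z0\<bar> \<le> 1"
        using elim abs_Re_le_cmod[of "z - z0"] by (simp add: dist_norm)
      then show ?case
        using * m by auto
    qed
    show "AE t in lborel. ((\<lambda>z. ?f z t) \<longlongrightarrow> ?f z0 t) (at z0)"
      \<comment> \<open>At t = 0 the denominator vanishes when z0 is real, so this one point is left
        out.\<close>
      using AE_lborel_singleton[of 0]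
    proof eventually_elim
      case (elim t)
      have "of_real t - \<i> * of_real (Im z0) \<noteq> 0"
        using elim by (auto simp: complex_eq_iff)
      then show ?case
        by (intro tendsto_intros isCont_tendsto_compose[OF c])
    qed
  qed
qed

section \<open>Bounds up to the line and boundary values\<close>

lemma integral_inverse_of_real_diff_imaginary:
  assumes "v \<noteq> 0"
  shows "has_bochner_integral lborel (\<lambda>t. indicator {-1..1} t *\<^sub>R (1 / (of_real t - \<i> * of_real v)))
    (2 * \<i> * of_real (arctan (1 / v)))"
proof -
  \<comment> \<open>Up to a constant, a branch of the logarithm of t - i v. Its imaginary part
    \<open>arctan (t / v)\<close> is smooth on the whole interval as v \<noteq> 0, and its real
    parts at 1 and -1 cancel.\<close>
  define F where "F t = Complex (ln (t\<^sup>2 + v\<^sup>2) / 2) (arctan (t / v))" for t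
  have nz: "0 < t\<^sup>2 + v\<^sup>2" for t
    using assms by (simp add: add_nonneg_pos)
  have d: "(F has_vector_derivative 1 / (of_real t - \<i> * of_real v)) (at t within {-1..1})" for t
  proof -
    have eq: "1 / (of_real t - \<i> * of_real v) = Complex (t / (t\<^sup>2 + v\<^sup>2)) (v / (t\<^sup>2 + v\<^sup>2))"
      by (simp add: complex_eq_iff Re_divide Im_divide)
    have "((\<lambda>t. ln (t\<^sup>2 + v\<^sup>2)) has_real_derivative 2 * t / (t\<^sup>2 + v\<^sup>2)) (at t within {-1..1})"
      using nz by (auto intro!: derivative_eq_intros)
    moreover have "2 * t / a / 2 = t / a" for a
      by simp
    ultimately
    have 1: "((\<lambda>t. ln (t\<^sup>2 + v\<^sup>2) / 2) has_real_derivative t / (t\<^sup>2 + v\<^sup>2)) (at t within {-1..1})"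
      using DERIV_cdivide[of _ _ t _ 2] by metis
    have "1 / v * inverse (1 + (t / v)\<^sup>2) = v / (t\<^sup>2 + v\<^sup>2)"
      using assms nz[of t] by (simp add: field_simps power2_eq_square)
    then have 2: "((\<lambda>t. arctan (t / v)) has_real_derivative v / (t\<^sup>2 + v\<^sup>2)) (at t within {-1..1})"
      by (auto intro!: derivative_eq_intros simp: assms divide_inverse mult.commute)
    show ?thesis
      using 1 2 by (simp add: has_vector_derivative_complex_iff eq F_def[abs_def])
  qed
  have "continuous_on {-1..1} (\<lambda>t. 1 / (of_real t - \<i> * of_real v))"
    using assms by (intro continuous_intros) (auto simp: complex_eq_iff)
  from has_bochner_integral_FTC_Icc[OF _ d this]
  have "has_bochner_integral lborel (\<lambda>t. indicator {-1..1} t *\<^sub>R (1 / (of_real t - \<i> * of_real v))) (F 1 - F (-1))"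
    by simp
  also have "F 1 - F (-1) = 2 * \<i> * of_real (arctan (1 / v))"
    by (simp add: F_def complex_eq_iff arctan_minus)
  finally show ?thesis .
qed

text \<open>The subtracted value can be integrated explicitly. All of the discontinuity at the line
  then sits in \<open>arctan (1 / Im z)\<close>, which tends to pi / 2 from above and to - pi / 2
  from below.\<close>

lemma cauchy_transform_eq_cauchy_regular:
  assumes g: "rapid_holder \<gamma> g" and z: "z \<notin> \<real>"
  shows "cauchy_transform g z = cauchy_regular g z + g (Re z) * (2 * \<i> * of_real (arctan (1 / Im z)))"
proof -
  define u v where "u = Re z" and "v = Im z"
  have v: "v \<noteq> 0"
    using z by (simp add: v_def not_Reals_iff_Im)
  have zuv: "z = of_real u + \<i> * of_real v"
    by (simp add: u_def v_def complex_eq)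
  let ?h = "\<lambda>t. g (u + 1 * t) / (of_real (u + 1 * t) - z)"
  have "integrable lborel (\<lambda>x. g x / (of_real x - z))"
    by (intro integrable_divide_of_real_diff integrable_rapid_holder[OF g] z)
  then have h: "integrable lborel ?h"
    by (rule lborel_integrable_real_affine) simp
  let ?k = "\<lambda>t. g u * (indicator {-1..1} t *\<^sub>R (1 / (of_real t - \<i> * of_real v)))"
  note K = integral_inverse_of_real_diff_imaginary[OF v]
  have k: "integrable lborel ?k"
    using K by (intro integrable_mult_right) (auto simp: has_bochner_integral_iff)
  have "cauchy_transform g z = (LINT t|lborel. ?h t)"
    unfolding cauchy_transform_def
    using lborel_integral_real_affine[of 1 "\<lambda>x. g x / (of_real x - z)" u] by simp
  also have "\<dots> = (LINT t|lborel. ?h t - ?k t) + (LINT t|lborel. ?k t)"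
    using h k by simp
  also have "(LINT t|lborel. ?h t - ?k t) = cauchy_regular g z"
    unfolding cauchy_regular_def u_def[symmetric] v_def[symmetric]
    by (intro Bochner_Integration.integral_cong refl)
      (simp add: zuv diff_divide_distrib indicator_def)
  also have "(LINT t|lborel. ?k t) = g u * (2 * \<i> * of_real (arctan (1 / v)))"
    using K by (simp only: has_bochner_integral_iff integral_mult_right_zero)
  finally show ?thesis
    by (simp add: u_def v_def)
qed

text \<open>The constant is good right up to the line: the regularized transform is bounded
  everywhere and the arctangent term is at most pi times the supremum of the modulus of g.\<close>

lemma cauchy_transform_bounded:
  assumes g: "rapid_holder \<gamma> g"
  shows "\<exists>K\<ge>0. \<forall>z. z \<notin> \<real> \<longrightarrow> norm (cauchy_transform g z) \<le> K"
proof -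
  obtain K where K: "\<And>z. norm (cauchy_regular g z) \<le> K"
    using cauchy_regular_bounded[OF g] by blast
  obtain C where C: "0 \<le> C" "\<And>x. (1 + \<bar>x\<bar>) ^ 0 * norm (g x) \<le> C"
    using rapid_holder_decay[OF g] by metis
  have "norm (cauchy_transform g z) \<le> K + C * pi" if "z \<notin> \<real>" for z
  proof -
    have "norm (2 * \<i> * of_real (arctan (1 / Im z)) :: complex) \<le> pi"
      using arctan_bounded[of "1 / Im z"] by (simp add: norm_mult) arith
    then show ?thesis
      unfolding cauchy_transform_eq_cauchy_regular[OF g that]
      using C by (intro norm_triangle_le add_mono K) (simp only: norm_mult[of "g _"], intro mult_mono, auto)
  qed
  moreover have "0 \<le> K + C * pi"
    using order_trans[OF norm_ge_zero K] C(1) by simp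
  ultimately show ?thesis by blast
qed

lemma cauchy_transform_decay:
  assumes g: "rapid_holder \<gamma> g"
  shows "\<exists>K\<ge>0. \<forall>z. z \<notin> \<real> \<longrightarrow> norm (z * cauchy_transform g z) \<le> K"
proof -
  obtain K where K: "0 \<le> K" "\<And>z. z \<notin> \<real> \<Longrightarrow> norm (cauchy_transform (\<lambda>x. x *\<^sub>R g x) z) \<le> K"
    using cauchy_transform_bounded[OF rapid_holder_times_ident[OF g]] by blast
  have "norm (z * cauchy_transform g z) \<le> K + norm (LINT x|lborel. g x)" if "z \<notin> \<real>" for z
    unfolding cauchy_transform_mult_ident[OF g that]
    by (rule order_trans[OF norm_triangle_ineq4]) (use K(2)[OF that] in simp)
  then show ?thesis
    using K(1) by (intro exI[of _ "K + norm (LINT x|lborel. g x)"]) auto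
qed

text \<open>The Plemelj formulas. At a real point \<open>cauchy_regular\<close> is the principal
  value integral.\<close>

lemma cauchy_transform_boundary:
  assumes g: "rapid_holder \<gamma> g"
  shows "(cauchy_transform g \<longlongrightarrow> cauchy_regular g (of_real x) + \<i> * pi * g x) (at (of_real x) within {z. Im z > 0})"
    and "(cauchy_transform g \<longlongrightarrow> cauchy_regular g (of_real x) - \<i> * pi * g x) (at (of_real x) within {z. Im z < 0})"
proof -
  have R: "(cauchy_regular g \<longlongrightarrow> cauchy_regular g (of_real x)) (at (of_real x) within S)" for S
    using continuous_on_cauchy_regular[OF g] unfolding continuous_on_def
    by (auto intro: tendsto_within_subset)
  have "isCont g x"
    using continuous_on_rapid_holder[OF g] by (simp add: continuous_on_eq_continuous_at)
  then have G: "((\<lambda>z. g (Re z)) \<longlongrightarrow> g x) (at (of_real x) within S)" for S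
    by (rule isCont_tendsto_compose) (auto intro!: tendsto_eq_intros)
  have I: "((\<lambda>z. Im z) \<longlongrightarrow> 0) (at (of_real x) within S)" for S
    by (auto intro!: tendsto_eq_intros)
  have *: "(cauchy_transform g \<longlongrightarrow> cauchy_regular g (of_real x) + g x * (2 * \<i> * of_real l)) (at (of_real x) within S)"
    if "((\<lambda>z. arctan (inverse (Im z))) \<longlongrightarrow> l) (at (of_real x) within S)" "S \<subseteq> - \<real>" for S l
  proof (rule Lim_transform_eventually)
    show "((\<lambda>z. cauchy_regular g z + g (Re z) * (2 * \<i> * of_real (arctan (inverse (Im z)))))
      \<longlongrightarrow> cauchy_regular g (of_real x) + g x * (2 * \<i> * of_real l)) (at (of_real x) within S)"
      by (intro tendsto_intros R G that)
    show "\<forall>\<^sub>F z in at (of_real x) within S.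
        cauchy_regular g z + g (Re z) * (2 * \<i> * of_real (arctan (inverse (Im z)))) = cauchy_transform g z"
      unfolding eventually_at_filter using that(2)
      by (intro always_eventually)
        (auto simp: cauchy_transform_eq_cauchy_regular[OF g] inverse_eq_divide dest!: subsetD)
  qed
  have "filterlim (\<lambda>z. inverse (Im z)) at_top (at (of_real x) within {z. Im z > 0})"
    by (intro filterlim_inverse_at_top I) (auto simp: eventually_at_filter)
  then have "((\<lambda>z. arctan (inverse (Im z))) \<longlongrightarrow> pi / 2) (at (of_real x) within {z. Im z > 0})"
    by (rule filterlim_compose[OF tendsto_arctan_at_top])
  from *[OF this] show "(cauchy_transform g \<longlongrightarrow> cauchy_regular g (of_real x) + \<i> * pi * g x) (at (of_real x) within {z. Im z > 0})"
    by (simp add: subset_eq complex_is_Real_iff mult_ac)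
  have "filterlim (\<lambda>z. inverse (Im z)) at_bot (at (of_real x) within {z. Im z < 0})"
    by (intro filterlim_inverse_at_bot I) (auto simp: eventually_at_filter)
  then have "((\<lambda>z. arctan (inverse (Im z))) \<longlongrightarrow> - (pi / 2)) (at (of_real x) within {z. Im z < 0})"
    by (rule filterlim_compose[OF tendsto_arctan_at_bot])
  from *[OF this] show "(cauchy_transform g \<longlongrightarrow> cauchy_regular g (of_real x) - \<i> * pi * g x) (at (of_real x) within {z. Im z < 0})"
    by (simp add: subset_eq complex_is_Real_iff mult_ac)
qed

section \<open>Moments and decay at infinity\<close>

lemma cauchy_transform_mult_power:
  assumes g: "rapid_holder \<gamma> g" and z: "z \<notin> \<real>"
    and "\<And>j. j < n \<Longrightarrow> (LINT x|lborel. x ^ j *\<^sub>R g x) = 0"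
  shows "z ^ n * cauchy_transform g z = cauchy_transform (\<lambda>x. x ^ n *\<^sub>R g x) z"
  using assms(3)
proof (induction n)
  case (Suc n)
  have "z ^ Suc n * cauchy_transform g z = z * cauchy_transform (\<lambda>x. x ^ n *\<^sub>R g x) z"
    using Suc by simp
  also have "\<dots> = cauchy_transform (\<lambda>x. x *\<^sub>R x ^ n *\<^sub>R g x) z - (LINT x|lborel. x ^ n *\<^sub>R g x)"
    by (rule cauchy_transform_mult_ident[OF rapid_holder_times_power[OF g] z])
  also have "\<dots> = cauchy_transform (\<lambda>x. x ^ Suc n *\<^sub>R g x) z"
    using Suc.prems[of n] by simp
  finally show ?case .
qed simp

text \<open>A Cauchy transform has an asymptotic series with the moments as coefficients.\<close>
lemma moments_eq_0_if_cauchy_transform_decays: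
  assumes g: "rapid_holder \<gamma> g"
    and K: "\<And>z. z \<notin> \<real> \<Longrightarrow> R \<le> norm z \<Longrightarrow> norm (z ^ Suc n * cauchy_transform g z) \<le> K"
    and "j < n"
  shows "(LINT x|lborel. x ^ j *\<^sub>R g x) = 0"
  using assms(3)
proof (induction j rule: less_induct)
  case (less j)
  define m where "m = (LINT x|lborel. x ^ j *\<^sub>R g x)"
  note gj = rapid_holder_times_power[OF g, of j]
  obtain B where B: "0 \<le> B"
    "\<And>z. z \<notin> \<real> \<Longrightarrow> norm (z * cauchy_transform (\<lambda>x. x *\<^sub>R x ^ j *\<^sub>R g x) z) \<le> B"
    using cauchy_transform_decay[OF rapid_holder_times_ident[OF gj]] by blast
  have "norm m \<le> (B + K) / y" if y: "1 \<le> y" "R \<le> y" for y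
  proof -
    define z where "z = \<i> * complex_of_real y"
    have z: "z \<notin> \<real>" "norm z = y" "z \<noteq> 0"
      using y by (auto simp: z_def norm_mult complex_is_Real_iff)
    \<comment> \<open>By the induction hypothesis the moments below j vanish, so z ^ j moves inside
      the transform, and one further factor z exposes the moment m.\<close>
    have "z ^ Suc j * cauchy_transform g z = cauchy_transform (\<lambda>x. x *\<^sub>R x ^ j *\<^sub>R g x) z - m"
      unfolding m_def cauchy_transform_mult_ident[OF gj z(1), symmetric]
      using less by (subst cauchy_transform_mult_power[OF g z(1), symmetric]) auto
    then have m: "m = cauchy_transform (\<lambda>x. x *\<^sub>R x ^ j *\<^sub>R g x) z - z ^ Suc j * cauchy_transform g z"
      by simp
    have "y * norm m = norm (z * m)"
      by (simp add: norm_mult z)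
    also have "\<dots> \<le> norm (z * cauchy_transform (\<lambda>x. x *\<^sub>R x ^ j *\<^sub>R g x) z) + norm (z ^ Suc (Suc j) * cauchy_transform g z)"
      unfolding m right_diff_distrib by (rule order_trans[OF norm_triangle_ineq4]) (simp add: mult.assoc)
    \<comment> \<open>The exponent j + 2 is at most n + 1 and norm z \<ge> 1, so the assumed decay
      covers this term. It follows that norm m is O(1 / y).\<close>
    also have "norm (z ^ Suc (Suc j) * cauchy_transform g z) \<le> norm (z ^ Suc n * cauchy_transform g z)"
      unfolding norm_mult norm_power z(2) using less.prems y by (intro mult_right_mono power_increasing) auto
    also have "\<dots> \<le> K"
      using K z y by blast
    finally show ?thesis
      using B(2)[OF z(1)] y by (simp add: pos_le_divide_eq mult.commute)
  qed
  then have "\<forall>\<^sub>F y in at_top. norm m \<le> (B + K) / y"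
    by (intro eventually_mono[OF eventually_ge_at_top[of "max 1 R"]]) auto
  moreover have "((\<lambda>y. (B + K) / y) \<longlongrightarrow> 0) (at_top :: real filter)"
    by (intro tendsto_divide_0[OF tendsto_const] filterlim_at_top_imp_at_infinity filterlim_ident)
  ultimately have "norm m \<le> 0"
    using tendsto_lowerbound trivial_limit_at_top_linorder by blast
  then show ?case
    by (simp add: m_def)
qed

subsection \<open>Matrix orthogonal polynomials\<close>

lemma integrable_vec:
  fixes f :: "'a \<Rightarrow> 'b::euclidean_space ^ 'n"
  assumes "\<And>i. integrable M (\<lambda>x. f x $ i)"
  shows "integrable M f"
proof -
  have "integrable M (\<lambda>x. \<Sum>i\<in>UNIV. axis i (f x $ i))"
  proof (intro Bochner_Integration.integrable_sum integrable_bounded_linear[OF _ assms])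
    fix i :: 'n
    show "bounded_linear (axis i :: 'b \<Rightarrow> _)"
      unfolding linear_conv_bounded_linear[symmetric]
      by (intro linearI) (auto simp: vec_eq_iff axis_def)
  qed
  also have "(\<lambda>x. \<Sum>i\<in>UNIV. axis i (f x $ i)) = f"
    by (simp add: fun_eq_iff vec_eq_iff axis_def)
  finally show ?thesis .
qed

lemma integral_vec_nth:
  fixes f :: "'a \<Rightarrow> 'b::euclidean_space ^ 'n"
  assumes "integrable M f"
  shows "integral\<^sup>L M f $ i = (LINT x|M. f x $ i)"
  using integral_bounded_linear[OF bounded_linear_vec_nth assms] by simp

lemma matrix_inv_left: "invertible A \<Longrightarrow> matrix_inv A ** A = mat 1"
  unfolding invertible_def matrix_inv_def by (rule someI2_ex) auto

lemma monic_matrix_poly_power: "monic_matrix_poly n (\<lambda>z. z ^ n *\<^sub>m mat 1)"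
  unfolding monic_matrix_poly_def
proof (intro exI[of _ "\<lambda>k. if k = n then mat 1 else 0"] conjI ext)
  fix z
  have "z ^ k *\<^sub>m (if k = n then mat 1 else 0) = (if k = n then z ^ n *\<^sub>m mat 1 else (0 :: complex^'a^'a))" for k
    by (simp add: msmult_def vec_eq_iff)
  then show "z ^ n *\<^sub>m mat 1 = (\<Sum>k\<le>n. z ^ k *\<^sub>m (if k = n then mat 1 else (0 :: complex^'a^'a)))"
    by simp
qed simp

lemma sum_atMost_eq_extend: "m \<le> n \<Longrightarrow> (\<Sum>k\<le>m. f k) = (\<Sum>k\<le>n. if k \<le> m then f k else 0)" for m n :: nat
  by (rule sum.mono_neutral_cong_left) auto

lemma monic_matrix_poly_diff:
  assumes "monic_matrix_poly n P" "monic_matrix_poly m Q" "m < n"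
  shows "monic_matrix_poly n (\<lambda>z. P z - B ** Q z)"
proof -
  obtain A C where A: "A n = mat 1" "P = (\<lambda>z. \<Sum>k\<le>n. z ^ k *\<^sub>m A k)" and Q: "Q = (\<lambda>z. \<Sum>k\<le>m. z ^ k *\<^sub>m C k)"
    using assms(1,2) unfolding monic_matrix_poly_def by blast
  have "B ** (\<Sum>k\<le>m. z ^ k *\<^sub>m C k) = (\<Sum>k\<le>m. z ^ k *\<^sub>m (B ** C k))" for z
    by (simp add: vec_eq_iff matrix_matrix_mult_def msmult_def sum_distrib_left mult_ac)
      (auto intro: sum.swap)
  also have "\<dots> z = (\<Sum>k\<le>n. if k \<le> m then z ^ k *\<^sub>m (B ** C k) else 0)" for z
    using assms(3) by (intro sum_atMost_eq_extend) simp
  finally have "P z - B ** Q z = (\<Sum>k\<le>n. z ^ k *\<^sub>m A k - (if k \<le> m then z ^ k *\<^sub>m (B ** C k) else 0))" for z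
    by (simp add: A(2) Q sum_subtractf)
  also have "\<dots> z = (\<Sum>k\<le>n. z ^ k *\<^sub>m (A k - (if k \<le> m then B ** C k else 0)))" for z
    by (intro sum.cong refl) (auto simp: msmult_def vec_eq_iff right_diff_distrib)
  finally have "(\<lambda>z. P z - B ** Q z) = (\<lambda>z. \<Sum>k\<le>n. z ^ k *\<^sub>m (A k - (if k \<le> m then B ** C k else 0)))"
    by blast
  then show ?thesis
    unfolding monic_matrix_poly_def using A(1) assms(3)
    by (intro exI[of _ "\<lambda>k. A k - (if k \<le> m then B ** C k else 0)"]) auto
qed

text \<open>Rows are counted by their number of coefficients, here n + 1, because positivity tests
  as many coefficients as there are vanishing moments.\<close>

lemma monic_matrix_poly_row:
  assumes "P = (\<lambda>z. \<Sum>k\<le>n. z ^ k *\<^sub>m A k)"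
  shows "(\<lambda>z. P z $ i) = (\<lambda>z. \<Sum>k<Suc n. z ^ k *s A k $ i)"
  by (simp add: assms fun_eq_iff vec_eq_iff msmult_def lessThan_Suc_atMost)

lemma row_matrix_poly:
  assumes "P = (\<lambda>z. \<Sum>k\<le>n. z ^ k *\<^sub>m A k)"
  shows "(\<lambda>z. w v* P z) = (\<lambda>z. \<Sum>k<Suc n. z ^ k *s (w v* A k))"
  by (simp add: assms fun_eq_iff vec_eq_iff msmult_def lessThan_Suc_atMost vector_matrix_mult_def
      sum_distrib_left sum_distrib_right mult_ac) (auto intro: sum.swap)

text \<open>Entry b of the row p(x) \<rho>(x). The weight and the jump matrix act from the right and
  constants from the left, so orthogonality and the Riemann-Hilbert problem can be treated row by
  row.\<close>

definition weighted_row ::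
    "(real \<Rightarrow> complex^'n^'n) \<Rightarrow> (complex \<Rightarrow> complex^'n) \<Rightarrow> 'n \<Rightarrow> real \<Rightarrow> complex"
  where "weighted_row \<rho> p b x = (\<Sum>a\<in>UNIV. p (of_real x) $ a * \<rho> x $ a $ b)"

lemma weighted_row_matrix: "(P (of_real x) ** \<rho> x) $ i $ b = weighted_row \<rho> (\<lambda>z. P z $ i) b x"
  by (simp add: weighted_row_def matrix_matrix_mult_def)

lemma weighted_row_mult:
  "weighted_row \<rho> (\<lambda>z. (B ** Q z) $ i) b x = (\<Sum>l\<in>UNIV. B $ i $ l * weighted_row \<rho> (\<lambda>z. Q z $ l) b x)"
proof -
  have "weighted_row \<rho> (\<lambda>z. (B ** Q z) $ i) b x
      = (\<Sum>a\<in>UNIV. \<Sum>l\<in>UNIV. B $ i $ l * (Q (of_real x) $ l $ a * \<rho> x $ a $ b))"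
    by (simp add: weighted_row_def matrix_matrix_mult_def sum_distrib_right mult.assoc)
  also have "\<dots> = (\<Sum>l\<in>UNIV. B $ i $ l * weighted_row \<rho> (\<lambda>z. Q z $ l) b x)"
    unfolding weighted_row_def sum_distrib_left by (rule sum.swap)
  finally show ?thesis .
qed

text \<open>The two properties of exp (-V) on which the rest is built. The place of the conjugate in
  the second one is that of p \<rho> p^* for a row p.\<close>

locale matrix_weight =
  fixes \<rho> :: "real \<Rightarrow> complex^'n^'n" and \<gamma> :: real
  assumes rapid: "\<And>i j. rapid_holder \<gamma> (\<lambda>x. \<rho> x $ i $ j)"
    and positive: "\<And>x v. v \<noteq> 0 \<Longrightarrow> 0 < Re (\<Sum>i\<in>UNIV. \<Sum>j\<in>UNIV. v $ i * \<rho> x $ i $ j * cnj (v $ j))"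
begin

lemma exponent: "0 < \<gamma>" "\<gamma> \<le> 1"
  using rapid_holder_exponent[OF rapid] by auto

lemma rapid_holder_weighted_row:
  assumes "p = (\<lambda>z. \<Sum>k<n. z ^ k *s a k)"
  shows "rapid_holder \<gamma> (weighted_row \<rho> p b)"
proof -
  have eq: "weighted_row \<rho> p b = (\<lambda>x. \<Sum>i\<in>UNIV. \<Sum>k<n. x ^ k *\<^sub>R (a k $ i * \<rho> x $ i $ b))"
    by (simp add: fun_eq_iff weighted_row_def assms sum_distrib_right scaleR_conv_of_real mult.assoc)
  show ?thesis
    unfolding eq
    by (intro rapid_holder_sum rapid_holder_times_power exponent rapid
        rapid_holder_bounded_linear[OF bounded_linear_mult_right])
qed

lemma integrable_weighted_row:
  assumes "p = (\<lambda>z. \<Sum>k<n. z ^ k *s a k)"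
  shows "integrable lborel (\<lambda>x. x ^ j *\<^sub>R weighted_row \<rho> p b x)"
  by (intro integrable_rapid_holder[of \<gamma>] rapid_holder_times_power rapid_holder_weighted_row[OF assms])

text \<open>The assumption makes the integral of \<open>p \<rho> p\<^sup>*\<close> vanish.\<close>
lemma row_poly_eq_0:
  assumes p: "p = (\<lambda>z. \<Sum>k<n. z ^ k *s a k)"
    and orth: "\<And>j b. j < n \<Longrightarrow> (LINT x|lborel. x ^ j *\<^sub>R weighted_row \<rho> p b x) = 0"
    and k: "k < n"
  shows "a k = 0"
proof (rule ccontr)
  assume "a k \<noteq> 0"
  then obtain i where i: "a k $ i \<noteq> 0"
    by (auto simp: vec_eq_iff)
  \<comment> \<open>The form p \<rho> p^* with its right factor expanded in powers of x, so that its
    integral is a combination of the moments assumed to vanish.\<close>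
  let ?q = "\<lambda>x. \<Sum>b\<in>UNIV. \<Sum>j<n. cnj (a j $ b) * (x ^ j *\<^sub>R weighted_row \<rho> p b x)"
  have q: "?q x = (\<Sum>c\<in>UNIV. \<Sum>b\<in>UNIV. p (of_real x) $ c * \<rho> x $ c $ b * cnj (p (of_real x) $ b))" for x
  proof -
    have "(\<Sum>c\<in>UNIV. \<Sum>b\<in>UNIV. p (of_real x) $ c * \<rho> x $ c $ b * cnj (p (of_real x) $ b))
        = (\<Sum>b\<in>UNIV. weighted_row \<rho> p b x * cnj (p (of_real x) $ b))"
      unfolding weighted_row_def sum_distrib_right by (rule sum.swap)
    also have "\<dots> = ?q x"
      by (intro sum.cong refl)
        (simp add: p sum_distrib_left sum_distrib_right scaleR_conv_of_real mult_ac)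
    finally show ?thesis ..
  qed
  have int: "integrable lborel ?q"
    by (intro Bochner_Integration.integrable_sum integrable_mult_right integrable_weighted_row[OF p])
  have int': "integrable lborel (\<lambda>x. cnj (a j $ b) * (x ^ j *\<^sub>R weighted_row \<rho> p b x))" for j b
    by (intro integrable_mult_right integrable_weighted_row[OF p])
  have "integral\<^sup>L lborel ?q
      = (\<Sum>b\<in>UNIV. \<Sum>j<n. (LINT x|lborel. cnj (a j $ b) * (x ^ j *\<^sub>R weighted_row \<rho> p b x)))"
    by (simp only: Bochner_Integration.integral_sum Bochner_Integration.integrable_sum int')
  also have "\<dots> = 0"
    using orth by (intro sum.neutral ballI) (simp only: integral_mult_right_zero, simp)
  finally have "integral\<^sup>L lborel ?q = 0" .
  then have "(LINT x|lborel. Re (?q x)) = 0"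
    using integral_Re[OF int] by simp
  moreover have pos: "0 < Re (?q x)" if "p (of_real x) \<noteq> 0" for x
    unfolding q by (rule positive[OF that])
  have "0 \<le> Re (?q x)" for x
    using pos[of x] by (cases "p (of_real x) = 0") (auto simp: weighted_row_def)
  ultimately have "AE x in lborel. Re (?q x) = 0"
    using integral_nonneg_eq_0_iff_AE[OF integrable_Re[OF int]] by simp
  then have p0: "AE x in lborel. p (of_real x) = 0"
    by eventually_elim (use pos in fastforce)
  \<comment> \<open>Entry i of p is a polynomial with the nonzero coefficient
    \<open>a k $ i\<close>, hence with finitely many zeros, although p vanishes almost everywhere.
    As k < n, the range up to n - 1 is the range below n.\<close>
  have "finite {z. (\<Sum>j\<le>n - 1. a j $ i * z ^ j) = 0}"
    using i k by (subst polyfun_finite_roots) (auto intro!: exI[of _ k])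
  then have "finite (complex_of_real -` {z. (\<Sum>j\<le>n - 1. a j $ i * z ^ j) = 0})"
    by (rule finite_vimageI) (simp add: inj_def)
  then have "finite {x::real. p (of_real x) = 0}"
  proof (rule finite_subset[rotated], intro subsetI)
    fix x :: real assume "x \<in> {x. p (of_real x) = 0}"
    then have "p (of_real x) $ i = 0" by simp
    moreover have "{..<n} = {..n - 1}"
      using k by auto
    ultimately show "x \<in> of_real -` {z. (\<Sum>j\<le>n - 1. a j $ i * z ^ j) = 0}"
      by (simp add: p mult.commute)
  qed
  from AE_not_in[OF finite_imp_null_set_lborel[OF this]]
  have "AE x in lborel. p (of_real x) \<noteq> 0"
    by simp
  with p0 have "AE x in (lborel :: real measure). False"
    by eventually_elim simp
  then show False
    by (simp add: AE_iff_null null_sets_def)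
qed

section \<open>Moments and the construction of the orthogonal polynomials\<close>

definition moment :: "(complex \<Rightarrow> complex^'n^'n) \<Rightarrow> nat \<Rightarrow> complex^'n^'n"
  where "moment P j = (\<chi> i b. LINT x|lborel. x ^ j *\<^sub>R weighted_row \<rho> (\<lambda>z. P z $ i) b x)"

lemma moment_eq:
  assumes "monic_matrix_poly n P"
  shows "(LINT x|lborel. x ^ j *\<^sub>R (P (of_real x) ** \<rho> x)) = moment P j"
proof -
  obtain A where A: "P = (\<lambda>z. \<Sum>k\<le>n. z ^ k *\<^sub>m A k)"
    using assms unfolding monic_matrix_poly_def by blast
  let ?f = "\<lambda>x. x ^ j *\<^sub>R (P (of_real x) ** \<rho> x)"
  have entry: "?f x $ i $ b = x ^ j *\<^sub>R weighted_row \<rho> (\<lambda>z. P z $ i) b x" for x i b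
    by (simp add: weighted_row_matrix)
  have row: "integrable lborel (\<lambda>x. ?f x $ i)" for i
    by (rule integrable_vec) (use integrable_weighted_row[OF monic_matrix_poly_row[OF A]] in \<open>simp only: entry\<close>)
  have "integral\<^sup>L lborel ?f $ i $ b = moment P j $ i $ b" for i b
    unfolding integral_vec_nth[OF integrable_vec[OF row]] integral_vec_nth[OF row] entry
    by (simp add: moment_def)
  then show ?thesis
    by (simp add: vec_eq_iff)
qed

lemma moment_diff:
  assumes "monic_matrix_poly n P" "monic_matrix_poly m Q"
  shows "moment (\<lambda>z. P z - B ** Q z) j = moment P j - B ** moment Q j"
proof -
  obtain A where A: "P = (\<lambda>z. \<Sum>k\<le>n. z ^ k *\<^sub>m A k)"
    using assms unfolding monic_matrix_poly_def by blast
  obtain C where C: "Q = (\<lambda>z. \<Sum>k\<le>m. z ^ k *\<^sub>m C k)"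
    using assms unfolding monic_matrix_poly_def by blast
  note int = integrable_weighted_row[OF monic_matrix_poly_row[OF A]]
    integrable_weighted_row[OF monic_matrix_poly_row[OF C]]
  have *: "weighted_row \<rho> (\<lambda>z. (P z - B ** Q z) $ i) b x = weighted_row \<rho> (\<lambda>z. P z $ i) b x
      - (\<Sum>l\<in>UNIV. B $ i $ l * weighted_row \<rho> (\<lambda>z. Q z $ l) b x)" for i b x
    unfolding weighted_row_mult[symmetric]
    by (simp add: weighted_row_def left_diff_distrib sum_subtractf)
  have "moment (\<lambda>z. P z - B ** Q z) j $ i $ b = (moment P j - B ** moment Q j) $ i $ b" for i b
  proof -
    have "moment (\<lambda>z. P z - B ** Q z) j $ i $ b =
        (LINT x|lborel. x ^ j *\<^sub>R weighted_row \<rho> (\<lambda>z. P z $ i) b x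
          - (\<Sum>l\<in>UNIV. B $ i $ l * (x ^ j *\<^sub>R weighted_row \<rho> (\<lambda>z. Q z $ l) b x)))"
      unfolding moment_def * by (simp add: scaleR_diff_right scaleR_sum_right)
    also have "\<dots> = (LINT x|lborel. x ^ j *\<^sub>R weighted_row \<rho> (\<lambda>z. P z $ i) b x)
          - (LINT x|lborel. (\<Sum>l\<in>UNIV. B $ i $ l * (x ^ j *\<^sub>R weighted_row \<rho> (\<lambda>z. Q z $ l) b x)))"
      by (intro Bochner_Integration.integral_diff Bochner_Integration.integrable_sum integrable_mult_right int)
    also have "(LINT x|lborel. (\<Sum>l\<in>UNIV. B $ i $ l * (x ^ j *\<^sub>R weighted_row \<rho> (\<lambda>z. Q z $ l) b x)))
        = (\<Sum>l\<in>UNIV. (LINT x|lborel. B $ i $ l * (x ^ j *\<^sub>R weighted_row \<rho> (\<lambda>z. Q z $ l) b x)))"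
      by (intro Bochner_Integration.integral_sum integrable_mult_right int)
    finally show ?thesis
      by (simp only: integral_mult_right_zero) (simp add: moment_def matrix_matrix_mult_def)
  qed
  then show ?thesis
    by (simp add: vec_eq_iff)
qed

text \<open>If a row w annihilates the moment from the left, then w P is orthogonal to all powers up
  to n, one more than P itself is. Positivity makes w P vanish, and its leading coefficient is w.
  The transpose turns rows into columns for the kernel criterion.\<close>

lemma invertible_moment:
  assumes P: "monic_matrix_poly n P" and orth: "\<And>j. j < n \<Longrightarrow> moment P j = 0"
  shows "invertible (moment P n)"
proof -
  obtain A where A: "A n = mat 1" "P = (\<lambda>z. \<Sum>k\<le>n. z ^ k *\<^sub>m A k)"
    using P unfolding monic_matrix_poly_def by blast
  have "w = 0" if w: "transpose (moment P n) *v w = 0" for w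
  proof -
    have row: "weighted_row \<rho> (\<lambda>z. w v* P z) b x = (\<Sum>i\<in>UNIV. w $ i * weighted_row \<rho> (\<lambda>z. P z $ i) b x)" for b x
    proof -
      have "weighted_row \<rho> (\<lambda>z. w v* P z) b x
          = (\<Sum>a\<in>UNIV. \<Sum>i\<in>UNIV. w $ i * (P (of_real x) $ i $ a * \<rho> x $ a $ b))"
        by (simp add: weighted_row_def vector_matrix_mult_def sum_distrib_right
            sum_distrib_left mult_ac)
      also have "\<dots> = (\<Sum>i\<in>UNIV. w $ i * weighted_row \<rho> (\<lambda>z. P z $ i) b x)"
        unfolding weighted_row_def sum_distrib_left by (rule sum.swap)
      finally show ?thesis .
    qed
    have "(LINT x|lborel. x ^ j *\<^sub>R weighted_row \<rho> (\<lambda>z. w v* P z) b x) = 0" if j: "j < Suc n" for j b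
    proof -
      have "(LINT x|lborel. x ^ j *\<^sub>R weighted_row \<rho> (\<lambda>z. w v* P z) b x)
          = (LINT x|lborel. (\<Sum>i\<in>UNIV. w $ i * (x ^ j *\<^sub>R weighted_row \<rho> (\<lambda>z. P z $ i) b x)))"
        by (simp add: row scaleR_sum_right)
      also have "\<dots> = (\<Sum>i\<in>UNIV. (LINT x|lborel. w $ i * (x ^ j *\<^sub>R weighted_row \<rho> (\<lambda>z. P z $ i) b x)))"
        by (intro Bochner_Integration.integral_sum integrable_mult_right
            integrable_weighted_row[OF monic_matrix_poly_row[OF A(2)]])
      also have "\<dots> = (\<Sum>i\<in>UNIV. w $ i * moment P j $ i $ b)"
        by (simp only: integral_mult_right_zero) (simp add: moment_def)
      also have "\<dots> = (transpose (moment P j) *v w) $ b"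
        by (simp add: matrix_vector_mult_def transpose_def mult.commute)
      also have "\<dots> = 0"
        using orth[of j] w j by (cases "j = n") (auto simp: matrix_vector_mult_def transpose_def)
      finally show ?thesis .
    qed
    from row_poly_eq_0[OF row_matrix_poly[OF A(2)] this, of n]
    show "w = 0"
      by (simp add: A(1))
  qed
  then obtain B where "B ** transpose (moment P n) = mat 1"
    using matrix_left_invertible_ker[of "transpose (moment P n)"] by blast
  then have "moment P n ** transpose B = mat 1"
    by (metis matrix_transpose_mul transpose_mat transpose_transpose)
  then show ?thesis
    by (meson invertible_right_inverse)
qed

text \<open>Gram-Schmidt from below: subtracting B P_m removes moment m and keeps the earlier ones
  at 0, because those of P_m vanish. A suitable B exists as moment m of P_m is invertible.\<close>

lemma monic_orthogonal_exists: "\<exists>P. monic_matrix_poly n P \<and> (\<forall>j<n. moment P j = 0)"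
proof (induction n rule: less_induct)
  case (less n)
  have "\<exists>R. monic_matrix_poly n R \<and> (\<forall>j<m. moment R j = 0)" if "m \<le> n" for m
    using that
  proof (induction m)
    case 0
    then show ?case
      using monic_matrix_poly_power by blast
  next
    case (Suc m)
    then obtain R where R: "monic_matrix_poly n R" "\<And>j. j < m \<Longrightarrow> moment R j = 0"
      by auto
    obtain P where P: "monic_matrix_poly m P" "\<And>j. j < m \<Longrightarrow> moment P j = 0"
      using less[of m] Suc.prems by auto
    define B where "B = moment R m ** matrix_inv (moment P m)"
    have "matrix_inv (moment P m) ** moment P m = mat 1"
      using invertible_moment[OF P] by (rule matrix_inv_left)
    then have "B ** moment P m = moment R m"
      by (simp add: B_def flip: matrix_mul_assoc)
    then have "moment (\<lambda>z. R z - B ** P z) j = 0" if "j < Suc m" for j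
      using R(2)[of j] P(2)[of j] that by (cases "j = m") (simp_all add: moment_diff[OF R(1) P(1)])
    moreover have "monic_matrix_poly n (\<lambda>z. R z - B ** P z)"
      using Suc.prems by (intro monic_matrix_poly_diff[OF R(1) P(1)]) simp
    ultimately show ?case by blast
  qed
  then show ?case by blast
qed

lemma monic_orthogonal_unique:
  assumes P: "monic_matrix_poly n P" "\<And>j. j < n \<Longrightarrow> moment P j = 0"
    and Q: "monic_matrix_poly n Q" "\<And>j. j < n \<Longrightarrow> moment Q j = 0"
  shows "P = Q"
proof -
  obtain A where A: "A n = mat 1" "P = (\<lambda>z. \<Sum>k\<le>n. z ^ k *\<^sub>m A k)"
    using P unfolding monic_matrix_poly_def by blast
  obtain C where C: "C n = mat 1" "Q = (\<lambda>z. \<Sum>k\<le>n. z ^ k *\<^sub>m C k)"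
    using Q unfolding monic_matrix_poly_def by blast
  have "A k $ i = C k $ i" if "k < n" for k i
  proof -
    \<comment> \<open>The factor \<open>mat 1\<close> gives the difference the shape that
      \<open>moment_diff\<close> expects. The leading terms cancel, which leaves n coefficients
      against n vanishing moments.\<close>
    have "(\<lambda>z. (P z - mat 1 ** Q z) $ i) = (\<lambda>z. \<Sum>k<Suc n. z ^ k *s (A k - C k) $ i)"
      by (simp add: A(2) C(2) fun_eq_iff vec_eq_iff msmult_def lessThan_Suc_atMost sum_subtractf right_diff_distrib)
    also have "\<dots> = (\<lambda>z. \<Sum>k<n. z ^ k *s (A k - C k) $ i)"
      by (simp add: A(1) C(1))
    finally have eq: "(\<lambda>z. (P z - mat 1 ** Q z) $ i) = (\<lambda>z. \<Sum>k<n. z ^ k *s (A k - C k) $ i)" .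
    have "moment (\<lambda>z. P z - mat 1 ** Q z) j $ i $ b = 0" if "j < n" for j b
      using P(2) Q(2) that by (simp only: moment_diff[OF P(1) Q(1)]) simp
    then have "(LINT x|lborel. x ^ j *\<^sub>R weighted_row \<rho> (\<lambda>z. (P z - mat 1 ** Q z) $ i) b x) = 0" if "j < n" for j b
      using that by (simp only: moment_def vec_lambda_beta)
    from row_poly_eq_0[OF eq this that] show ?thesis
      by simp
  qed
  then have "A k = C k" if "k \<le> n" for k
    using that A(1) C(1) by (cases "k = n") (auto simp: vec_eq_iff)
  then show ?thesis
    by (simp add: A(2) C(2))
qed

text \<open>Existence and uniqueness together show that the definite description in
  \<open>monic_op\<close> denotes the orthogonal polynomial.\<close>

lemma monic_op:
  shows monic_matrix_poly_monic_op: "monic_matrix_poly n (monic_op \<rho> n)"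
    and moment_monic_op: "j < n \<Longrightarrow> moment (monic_op \<rho> n) j = 0"
proof -
  let ?P = "\<lambda>P. monic_matrix_poly n P \<and>
    (\<forall>j<n. (LINT x|lborel. x ^ j *\<^sub>R (P (of_real x) ** \<rho> x)) = 0)"
  have eq: "?P P \<longleftrightarrow> monic_matrix_poly n P \<and> (\<forall>j<n. moment P j = 0)" for P
    using moment_eq by auto
  have "\<exists>!P. ?P P"
    unfolding eq using monic_orthogonal_exists monic_orthogonal_unique by blast
  from theI'[OF this] have "?P (monic_op \<rho> n)"
    unfolding monic_op_def .
  then show "monic_matrix_poly n (monic_op \<rho> n)" "j < n \<Longrightarrow> moment (monic_op \<rho> n) j = 0"
    unfolding eq by blast+
qed

text \<open>The moment is invertible, so \<open>norming_const\<close> is a genuine inverse and only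
  the scalar has to be moved across. This product makes the lower right block tend to the
  identity.\<close>

lemma norming_const_mult:
  "norming_const \<rho> n ** moment (monic_op \<rho> n) n = (- (2 * of_real pi * \<i>)) *\<^sub>m mat 1"
proof -
  let ?c = "- (1 / (2 * of_real pi * \<i>))"
  let ?N = "moment (monic_op \<rho> n) n"
  have c: "?c * - (2 * of_real pi * \<i>) = 1"
    by simp
  have smult: "A ** (c *\<^sub>m B) = c *\<^sub>m (A ** B)" "(c *\<^sub>m A) ** B = c *\<^sub>m (A ** B)"
    "c *\<^sub>m d *\<^sub>m A = (c * d) *\<^sub>m A" "1 *\<^sub>m A = A" for A B :: "complex^'n^'n" and c d
    by (simp_all add: msmult_def matrix_matrix_mult_def vec_eq_iff sum_distrib_left mult_ac)
  have "invertible ?N"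
    by (rule invertible_moment[OF monic_matrix_poly_monic_op moment_monic_op])
  then have "invertible (?c *\<^sub>m ?N)"
    unfolding invertible_def using c
    by (metis (no_types, opaque_lifting) mult.commute smult)
  then have "matrix_inv (?c *\<^sub>m ?N) ** (?c *\<^sub>m ?N) = mat 1"
    by (rule matrix_inv_left)
  then have "?c *\<^sub>m (norming_const \<rho> n ** ?N) = mat 1"
    unfolding norming_const_def moment_eq[OF monic_matrix_poly_monic_op] by (simp only: smult)
  then have "(- (2 * of_real pi * \<i>)) *\<^sub>m ?c *\<^sub>m (norming_const \<rho> n ** ?N)
      = (- (2 * of_real pi * \<i>)) *\<^sub>m mat 1"
    by simp
  then show ?thesis
    using c by (simp only: smult mult.commute)
qed

end

subsection \<open>The Riemann-Hilbert problem\<close>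

lemma sum_UNIV_Plus:
  "(\<Sum>k\<in>UNIV. f k) = (\<Sum>a\<in>UNIV. f (Inl a)) + (\<Sum>b\<in>UNIV. f (Inr b))"
  for f :: "'a::finite + 'b::finite \<Rightarrow> 'c::comm_monoid_add"
  by (subst UNIV_Plus_UNIV[symmetric], subst sum.Plus) simp_all

lemma mult_block_matrix:
  "(A ** block_matrix B C D F) $ r $ Inl b = (\<Sum>a\<in>UNIV. A $ r $ Inl a * B $ a $ b) + (\<Sum>a\<in>UNIV. A $ r $ Inr a * D $ a $ b)"
  "(A ** block_matrix B C D F) $ r $ Inr b = (\<Sum>a\<in>UNIV. A $ r $ Inl a * C $ a $ b) + (\<Sum>a\<in>UNIV. A $ r $ Inr a * F $ a $ b)"
  by (simp_all add: matrix_matrix_mult_def block_matrix_def sum_UNIV_Plus)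

lemma sum_mult_mat: "(\<Sum>a\<in>UNIV. f a * mat c $ a $ b) = f b * (c :: 'a::semiring_1)"
  by (simp add: mat_def if_distrib[of "(*) _"] cong: if_cong)

lemma mult_block_diag:
  "(A ** block_matrix (mat c) 0 0 (mat d)) $ r $ Inl b = A $ r $ Inl b * (c :: 'a::semiring_1)"
  "(A ** block_matrix (mat c) 0 0 (mat d)) $ r $ Inr b = A $ r $ Inr b * d"
  by (simp_all add: mult_block_matrix sum_mult_mat)

lemma eventually_off_reals:
  "eventually P (inf at_infinity (principal (- \<real>))) \<longleftrightarrow> (\<exists>R. \<forall>z::complex. z \<notin> \<real> \<longrightarrow> R \<le> norm z \<longrightarrow> P z)"
  by (auto simp: eventually_inf_principal eventually_at_infinity)

section \<open>Continuation across the line\<close>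

definition across_reals :: "(real \<Rightarrow> complex) \<Rightarrow> (complex \<Rightarrow> complex) \<Rightarrow> complex \<Rightarrow> complex"
  where "across_reals b f z = (if z \<in> \<real> then b (Re z) else f z)"

text \<open>The limits from the two half-planes and along the line agree, so the extension is
  continuous everywhere; a continuous function that is holomorphic on both sides of a line is
  holomorphic across it.\<close>

lemma across_reals_holomorphic:
  assumes f: "f holomorphic_on - \<real>" and b: "continuous_on UNIV b"
    and upper: "\<And>x. (f \<longlongrightarrow> b x) (at (of_real x) within {z. Im z > 0})"
    and lower: "\<And>x. (f \<longlongrightarrow> b x) (at (of_real x) within {z. Im z < 0})"
  shows "across_reals b f holomorphic_on UNIV"
proof -
  have hol: "across_reals b f holomorphic_on - \<real>"
    by (rule holomorphic_transform[OF f]) (simp add: across_reals_def)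
  have "continuous (at z) (across_reals b f)" for z
  proof (cases "z \<in> \<real>")
    case False
    then show ?thesis
      using holomorphic_on_imp_continuous_on[OF hol] closed_complex_Reals
      by (simp add: continuous_on_eq_continuous_at open_Compl)
  next
    case True
    then obtain x where z: "z = of_real x"
      by (auto elim: Reals_cases)
    have fz: "across_reals b f z = b x"
      by (simp add: across_reals_def z)
    have lim: "(across_reals b f \<longlongrightarrow> b x) (at z within S)" if "(f \<longlongrightarrow> b x) (at z within S)" "S \<subseteq> - \<real>" for S
      using that(1)
    proof (rule Lim_transform_eventually)
      show "\<forall>\<^sub>F w in at z within S. f w = across_reals b f w"
        unfolding eventually_at_filter using that(2)
        by (intro always_eventually) (auto simp: across_reals_def)
    qed
    have *: "(across_reals b f \<longlongrightarrow> b x) (at z within {w. Im w > 0})"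
      "(across_reals b f \<longlongrightarrow> b x) (at z within {w. Im w < 0})"
      by (rule lim[OF upper[of x, folded z]] lim[OF lower[of x, folded z]];
          force simp: complex_is_Real_iff)+
    have "((\<lambda>w. b (Re w)) \<longlongrightarrow> b x) (at z within \<real>)"
      using b by (intro isCont_tendsto_compose[of x b])
        (auto intro!: tendsto_eq_intros simp: continuous_on_eq_continuous_at z)
    then have "(across_reals b f \<longlongrightarrow> b x) (at z within \<real>)"
      by (rule Lim_transform_eventually)
        (auto simp: eventually_at_filter across_reals_def intro!: always_eventually)
    with * have "(across_reals b f \<longlongrightarrow> b x) (at z within ({w. Im w > 0} \<union> {w. Im w < 0}) \<union> \<real>)"
      by (intro Lim_Un)
    moreover have "({w. Im w > 0} \<union> {w. Im w < 0}) \<union> \<real> = UNIV"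
      by (auto simp: complex_is_Real_iff)
    ultimately show ?thesis
      by (simp add: continuous_within fz)
  qed
  then have "continuous_on UNIV (across_reals b f)"
    by (simp add: continuous_on_eq_continuous_at)
  moreover have "across_reals b f holomorphic_on (UNIV \<inter> {z. \<i> \<bullet> z < 0})"
    "across_reals b f holomorphic_on (UNIV \<inter> {z. 0 < \<i> \<bullet> z})"
    by (rule holomorphic_on_subset[OF hol], force simp: complex_is_Real_iff)+
  ultimately show ?thesis
    using holomorphic_on_paste_across_line[of UNIV \<i> _ 0] by simp
qed

text \<open>The asymptotic conditions say nothing on the line itself. A real point is approached
  vertically, which increases the modulus, so the approximating points stay where the bound is
  known.\<close>

lemma norm_le_across_reals:
  fixes f :: "complex \<Rightarrow> complex" and h :: "complex \<Rightarrow> real"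
  assumes f: "continuous_on UNIV f" and h: "continuous_on UNIV h"
    and le: "\<And>z. z \<notin> \<real> \<Longrightarrow> R \<le> norm z \<Longrightarrow> norm (f z) \<le> h z" and z: "R \<le> norm z"
  shows "norm (f z) \<le> h z"
proof (cases "z \<in> \<real>")
  case True
  define X where "X k = z + \<i> * of_real (inverse (real (Suc k)))" for k
  have "X \<longlonglongrightarrow> z + \<i> * of_real 0"
    unfolding X_def by (intro tendsto_intros LIMSEQ_inverse_real_of_nat)
  then have X: "X \<longlonglongrightarrow> z"
    by simp
  have lim: "(\<lambda>k. norm (f (X k))) \<longlonglongrightarrow> norm (f z)" "(\<lambda>k. h (X k)) \<longlonglongrightarrow> h z"
    using f h X by (auto intro!: tendsto_norm isCont_tendsto_compose[OF _ X] simp: continuous_on_eq_continuous_at)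
  have "norm (f (X k)) \<le> h (X k)" for k
  proof (rule le)
    have "Im z = 0"
      using True by (simp add: complex_is_Real_iff)
    then show "X k \<notin> \<real>"
      by (simp add: X_def complex_is_Real_iff del: of_nat_Suc)
    have "norm z = \<bar>Re (X k)\<bar>"
      using \<open>Im z = 0\<close> by (simp add: X_def norm_complex_def)
    then show "R \<le> norm (X k)"
      using z abs_Re_le_cmod[of "X k"] by linarith
  qed
  then show ?thesis
    using LIMSEQ_le[OF lim] by blast
qed (use le z in blast)

lemma cauchy_transform_zero: "cauchy_transform (\<lambda>x. 0) z = 0"
  by (simp add: cauchy_transform_def)

context matrix_weight
begin

definition row_cauchy :: "(complex \<Rightarrow> complex^'n) \<Rightarrow> 'n \<Rightarrow> complex \<Rightarrow> complex"
  where "row_cauchy p b z = 1 / (2 * of_real pi * \<i>) * cauchy_transform (weighted_row \<rho> p b) z"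

text \<open>The factor 1 / (2 pi i) turns the terms i pi g of the Plemelj formulas into g / 2, so
  the jump is exactly the weighted row.\<close>

lemma row_cauchy_boundary:
  assumes "p = (\<lambda>z. \<Sum>k<n. z ^ k *s a k)"
  shows "(row_cauchy p b \<longlongrightarrow> 1 / (2 * of_real pi * \<i>) * cauchy_regular (weighted_row \<rho> p b) (of_real x)
      + weighted_row \<rho> p b x / 2) (at (of_real x) within {z. Im z > 0})"
    and "(row_cauchy p b \<longlongrightarrow> 1 / (2 * of_real pi * \<i>) * cauchy_regular (weighted_row \<rho> p b) (of_real x)
      - weighted_row \<rho> p b x / 2) (at (of_real x) within {z. Im z < 0})"
proof -
  note lim = cauchy_transform_boundary[OF rapid_holder_weighted_row[OF assms], of b x, THEN tendsto_mult_left,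
      of "1 / (2 * of_real pi * \<i>)"]
  have half: "1 / (2 * of_real pi * \<i>) * (\<i> * of_real pi * w) = w / 2" for w
    by (simp add: field_simps)
  show "(row_cauchy p b \<longlongrightarrow> 1 / (2 * of_real pi * \<i>) * cauchy_regular (weighted_row \<rho> p b) (of_real x)
      + weighted_row \<rho> p b x / 2) (at (of_real x) within {z. Im z > 0})"
    using lim(1) unfolding row_cauchy_def[abs_def] distrib_left half .
  show "(row_cauchy p b \<longlongrightarrow> 1 / (2 * of_real pi * \<i>) * cauchy_regular (weighted_row \<rho> p b) (of_real x)
      - weighted_row \<rho> p b x / 2) (at (of_real x) within {z. Im z < 0})"
    using lim(2) unfolding row_cauchy_def[abs_def] right_diff_distrib half .
qed

lemma row_cauchy_holomorphic:
  assumes "p = (\<lambda>z. \<Sum>k<n. z ^ k *s a k)"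
  shows "row_cauchy p b holomorphic_on - \<real>"
  unfolding row_cauchy_def[abs_def]
  by (intro holomorphic_intros cauchy_transform_holomorphic integrable_rapid_holder[OF rapid_holder_weighted_row[OF assms]])

text \<open>Each row of the difference of two solutions is such a pair \<open>p\<close>, \<open>q\<close>.\<close>
lemma homogeneous_row_eq_0:
  fixes p q :: "complex \<Rightarrow> complex^'n" and p' qu ql :: "real \<Rightarrow> complex^'n"
  assumes n: "n \<ge> 1"
    and holo: "\<And>b. (\<lambda>z. p z $ b) holomorphic_on - \<real>" "\<And>b. (\<lambda>z. q z $ b) holomorphic_on - \<real>"
    and cont: "\<And>b. continuous_on UNIV (\<lambda>x. p' x $ b)" "\<And>b. continuous_on UNIV (\<lambda>x. qu x $ b)"
    and p_lim: "\<And>x b. ((\<lambda>z. p z $ b) \<longlongrightarrow> p' x $ b) (at (of_real x) within {z. Im z > 0})"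
      "\<And>x b. ((\<lambda>z. p z $ b) \<longlongrightarrow> p' x $ b) (at (of_real x) within {z. Im z < 0})"
    and q_lim: "\<And>x b. ((\<lambda>z. q z $ b) \<longlongrightarrow> qu x $ b) (at (of_real x) within {z. Im z > 0})"
      "\<And>x b. ((\<lambda>z. q z $ b) \<longlongrightarrow> ql x $ b) (at (of_real x) within {z. Im z < 0})"
    and jump: "\<And>x b. qu x $ b = ql x $ b + (\<Sum>a\<in>UNIV. p' x $ a * \<rho> x $ a $ b)"
    and p_growth: "\<And>b. \<exists>R K. \<forall>z. z \<notin> \<real> \<longrightarrow> R \<le> norm z \<longrightarrow> norm (p z $ b) \<le> K * norm z ^ (n - 1)"
    and q_decay: "\<And>b. \<exists>R K. \<forall>z. z \<notin> \<real> \<longrightarrow> R \<le> norm z \<longrightarrow> norm (z ^ Suc n * q z $ b) \<le> K"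
    and z: "z \<notin> \<real>"
  shows "p z = 0 \<and> q z = 0"
proof -
  \<comment> \<open>Both one-sided boundary values of p are p', so p extends to an entire function;
    growth of order n - 1 makes it a polynomial.\<close>
  have "\<exists>c. \<forall>z. across_reals (\<lambda>x. p' x $ b) (\<lambda>z. p z $ b) z = (\<Sum>k\<le>n - 1. c k * z ^ k)" for b
  proof -
    let ?f = "across_reals (\<lambda>x. p' x $ b) (\<lambda>z. p z $ b)"
    have hol: "?f holomorphic_on UNIV"
      by (rule across_reals_holomorphic[OF holo(1) cont(1) p_lim])
    obtain R K where RK: "\<And>z. z \<notin> \<real> \<Longrightarrow> R \<le> norm z \<Longrightarrow> norm (p z $ b) \<le> K * norm z ^ (n - 1)"
      using p_growth by blast
    have le: "norm (?f z) \<le> K * norm z ^ (n - 1)" if "z \<notin> \<real>" "R \<le> norm z" for z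
      using RK[OF that] that(1) by (simp add: across_reals_def)
    have le': "norm (?f z) \<le> K * norm z ^ (n - 1)" if "R \<le> norm z" for z
    proof (rule norm_le_across_reals[of ?f "\<lambda>z. K * norm z ^ (n - 1)" R z])
      show "continuous_on UNIV (\<lambda>z::complex. K * norm z ^ (n - 1))"
        by (intro continuous_intros)
    qed (use le that holomorphic_on_imp_continuous_on[OF hol] in blast)+
    have "?f z = (\<Sum>k\<le>n - 1. (deriv ^^ k) ?f 0 / fact k * z ^ k)" for z
      by (rule Liouville_polynomial[OF hol le'])
    then show ?thesis
      by (intro exI[of _ "\<lambda>k. (deriv ^^ k) ?f 0 / fact k"] allI)
  qed
  then obtain c where c: "\<And>b z. across_reals (\<lambda>x. p' x $ b) (\<lambda>z. p z $ b) z = (\<Sum>k\<le>n - 1. c b k * z ^ k)"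
    by metis
  define a where "a k = (\<chi> b. c b k)" for k
  define P where "P = (\<lambda>z. \<Sum>k<n. z ^ k *s a k)"
  have n': "{..n - 1} = {..<n}"
    using n by auto
  have "P z $ b = across_reals (\<lambda>x. p' x $ b) (\<lambda>z. p z $ b) z" for z b
    by (simp add: P_def c a_def mult.commute flip: n')
  then have P: "p z = P z" "p' x = P (of_real x)" if "z \<notin> \<real>" for z x
    using that by (auto simp: vec_eq_iff across_reals_def)
  note rapid_P = rapid_holder_weighted_row[OF P_def]
  \<comment> \<open>The jump of q is p \<rho>, as is that of the Cauchy transform of P \<rho>. The
    difference has no jump, is therefore entire, and is O(1 / z).\<close>
  have qP: "q z $ b = row_cauchy P b z" if z: "z \<notin> \<real>" for z b
  proof -
    let ?g = "weighted_row \<rho> P b"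
    let ?h = "\<lambda>z. q z $ b - row_cauchy P b z"
    let ?l = "\<lambda>x. qu x $ b - (1 / (2 * of_real pi * \<i>) * cauchy_regular ?g (of_real x) + ?g x / 2)"
    have l: "?l x = ql x $ b - (1 / (2 * of_real pi * \<i>) * cauchy_regular ?g (of_real x) - ?g x / 2)" for x
      using jump[of x b] P(2)[OF z] by (simp add: weighted_row_def) 
    have "continuous_on UNIV ?l"
      by (intro continuous_intros cont(2) continuous_on_compose2[OF continuous_on_cauchy_regular[OF rapid_P]]
          continuous_on_rapid_holder[OF rapid_P]) auto
    moreover have "?h holomorphic_on - \<real>"
      by (intro holomorphic_intros holo(2) row_cauchy_holomorphic[OF P_def])
    moreover have "(?h \<longlongrightarrow> ?l x) (at (of_real x) within {z. Im z > 0})" for x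
      by (intro tendsto_diff q_lim row_cauchy_boundary[OF P_def])
    moreover have "(?h \<longlongrightarrow> ?l x) (at (of_real x) within {z. Im z < 0})" for x
      unfolding l by (intro tendsto_diff q_lim row_cauchy_boundary[OF P_def])
    ultimately have hol: "across_reals ?l ?h holomorphic_on UNIV"
      by (intro across_reals_holomorphic)
    obtain R K where RK: "\<And>z. z \<notin> \<real> \<Longrightarrow> R \<le> norm z \<Longrightarrow> norm (z ^ Suc n * q z $ b) \<le> K"
      using q_decay by blast
    obtain B where B: "\<And>z. z \<notin> \<real> \<Longrightarrow> norm (z * cauchy_transform ?g z) \<le> B"
      using cauchy_transform_decay[OF rapid_P] by blast
    let ?K = "K + norm (1 / (2 * of_real pi * \<i>)) * B"
    have le: "norm (z * ?h z) \<le> ?K" if "z \<notin> \<real>" "max 1 R \<le> norm z" for z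
    proof -
      \<comment> \<open>Only first-order decay is used here, and norm z \<ge> 1 allows z to be
        replaced by the higher power. The full decay of q enters below, through the moments.\<close>
      have "norm (z * q z $ b) \<le> norm (z ^ Suc n * q z $ b)"
        unfolding norm_mult norm_power using that n power_increasing[of 1 "Suc n" "norm z"]
        by (intro mult_right_mono) auto
      also have "\<dots> \<le> K"
        using RK that by simp
      finally have 1: "norm (z * q z $ b) \<le> K" .
      have "z * row_cauchy P b z = 1 / (2 * of_real pi * \<i>) * (z * cauchy_transform ?g z)"
        by (simp add: row_cauchy_def)
      then have 2: "norm (z * row_cauchy P b z) \<le> norm (1 / (2 * of_real pi * \<i>)) * B"
        using mult_left_mono[OF B[OF that(1)] norm_ge_zero] by (metis norm_mult)
      show ?thesis
        unfolding right_diff_distrib by (rule order_trans[OF norm_triangle_ineq4 add_mono[OF 1 2]])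
    qed
    have le1: "norm (z * across_reals ?l ?h z) \<le> ?K" if "z \<notin> \<real>" "max 1 R \<le> norm z" for z
      using le[OF that] that(1) by (simp add: across_reals_def)
    have le': "norm (z * across_reals ?l ?h z) \<le> ?K" if "max 1 R \<le> norm z" for z
    proof (rule norm_le_across_reals[of "\<lambda>z. z * across_reals ?l ?h z" "\<lambda>_. ?K" "max 1 R" z])
      show "continuous_on UNIV (\<lambda>z. z * across_reals ?l ?h z)"
        by (intro continuous_intros holomorphic_on_imp_continuous_on[OF hol])
    qed (use le1 that in \<open>auto intro: continuous_intros\<close>)
    have "norm (across_reals ?l ?h z) \<le> ?K / norm z" if "max 1 R \<le> norm z" for z
    proof -
      have "0 < norm z"
        using that by linarith
      then show ?thesis
        using le'[OF that]
        by (simp add: norm_mult pos_le_divide_eq mult.commute)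
    qed
    then have "\<forall>\<^sub>F z in at_infinity. norm (across_reals ?l ?h z) \<le> ?K / norm z"
      unfolding eventually_at_infinity by blast
    moreover have "((\<lambda>z. ?K / norm z) \<longlongrightarrow> 0) (at_infinity :: complex filter)"
      by (rule real_tendsto_divide_at_top[OF tendsto_const filterlim_norm_at_top])
    ultimately have "(across_reals ?l ?h \<longlongrightarrow> 0) at_infinity"
      by (rule Lim_null_comparison)
    from Liouville_weak_0[OF hol this, of z] show ?thesis
      using z by (simp add: across_reals_def)
  qed
  have "a k = 0" if k: "k < n" for k
  proof (rule row_poly_eq_0[OF P_def _ k])
    fix j b assume j: "j < n"
    obtain R K where RK: "\<And>z. z \<notin> \<real> \<Longrightarrow> R \<le> norm z \<Longrightarrow> norm (z ^ Suc n * q z $ b) \<le> K"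
      using q_decay by blast
    have ct: "z ^ Suc n * cauchy_transform (weighted_row \<rho> P b) z = 2 * of_real pi * \<i> * (z ^ Suc n * q z $ b)"
      if "z \<notin> \<real>" for z
      by (simp add: qP[OF that] row_cauchy_def)
    have "norm (z ^ Suc n * cauchy_transform (weighted_row \<rho> P b) z) \<le> norm (2 * of_real pi * \<i>) * K"
      if "z \<notin> \<real>" "R \<le> norm z" for z
      unfolding ct[OF that(1)] norm_mult[of "2 * of_real pi * \<i>"]
      by (rule mult_left_mono[OF RK[OF that] norm_ge_zero])
    from moments_eq_0_if_cauchy_transform_decays[OF rapid_P this j]
    show "(LINT x|lborel. x ^ j *\<^sub>R weighted_row \<rho> P b x) = 0" .
  qed
  then have P0: "P = (\<lambda>z. 0)"
    by (simp add: P_def)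
  have "weighted_row \<rho> P b = (\<lambda>x. 0)" for b
    by (simp add: weighted_row_def P0 fun_eq_iff)
  then have "q z = 0"
    by (simp add: vec_eq_iff qP[OF z] row_cauchy_def cauchy_transform_zero)
  then show ?thesis
    using P(1)[OF z] by (simp add: P0)
qed

section \<open>Verification of the explicit solution\<close>

definition solution_row :: "nat \<Rightarrow> 'n + 'n \<Rightarrow> complex \<Rightarrow> complex^'n"
  where "solution_row n r z = (case r of
      Inl i \<Rightarrow> monic_op \<rho> n z $ i
    | Inr i \<Rightarrow> (norming_const \<rho> (n - 1) ** monic_op \<rho> (n - 1) z) $ i)"

lemma solution_row_Inl:
  obtains a where "solution_row n (Inl i) = (\<lambda>z. \<Sum>k<Suc n. z ^ k *s a k)" "a n = mat 1 $ i"
proof -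
  obtain A where A: "A n = mat 1" "monic_op \<rho> n = (\<lambda>z. \<Sum>k\<le>n. z ^ k *\<^sub>m A k)"
    using monic_matrix_poly_monic_op[of n] unfolding monic_matrix_poly_def by blast
  have "solution_row n (Inl i) = (\<lambda>z. \<Sum>k<Suc n. z ^ k *s A k $ i)"
    using monic_matrix_poly_row[OF A(2), of i] by (simp add: solution_row_def[abs_def])
  then show ?thesis
    using A(1) that by simp
qed

text \<open>The row comes from degree n - 1 and so has n coefficients; n \<ge> 1 guards the
  truncated subtraction.\<close>

lemma solution_row_Inr:
  assumes "n \<ge> 1"
  obtains a where "solution_row n (Inr i) = (\<lambda>z. \<Sum>k<n. z ^ k *s a k)"
proof -
  obtain A where A: "monic_op \<rho> (n - 1) = (\<lambda>z. \<Sum>k\<le>n - 1. z ^ k *\<^sub>m A k)"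
    using monic_matrix_poly_monic_op[of "n - 1"] unfolding monic_matrix_poly_def by blast
  have row: "(C ** M) $ i = C $ i v* M" for C M :: "complex^'n^'n"
    by (simp add: vec_eq_iff matrix_matrix_mult_def vector_matrix_mult_def mult.commute)
  show ?thesis
    using row_matrix_poly[OF A, of "norming_const \<rho> (n - 1) $ i"] assms that
    by (simp add: solution_row_def[abs_def] row)
qed

lemma solution_row_poly:
  assumes "n \<ge> 1"
  obtains m a where "solution_row n r = (\<lambda>z. \<Sum>k<m. z ^ k *s a k)"
proof (cases r)
  case (Inl i)
  then show ?thesis
    using solution_row_Inl[of n i] that by metis
next
  case (Inr i)
  then show ?thesis
    using solution_row_Inr[OF assms, of i] that by metis
qed

lemma integrable_weighted_row_monic_op:
  "integrable lborel (\<lambda>x. x ^ j *\<^sub>R weighted_row \<rho> (\<lambda>z. monic_op \<rho> m z $ i) b x)"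
proof -
  obtain A where "monic_op \<rho> m = (\<lambda>z. \<Sum>k\<le>m. z ^ k *\<^sub>m A k)"
    using monic_matrix_poly_monic_op[of m] unfolding monic_matrix_poly_def by blast
  from integrable_weighted_row[OF monic_matrix_poly_row[OF this]] show ?thesis .
qed

lemma moment_solution_row_Inl:
  "j < n \<Longrightarrow> (LINT x|lborel. x ^ j *\<^sub>R weighted_row \<rho> (solution_row n (Inl i)) b x) = 0"
  using moment_monic_op[of j n] by (simp add: solution_row_def[abs_def] moment_def vec_eq_iff)

lemma weighted_row_solution_row_Inr:
  "weighted_row \<rho> (solution_row n (Inr i)) b x
    = (\<Sum>l\<in>UNIV. norming_const \<rho> (n - 1) $ i $ l * weighted_row \<rho> (\<lambda>z. monic_op \<rho> (n - 1) z $ l) b x)"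
  by (simp add: solution_row_def[abs_def] weighted_row_mult)

lemma moment_solution_row_Inr:
  "(LINT x|lborel. x ^ j *\<^sub>R weighted_row \<rho> (solution_row n (Inr i)) b x)
    = (norming_const \<rho> (n - 1) ** moment (monic_op \<rho> (n - 1)) j) $ i $ b"
proof -
  have "(LINT x|lborel. x ^ j *\<^sub>R weighted_row \<rho> (solution_row n (Inr i)) b x)
      = (LINT x|lborel. (\<Sum>l\<in>UNIV. norming_const \<rho> (n - 1) $ i $ l *
          (x ^ j *\<^sub>R weighted_row \<rho> (\<lambda>z. monic_op \<rho> (n - 1) z $ l) b x)))"
    by (simp add: weighted_row_solution_row_Inr scaleR_sum_right)
  also have "\<dots> = (\<Sum>l\<in>UNIV. (LINT x|lborel. norming_const \<rho> (n - 1) $ i $ l *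
          (x ^ j *\<^sub>R weighted_row \<rho> (\<lambda>z. monic_op \<rho> (n - 1) z $ l) b x)))"
    by (intro Bochner_Integration.integral_sum integrable_mult_right integrable_weighted_row_monic_op)
  finally show ?thesis
    by (simp only: integral_mult_right_zero) (simp add: moment_def matrix_matrix_mult_def)
qed

text \<open>The matrix integral is split into entries once its integrand is known to be integrable,
  which holds for z off the line.\<close>

lemma cauchy_op_row:
  assumes z: "z \<notin> \<real>"
  shows "cauchy_op \<rho> m z $ i $ b = row_cauchy (\<lambda>z. monic_op \<rho> m z $ i) b z"
proof -
  let ?f = "\<lambda>x. (1 / (of_real x - z)) *\<^sub>m (monic_op \<rho> m (of_real x) ** \<rho> x)"
  have entry: "?f x $ i $ b = weighted_row \<rho> (\<lambda>z. monic_op \<rho> m z $ i) b x / (of_real x - z)" for x i b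
    by (simp add: msmult_def weighted_row_matrix[symmetric])
  have row: "integrable lborel (\<lambda>x. ?f x $ i)" for i
  proof (rule integrable_vec)
    fix b
    show "integrable lborel (\<lambda>x. ?f x $ i $ b)"
      unfolding entry using integrable_weighted_row_monic_op[of 0 m i b]
      by (intro integrable_divide_of_real_diff z) simp
  qed
  have "integral\<^sup>L lborel ?f $ i $ b = cauchy_transform (weighted_row \<rho> (\<lambda>z. monic_op \<rho> m z $ i) b) z"
    unfolding integral_vec_nth[OF integrable_vec[OF row]] integral_vec_nth[OF row] entry cauchy_transform_def ..
  then show ?thesis
    unfolding cauchy_op_def row_cauchy_def by (simp add: msmult_def)
qed

lemma rhp_solution_Inl: "rhp_solution \<rho> n z $ r $ Inl b = solution_row n r z $ b"
  by (cases r) (simp_all add: rhp_solution_def block_matrix_def solution_row_def)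

text \<open>Both block rows have the same shape, a row polynomial followed by its Cauchy transform.
  In the lower one the constant left factor moves into the integral.\<close>

lemma rhp_solution_Inr:
  assumes z: "z \<notin> \<real>"
  shows "rhp_solution \<rho> n z $ r $ Inr b = row_cauchy (solution_row n r) b z"
proof (cases r)
  case (Inl i)
  then show ?thesis
    by (simp add: rhp_solution_def block_matrix_def solution_row_def[abs_def] cauchy_op_row[OF z])
next
  case (Inr i)
  let ?c = "\<lambda>l. norming_const \<rho> (n - 1) $ i $ l"
  let ?g = "\<lambda>l. weighted_row \<rho> (\<lambda>z. monic_op \<rho> (n - 1) z $ l) b"
  have int: "integrable lborel (\<lambda>x. ?c l * (?g l x / (of_real x - z)))" for l
    using integrable_weighted_row_monic_op[of 0 "n - 1" l b]
    by (intro integrable_mult_right integrable_divide_of_real_diff z) simp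
  have "cauchy_transform (weighted_row \<rho> (solution_row n r) b) z
      = (LINT x|lborel. (\<Sum>l\<in>UNIV. ?c l * (?g l x / (of_real x - z))))"
    by (simp add: cauchy_transform_def Inr weighted_row_solution_row_Inr sum_divide_distrib)
  also have "\<dots> = (\<Sum>l\<in>UNIV. (LINT x|lborel. ?c l * (?g l x / (of_real x - z))))"
    by (intro Bochner_Integration.integral_sum int)
  also have "\<dots> = (\<Sum>l\<in>UNIV. ?c l * cauchy_transform (?g l) z)"
    by (simp only: integral_mult_right_zero cauchy_transform_def)
  finally have "row_cauchy (solution_row n r) b z = (\<Sum>l\<in>UNIV. ?c l * cauchy_op \<rho> (n - 1) z $ l $ b)"
    by (simp add: row_cauchy_def cauchy_op_row[OF z] sum_distrib_left mult_ac)
  then show ?thesis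
    by (simp add: rhp_solution_def block_matrix_def Inr matrix_matrix_mult_def)
qed

lemma row_poly_decay:
  "\<exists>K. \<forall>z. 1 \<le> norm z \<longrightarrow> norm ((\<Sum>k<n. z ^ k *s a k) $ b * z powi (- int n)) \<le> K * norm (1 / z)"
  for a :: "nat \<Rightarrow> complex^'n"
proof -
  have "norm ((\<Sum>k<n. z ^ k *s a k) $ b * z powi (- int n)) \<le> (\<Sum>k<n. norm (a k $ b)) * norm (1 / z)"
    if z: "1 \<le> norm z" for z
  proof -
    have "norm ((\<Sum>k<n. z ^ k *s a k) $ b * z powi (- int n))
        = norm (\<Sum>k<n. z ^ k * a k $ b / z ^ n)"
      by (simp add: power_int_minus sum_distrib_right divide_inverse)
    also have "\<dots> \<le> (\<Sum>k<n. norm (a k $ b) * norm (1 / z))"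
    proof (rule order_trans[OF norm_sum sum_mono])
      fix k assume "k \<in> {..<n}"
      then have "norm z ^ Suc k \<le> norm z ^ n"
        using z by (intro power_increasing) auto
      moreover have "0 < norm z"
        using z by linarith
      ultimately have "norm z ^ k / norm z ^ n \<le> 1 / norm z"
        by (simp add: divide_simps mult.commute)
      from mult_left_mono[OF this norm_ge_zero[of "a k $ b"]]
      show "norm (z ^ k * a k $ b / z ^ n) \<le> norm (a k $ b) * norm (1 / z)"
        by (simp add: norm_mult norm_divide norm_power mult_ac)
    qed
    finally show ?thesis
      by (simp add: sum_distrib_right)
  qed
  then show ?thesis by blast
qed

text \<open>If the first n moments vanish, the transform has order -(n + 1) at infinity, and the
  next moment is its leading coefficient up to the factor -1 / (2 pi i). The first form serves the
  upper right block, the second, with n - 1 for n, the lower right one.\<close>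

lemma row_cauchy_mult_power:
  assumes p: "p = (\<lambda>z. \<Sum>k<m. z ^ k *s a k)"
    and moments: "\<And>j. j < n \<Longrightarrow> (LINT x|lborel. x ^ j *\<^sub>R weighted_row \<rho> p b x) = 0"
  shows "\<exists>K. \<forall>z. z \<notin> \<real> \<longrightarrow> norm (row_cauchy p b z * z ^ n) \<le> K * norm (1 / z)"
    and "\<exists>K. \<forall>z. z \<notin> \<real> \<longrightarrow> norm (row_cauchy p b z * z ^ Suc n
      + (LINT x|lborel. x ^ n *\<^sub>R weighted_row \<rho> p b x) / (2 * of_real pi * \<i>)) \<le> K * norm (1 / z)"
proof -
  let ?g = "weighted_row \<rho> p b"
  let ?c = "1 / (2 * of_real pi * \<i>)"
  have rapid_n: "rapid_holder \<gamma> (\<lambda>x. x ^ n *\<^sub>R ?g x)" for n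
    by (rule rapid_holder_times_power[OF rapid_holder_weighted_row[OF p]])
  have "\<exists>K. \<forall>z. z \<notin> \<real> \<longrightarrow> norm (?c * cauchy_transform (\<lambda>x. x ^ n *\<^sub>R ?g x) z) \<le> K * norm (1 / z)" for n
  proof -
    obtain K where K: "\<And>z. z \<notin> \<real> \<Longrightarrow> norm (z * cauchy_transform (\<lambda>x. x ^ n *\<^sub>R ?g x) z) \<le> K"
      using cauchy_transform_decay[OF rapid_n] by blast
    have "norm (?c * cauchy_transform (\<lambda>x. x ^ n *\<^sub>R ?g x) z) \<le> norm ?c * K * norm (1 / z)" if z: "z \<notin> \<real>" for z
    proof -
      have "z \<noteq> 0"
        using z by auto
      then have "norm (cauchy_transform (\<lambda>x. x ^ n *\<^sub>R ?g x) z) \<le> K * norm (1 / z)"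
        using K[OF z] by (simp add: norm_mult norm_divide pos_le_divide_eq mult.commute)
      then show ?thesis
        unfolding norm_mult mult.assoc by (rule mult_left_mono) simp
    qed
    then show ?thesis by blast
  qed
  note decay = this
  have power: "row_cauchy p b z * z ^ n = ?c * cauchy_transform (\<lambda>x. x ^ n *\<^sub>R ?g x) z" if "z \<notin> \<real>" for z
    using cauchy_transform_mult_power[OF rapid_holder_weighted_row[OF p] that moments]
    by (simp add: row_cauchy_def mult_ac)
  then show "\<exists>K. \<forall>z. z \<notin> \<real> \<longrightarrow> norm (row_cauchy p b z * z ^ n) \<le> K * norm (1 / z)"
    using decay[of n] by simp
  have "row_cauchy p b z * z ^ Suc n + (LINT x|lborel. x ^ n *\<^sub>R ?g x) / (2 * of_real pi * \<i>)
      = ?c * cauchy_transform (\<lambda>x. x ^ Suc n *\<^sub>R ?g x) z" if z: "z \<notin> \<real>" for z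
  proof -
    have "row_cauchy p b z * z ^ Suc n = ?c * (z * cauchy_transform (\<lambda>x. x ^ n *\<^sub>R ?g x) z)"
      using power[OF z] by (simp add: mult_ac)
    also have "\<dots> = ?c * (cauchy_transform (\<lambda>x. x ^ Suc n *\<^sub>R ?g x) z - (LINT x|lborel. x ^ n *\<^sub>R ?g x))"
      using cauchy_transform_mult_ident[OF rapid_n z] by simp
    finally show ?thesis
      by (simp add: right_diff_distrib)
  qed
  then show "\<exists>K. \<forall>z. z \<notin> \<real> \<longrightarrow> norm (row_cauchy p b z * z ^ Suc n
      + (LINT x|lborel. x ^ n *\<^sub>R ?g x) / (2 * of_real pi * \<i>)) \<le> K * norm (1 / z)"
    using decay[of "Suc n"] by simp
qed

text \<open>Multiplication by the inverse of the diagonal factor isolates the error term. In the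
  left block column degrees control it, in the right one vanishing moments do.\<close>

lemma rhp_solution_asymptotics:
  assumes n: "n \<ge> 1"
  shows "\<exists>K. \<forall>z. z \<notin> \<real> \<longrightarrow> 1 \<le> norm z \<longrightarrow>
    norm ((rhp_solution \<rho> n z ** block_matrix (mat (z powi (- int n))) 0 0 (mat (z ^ n)) - mat 1) $ r $ s)
      \<le> K * norm (1 / z)"
    (is "\<exists>K. \<forall>z. _ \<longrightarrow> _ \<longrightarrow> norm (?E z $ r $ s) \<le> _")
proof (cases s)
  case s: (Inl b)
  have E: "?E z $ r $ s = solution_row n r z $ b * z powi (- int n) - mat 1 $ r $ Inl b" for z
    by (simp add: s mult_block_diag rhp_solution_Inl)
  show ?thesis
  proof (cases r)
    case (Inl i)
    obtain a where a: "solution_row n (Inl i) = (\<lambda>z. \<Sum>k<Suc n. z ^ k *s a k)" "a n = mat 1 $ i"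
      by (rule solution_row_Inl)
    \<comment> \<open>The monic leading term cancels against the identity, which leaves powers below
      n.\<close>
    have "?E z $ r $ s = (\<Sum>k<n. z ^ k *s a k) $ b * z powi (- int n)" if "z \<notin> \<real>" for z
    proof -
      have "z \<noteq> 0"
        using that by auto
      then show ?thesis
        unfolding E unfolding Inl a(1) by (simp add: a(2) mat_def power_int_minus algebra_simps)
    qed
    then show ?thesis
      using row_poly_decay[where n = n and a = a and b = b] by auto
  next
    case (Inr i)
    obtain a where a: "solution_row n (Inr i) = (\<lambda>z. \<Sum>k<n. z ^ k *s a k)"
      by (rule solution_row_Inr[OF n])
    have "?E z $ r $ s = (\<Sum>k<n. z ^ k *s a k) $ b * z powi (- int n)" for z
      unfolding E unfolding Inr a by (simp add: mat_def)
    then show ?thesis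
      using row_poly_decay[where n = n and a = a and b = b] by auto
  qed
next
  case s: (Inr b)
  have E: "?E z $ r $ s = row_cauchy (solution_row n r) b z * z ^ n - mat 1 $ r $ Inr b" if "z \<notin> \<real>" for z
    by (simp add: s mult_block_diag rhp_solution_Inr[OF that])
  obtain m a where p: "solution_row n r = (\<lambda>z. \<Sum>k<m. z ^ k *s a k)"
    by (rule solution_row_poly[OF n])
  show ?thesis
  proof (cases r)
    case (Inl i)
    have "?E z $ r $ s = row_cauchy (solution_row n r) b z * z ^ n" if "z \<notin> \<real>" for z
      unfolding E[OF that] by (simp add: Inl mat_def)
    then show ?thesis
      using row_cauchy_mult_power(1)[OF p, of n b] moment_solution_row_Inl[of _ n i b] by (auto simp: Inl)
  next
    case (Inr i)
    \<comment> \<open>The effect of \<open>norming_const\<close>: the first moment that need not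
      vanish becomes -2 pi i times the identity, so the leading term of the expansion is the entry
      of \<open>mat 1\<close>.\<close>
    have N: "(LINT x|lborel. x ^ (n - 1) *\<^sub>R weighted_row \<rho> (solution_row n r) b x) / (2 * of_real pi * \<i>)
        = - mat 1 $ r $ Inr b"
      unfolding Inr moment_solution_row_Inr norming_const_mult
      by (simp add: msmult_def mat_def)
    have "?E z $ r $ s = row_cauchy (solution_row n r) b z * z ^ Suc (n - 1)
        + (LINT x|lborel. x ^ (n - 1) *\<^sub>R weighted_row \<rho> (solution_row n r) b x) / (2 * of_real pi * \<i>)"
      if "z \<notin> \<real>" for z
      unfolding E[OF that] N using n by simp
    moreover have "(LINT x|lborel. x ^ j *\<^sub>R weighted_row \<rho> (solution_row n r) b x) = 0" if "j < n - 1" for j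
      using that by (simp add: Inr moment_solution_row_Inr moment_monic_op matrix_matrix_mult_def)
    ultimately show ?thesis
      using row_cauchy_mult_power(2)[OF p, of "n - 1" b] by (auto simp del: power_Suc)
  qed
qed

lemma tendsto_matrix:
  assumes "\<And>r s. ((\<lambda>z. Y z $ r $ s) \<longlongrightarrow> L $ r $ s) F"
  shows "(Y \<longlongrightarrow> L) F"
  by (intro vec_tendstoI assms)

lemma continuous_on_matrix:
  assumes "\<And>r s. continuous_on S (\<lambda>z. Y z $ r $ s)"
  shows "continuous_on S Y"
  using assms unfolding continuous_on_def by (blast intro: tendsto_matrix)

lemma rhp_solution_solves:
  assumes n: "n \<ge> 1"
  shows "solves_rhp \<rho> n (rhp_solution \<rho> n)"
proof -
  let ?Y = "rhp_solution \<rho> n"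
  let ?p = "solution_row n"
  let ?c = "1 / (2 * of_real pi * \<i>)"
  have open_C: "open (- \<real> :: complex set)"
    by (intro open_Compl closed_complex_Reals)
  have p_cont: "continuous_on UNIV (\<lambda>z. ?p r z $ b)" for r b
  proof -
    obtain m a where "?p r = (\<lambda>z. \<Sum>k<m. z ^ k *s a k)"
      by (rule solution_row_poly[OF n])
    then show ?thesis
      by (auto intro!: continuous_intros)
  qed
  have analytic: "(\<lambda>z. ?Y z $ r $ s) analytic_on - \<real>" for r s
  proof -
    obtain m a where p: "?p r = (\<lambda>z. \<Sum>k<m. z ^ k *s a k)"
      by (rule solution_row_poly[OF n])
    have "(\<lambda>z. ?Y z $ r $ s) holomorphic_on - \<real>"
    proof (cases s)
      case (Inl b)
      then show ?thesis
        by (simp add: rhp_solution_Inl p) (intro holomorphic_intros)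
    next
      case (Inr b)
      show ?thesis
        unfolding Inr
        by (rule holomorphic_transform[OF row_cauchy_holomorphic[OF p, of b]]) (simp add: rhp_solution_Inr)
    qed
    then show ?thesis
      by (simp add: analytic_on_open[OF open_C])
  qed
  define E where "E z = ?Y z ** block_matrix (mat (z powi (- int n))) 0 0 (mat (z ^ n)) - mat 1" for z
  have "?Y z = (mat 1 + E z) ** block_matrix (mat (z ^ n)) 0 0 (mat (z powi (- int n)))" if "z \<notin> \<real>" for z
  proof -
    have z: "z \<noteq> 0"
      using that by auto
    have "?Y z $ r $ s = ((mat 1 + E z) ** block_matrix (mat (z ^ n)) 0 0 (mat (z powi (- int n)))) $ r $ s" for r s
      using z by (cases s) (simp_all add: E_def mult_block_diag power_int_minus)
    then show ?thesis
      by (simp add: vec_eq_iff)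
  qed
  then have asymp: "\<forall>\<^sub>F z in inf at_infinity (principal (- \<real>)).
      ?Y z = (mat 1 + E z) ** block_matrix (mat (z ^ n)) 0 0 (mat (z powi (- int n)))"
    unfolding eventually_off_reals by blast
  have bigo: "(\<lambda>z. E z $ r $ s) \<in> O[inf at_infinity (principal (- \<real>))](\<lambda>z. 1 / z)" for r s
  proof -
    obtain K where "\<And>z. z \<notin> \<real> \<Longrightarrow> 1 \<le> norm z \<Longrightarrow> norm (E z $ r $ s) \<le> K * norm (1 / z)"
      using rhp_solution_asymptotics[OF n, of r s] unfolding E_def by blast
    then show ?thesis
      by (intro bigoI[of _ K]) (auto simp: eventually_off_reals)
  qed
  \<comment> \<open>Both boundary values in one formula, \<sigma> = 1 from above and \<sigma> = -1
    from below. They agree in the left block column and differ by the whole weighted row in the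
    right one.\<close>
  define B where "B \<sigma> x = (\<chi> r s. case s of Inl b \<Rightarrow> ?p r (of_real x) $ b
    | Inr b \<Rightarrow> ?c * cauchy_regular (weighted_row \<rho> (?p r) b) (of_real x) + \<sigma> * weighted_row \<rho> (?p r) b x / 2)"
    for \<sigma> :: complex and x
  have B_cont: "continuous_on UNIV (B \<sigma>)" for \<sigma>
  proof (rule continuous_on_matrix)
    fix r s
    obtain m a where p: "?p r = (\<lambda>z. \<Sum>k<m. z ^ k *s a k)"
      by (rule solution_row_poly[OF n])
    note rapid_p = rapid_holder_weighted_row[OF p]
    show "continuous_on UNIV (\<lambda>x. B \<sigma> x $ r $ s)"
    proof (cases s)
      case (Inl b)
      then show ?thesis
        by (simp add: B_def p) (intro continuous_intros)
    next
      case (Inr b)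
      then show ?thesis
        by (simp add: B_def)
          (intro continuous_intros continuous_on_compose2[OF continuous_on_cauchy_regular[OF rapid_p]]
            continuous_on_rapid_holder[OF rapid_p]; simp)
    qed
  qed
  have B_lim: "(?Y \<longlongrightarrow> B \<sigma> x) (at (of_real x) within S)"
    if S: "S \<subseteq> - \<real>" and \<sigma>: "\<And>r b. (row_cauchy (?p r) b \<longlongrightarrow> B \<sigma> x $ r $ Inr b) (at (of_real x) within S)"
    for \<sigma> x S
  proof (rule tendsto_matrix)
    fix r s
    show "((\<lambda>z. ?Y z $ r $ s) \<longlongrightarrow> B \<sigma> x $ r $ s) (at (of_real x) within S)"
    proof (cases s)
      case (Inl b)
      have "((\<lambda>z. ?p r z $ b) \<longlongrightarrow> ?p r (of_real x) $ b) (at (of_real x) within S)"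
        using p_cont[of r b] unfolding continuous_on_def by (blast intro: tendsto_within_subset)
      then show ?thesis
        by (simp add: Inl rhp_solution_Inl B_def)
    next
      case (Inr b)
      show ?thesis
        unfolding Inr
      proof (rule Lim_transform_eventually[OF \<sigma>])
        show "\<forall>\<^sub>F z in at (of_real x) within S. row_cauchy (?p r) b z = ?Y z $ r $ Inr b"
          unfolding eventually_at_filter using S
          by (intro always_eventually) (auto simp: rhp_solution_Inr)
      qed
    qed
  qed
  have upper: "(?Y \<longlongrightarrow> B 1 x) (at (of_real x) within {z. Im z > 0})" for x
  proof (rule B_lim)
    fix r b
    obtain m a where p: "?p r = (\<lambda>z. \<Sum>k<m. z ^ k *s a k)"
      by (rule solution_row_poly[OF n])
    show "(row_cauchy (?p r) b \<longlongrightarrow> B 1 x $ r $ Inr b) (at (of_real x) within {z. Im z > 0})"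
      using row_cauchy_boundary(1)[OF p, of b x] by (simp add: B_def)
  qed (auto simp: complex_is_Real_iff)
  have lower: "(?Y \<longlongrightarrow> B (-1) x) (at (of_real x) within {z. Im z < 0})" for x
  proof (rule B_lim)
    fix r b
    obtain m a where p: "?p r = (\<lambda>z. \<Sum>k<m. z ^ k *s a k)"
      by (rule solution_row_poly[OF n])
    show "(row_cauchy (?p r) b \<longlongrightarrow> B (-1) x $ r $ Inr b) (at (of_real x) within {z. Im z < 0})"
      using row_cauchy_boundary(2)[OF p, of b x] by (simp add: B_def)
  qed (auto simp: complex_is_Real_iff)
  have jump: "B 1 x = B (-1) x ** block_matrix (mat 1) (\<rho> x) 0 (mat 1)" for x
  proof -
    have "B 1 x $ r $ s = (B (-1) x ** block_matrix (mat 1) (\<rho> x) 0 (mat 1)) $ r $ s" for r s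
    proof (cases s)
      case (Inl b)
      then show ?thesis
        by (simp add: mult_block_matrix sum_mult_mat) (simp add: B_def)
    next
      case (Inr b)
      have "(\<Sum>a\<in>UNIV. B (-1) x $ r $ Inl a * \<rho> x $ a $ b) = weighted_row \<rho> (?p r) b x"
        by (simp add: B_def weighted_row_def)
      then show ?thesis
        by (simp add: Inr mult_block_matrix sum_mult_mat) (simp add: B_def)
    qed
    then show ?thesis
      by (simp add: vec_eq_iff)
  qed
  show ?thesis
    unfolding solves_rhp_def
    using analytic asymp bigo B_cont upper lower jump by blast
qed

section \<open>Uniqueness of the solution\<close>

lemma rhp_solution_unique:
  assumes n: "n \<ge> 1" and Y: "solves_rhp \<rho> n Y" and W: "solves_rhp \<rho> n W" and z: "z \<notin> \<real>"
  shows "Y z = W z"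
proof -
  obtain E Yu Yl where Y_hol: "\<And>r s. (\<lambda>z. Y z $ r $ s) analytic_on - \<real>"
    and YE: "\<forall>\<^sub>F z in inf at_infinity (principal (- \<real>)).
      Y z = (mat 1 + E z) ** block_matrix (mat (z ^ n)) 0 0 (mat (z powi (- int n)))"
    and E: "\<And>r s. (\<lambda>z. E z $ r $ s) \<in> O[inf at_infinity (principal (- \<real>))](\<lambda>z. 1 / z)"
    and Y_cont: "continuous_on UNIV Yu" "continuous_on UNIV Yl"
    and Y_lim: "\<And>x. (Y \<longlongrightarrow> Yu x) (at (of_real x) within {z. Im z > 0})"
      "\<And>x. (Y \<longlongrightarrow> Yl x) (at (of_real x) within {z. Im z < 0})"
    and Y_jump: "\<And>x. Yu x = Yl x ** block_matrix (mat 1) (\<rho> x) 0 (mat 1)"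
    using Y unfolding solves_rhp_def by blast
  obtain F Wu Wl where W_hol: "\<And>r s. (\<lambda>z. W z $ r $ s) analytic_on - \<real>"
    and WF: "\<forall>\<^sub>F z in inf at_infinity (principal (- \<real>)).
      W z = (mat 1 + F z) ** block_matrix (mat (z ^ n)) 0 0 (mat (z powi (- int n)))"
    and F: "\<And>r s. (\<lambda>z. F z $ r $ s) \<in> O[inf at_infinity (principal (- \<real>))](\<lambda>z. 1 / z)"
    and W_cont: "continuous_on UNIV Wu" "continuous_on UNIV Wl"
    and W_lim: "\<And>x. (W \<longlongrightarrow> Wu x) (at (of_real x) within {z. Im z > 0})"
      "\<And>x. (W \<longlongrightarrow> Wl x) (at (of_real x) within {z. Im z < 0})"
    and W_jump: "\<And>x. Wu x = Wl x ** block_matrix (mat 1) (\<rho> x) 0 (mat 1)"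
    using W unfolding solves_rhp_def by blast
  define D Du Dl where "D z = Y z - W z" and "Du x = Yu x - Wu x" and "Dl x = Yl x - Wl x" for z x
  have hol: "(\<lambda>z. D z $ r $ s) holomorphic_on - \<real>" for r s
    unfolding D_def using Y_hol[of r s] W_hol[of r s]
    by (simp add: holomorphic_on_diff analytic_imp_holomorphic)
  have cont: "continuous_on UNIV (\<lambda>x. Du x $ r $ s)" "continuous_on UNIV (\<lambda>x. Dl x $ r $ s)" for r s
    unfolding Du_def Dl_def using Y_cont W_cont by (auto intro!: continuous_intros)
  have lim: "((\<lambda>z. D z $ r $ s) \<longlongrightarrow> Du x $ r $ s) (at (of_real x) within {z. Im z > 0})"
    "((\<lambda>z. D z $ r $ s) \<longlongrightarrow> Dl x $ r $ s) (at (of_real x) within {z. Im z < 0})" for x r s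
    unfolding D_def Du_def Dl_def by (intro tendsto_vec_nth tendsto_diff Y_lim W_lim)+
  \<comment> \<open>The jump matrix is block upper triangular with identities on the diagonal: the
    left block column does not jump, and the right one jumps by the left one times \<rho>.\<close>
  have Du: "Du x $ r $ Inl b = Dl x $ r $ Inl b"
    "Du x $ r $ Inr b = Dl x $ r $ Inr b + (\<Sum>a\<in>UNIV. Dl x $ r $ Inl a * \<rho> x $ a $ b)" for x r b
    by (simp_all add: Du_def Dl_def Y_jump W_jump mult_block_matrix sum_mult_mat
        left_diff_distrib sum_subtractf)
  have lim_Inl: "((\<lambda>z. D z $ r $ Inl b) \<longlongrightarrow> Du x $ r $ Inl b) (at (of_real x) within {z. Im z < 0})" for x r b
    unfolding Du(1) by (rule lim)
  have jump: "Du x $ r $ Inr b = Dl x $ r $ Inr b + (\<Sum>a\<in>UNIV. Du x $ r $ Inl a * \<rho> x $ a $ b)" for x r b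
    by (simp add: Du)
  \<comment> \<open>The identity matrices of the two normalizations cancel, which leaves an O(1 / z)
    error in front of the diagonal factor.\<close>
  have decay: "\<exists>R K. 1 \<le> R \<and> (\<forall>z. z \<notin> \<real> \<longrightarrow> R \<le> norm z \<longrightarrow> norm (z * (E z - F z) $ r $ s) \<le> K \<and>
      D z = (E z - F z) ** block_matrix (mat (z ^ n)) 0 0 (mat (z powi (- int n))))" for r s
  proof -
    have "(\<lambda>z. E z $ r $ s - F z $ r $ s) \<in> O[inf at_infinity (principal (- \<real>))](\<lambda>z. 1 / z)"
      by (intro sum_in_bigo E F)
    then obtain K where "\<forall>\<^sub>F z in inf at_infinity (principal (- \<real>)). norm (E z $ r $ s - F z $ r $ s) \<le> K * norm (1 / z)"
      by (elim landau_o.bigE)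
    from eventually_conj[OF this eventually_conj[OF YE WF]]
    obtain R where R: "\<And>z. z \<notin> \<real> \<Longrightarrow> R \<le> norm z \<Longrightarrow> norm (E z $ r $ s - F z $ r $ s) \<le> K * norm (1 / z) \<and>
      Y z = (mat 1 + E z) ** block_matrix (mat (z ^ n)) 0 0 (mat (z powi (- int n))) \<and>
      W z = (mat 1 + F z) ** block_matrix (mat (z ^ n)) 0 0 (mat (z powi (- int n)))"
      unfolding eventually_off_reals by blast
    have "norm (z * (E z - F z) $ r $ s) \<le> K \<and>
      D z = (E z - F z) ** block_matrix (mat (z ^ n)) 0 0 (mat (z powi (- int n)))"
      if "z \<notin> \<real>" "max 1 R \<le> norm z" for z
    proof
      have "z \<noteq> 0"
        using that by auto
      then show "norm (z * (E z - F z) $ r $ s) \<le> K"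
        using R[of z] that by (simp add: norm_mult norm_divide pos_le_divide_eq mult.commute)
      have "Y z = (mat 1 + E z) ** block_matrix (mat (z ^ n)) 0 0 (mat (z powi (- int n)))"
        "W z = (mat 1 + F z) ** block_matrix (mat (z ^ n)) 0 0 (mat (z powi (- int n)))"
        using R[of z] that by auto
      then show "D z = (E z - F z) ** block_matrix (mat (z ^ n)) 0 0 (mat (z powi (- int n)))"
        unfolding D_def by (simp add: matrix_matrix_mult_def vec_eq_iff algebra_simps flip: sum_subtractf)
    qed
    then show ?thesis
      by (intro exI[of _ "max 1 R"] exI[of _ K]) auto
  qed
  have "D z $ r $ Inl b = 0 \<and> D z $ r $ Inr b = 0" for r b
  proof -
    let ?l = "\<lambda>M. \<chi> b. M $ r $ Inl b" and ?r = "\<lambda>M. \<chi> b. M $ r $ Inr b"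
    have "?l (D z) = 0 \<and> ?r (D z) = 0"
    proof (rule homogeneous_row_eq_0[OF n, of "\<lambda>z. ?l (D z)" "\<lambda>z. ?r (D z)"
          "\<lambda>x. ?l (Du x)" "\<lambda>x. ?r (Du x)" "\<lambda>x. ?r (Dl x)"])
      fix b
      show "\<exists>R K. \<forall>z. z \<notin> \<real> \<longrightarrow> R \<le> norm z \<longrightarrow> norm (?l (D z) $ b) \<le> K * norm z ^ (n - 1)"
      proof -
        obtain R K where R: "1 \<le> R" and *: "\<And>z. z \<notin> \<real> \<Longrightarrow> R \<le> norm z \<Longrightarrow> norm (z * (E z - F z) $ r $ Inl b) \<le> K \<and>
            D z = (E z - F z) ** block_matrix (mat (z ^ n)) 0 0 (mat (z powi (- int n)))"
          using decay[of r "Inl b"] by blast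
        have "norm (D z $ r $ Inl b) \<le> K * norm z ^ (n - 1)" if "z \<notin> \<real>" "R \<le> norm z" for z
        proof -
          \<comment> \<open>One factor of z ^ n is spent on the O(1 / z) error, which lowers the
            growth to n - 1; here n \<ge> 1 enters.\<close>
          have "D z $ r $ Inl b = (z * (E z - F z) $ r $ Inl b) * z ^ (n - 1)"
            using *[OF that] n by (simp add: mult_block_diag mult_ac flip: power_Suc)
          then show ?thesis
            using *[OF that] by (simp only: norm_mult norm_power) (intro mult_right_mono, auto)
        qed
        then show ?thesis
          by auto
      qed
      show "\<exists>R K. \<forall>z. z \<notin> \<real> \<longrightarrow> R \<le> norm z \<longrightarrow> norm (z ^ Suc n * ?r (D z) $ b) \<le> K"
      proof -
        obtain R K where R: "1 \<le> R" and *: "\<And>z. z \<notin> \<real> \<Longrightarrow> R \<le> norm z \<Longrightarrow> norm (z * (E z - F z) $ r $ Inr b) \<le> K \<and>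
            D z = (E z - F z) ** block_matrix (mat (z ^ n)) 0 0 (mat (z powi (- int n)))"
          using decay[of r "Inr b"] by blast
        have "norm (z ^ Suc n * D z $ r $ Inr b) \<le> K" if "z \<notin> \<real>" "R \<le> norm z" for z
        proof -
          have "z \<noteq> 0"
            using that by auto
          \<comment> \<open>The factor z ^ (-n) of the diagonal and the O(1 / z) error together give
            decay of order n + 1.\<close>
          then have eq: "z ^ Suc n * D z $ r $ Inr b = z * (E z - F z) $ r $ Inr b"
            using *[OF that] by (simp add: mult_block_diag power_int_minus)
          show ?thesis
            unfolding eq using *[OF that] by blast
        qed
        then show ?thesis
          by auto
      qed
    qed (unfold vec_lambda_beta, (rule z hol cont lim lim_Inl jump)+)
    then show ?thesis
      by (simp add: vec_eq_iff)
  qed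
  then have "D z $ r $ s = 0" for r s
    by (cases s) auto
  then show ?thesis
    by (simp add: D_def vec_eq_iff)
qed

end

theorem proposition2:
  fixes V :: "real \<Rightarrow> complex^'n^'n" and n :: nat
  defines "\<rho> \<equiv> (\<lambda>x. matrix_exp (- V x))"
  assumes even: "\<And>x. V x = V (- x)"
    and hermitian: "\<And>x. hermitian_matrix (V x)"
    and holder: "\<And>i j. holder_continuous (\<lambda>x. V x $ i $ j)"
    and moments: "finite_moments \<rho>"
    and n: "n \<ge> 1"
  shows "solves_rhp \<rho> n (rhp_solution \<rho> n) \<and>
    (\<forall>Y. solves_rhp \<rho> n Y \<longrightarrow> (\<forall>z. z \<notin> \<real> \<longrightarrow> Y z = rhp_solution \<rho> n z))"
proof -
  obtain \<gamma> where \<gamma>: "\<And>i j. rapid_holder \<gamma> (\<lambda>x. \<rho> x $ i $ j)"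
    using rapid_holder_matrix_exp[OF hermitian holder] moments unfolding \<rho>_def by blast
  have "hermitian_matrix (- V x)" for x
    using hermitian[of x] unfolding hermitian_matrix_def
    by (metis complex_cnj_minus vector_uminus_component)
  then interpret matrix_weight \<rho> \<gamma>
    by unfold_locales (rule \<gamma>, unfold \<rho>_def, rule matrix_exp_positive)
  show ?thesis
    using rhp_solution_solves[OF n] rhp_solution_unique[OF n] by blast
qed

end
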